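(* Let $n\ge 2$ be a dimension such that (i) every minimizer for the Markov–Dubins problem in $\mathbf{R}^n$ (that is, every shortest curve in some set $\mathcal{C}(p,q;v,w)$) is either a smooth curve with curvature $1$ and positive torsion, or a $C^1$-concatenation of finitely many circular arcs of curvature $1$ and a line segment, and (ii) every $CCC$-curve whose middle arc has length $<\pi$ is not a minimizer (i.e. is not a shortest curve in the set $\mathcal{C}(p,q;v,w)$ determined by its endpoint data). Then $NIR(K,\mathbf{R}^n)=\frac{1}{2}DCSD(K)$ for every relative minimum $K$ of the ropelength $\ell_e$, where $K$ is a union of finitely many disjoint $C^{1,1}$ simple closed curves in $\mathbf{R}^n$.
   Context: A knot/link $K$ is the image of a one-to-one $C^1$ map $\gamma:D\to\mathbf{R}^n$ with $\gamma'\neq 0$, where $D$ is a finite disjoint union of circles. $K$ is $C^{1,1}$ if $\gamma'$ is Lipschitz (for an arclength parametrization). Normal injectivity radius (thickness): $NIR(K,\mathbf{R}^n)=\sup(\{0\}\cup\{r>0: \text{the map } (p,v)\mapsto p+v \text{ restricted to } \{(p,v): p\in K,\ v\perp T_pK,\ \|v\|<r\} \text{ is one-to-one}\})$. Double critical self distance: a pair of distinct points $p,q\in K$ is a double critical pair if the segment $\overline{pq}$ is perpendicular to $K$ at both $p$ and $q$; $DCSD(K)=\inf\{\|p-q\|:\{p,q\}\text{ a double critical pair}\}$. Ropelength: $\ell_e(K)=\ell(K)/NIR(K,\mathbf{R}^n)$, where $\ell$ is total length. A relative minimum of $\ell_e$ is a $K=\gamma(D)$ having a neighborhood $\mathcal{U}$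 of $\gamma$ in the $C^1$ topology such that $\ell_e(\gamma)\le\ell_e(\eta)$ for all $\eta\in\mathcal{U}$ lying in the same knot/link class as $\gamma$ (the free $C^1$ ambient isotopy class of embeddings $D\to\mathbf{R}^n$ with fixed number of components). Markov–Dubins problem: for $p,q,v,w\in\mathbf{R}^n$ with $\|v\|=\|w\|=1$, $\mathcal{C}(p,q;v,w)$ is the set of $C^{1}$ curves from $p$ to $q$ with unit tangent $v$ at $p$ and $w$ at $q$ and (generalized) curvature $\le 1$; a minimizer is a shortest curve in such a set. Generalized curvature of $\gamma$ at $s$: $\kappa\gamma(s)=\limsup_{t\neq u,\ t,u\to s}\frac{\angle(\gamma'(t),\gamma'(u))}{\ell(\gamma([t,u]))}$. A $CCC$-curve is a $C^1$-concatenation of three arcs of circles of curvature $1$, each arc of positive length, with successive arcs having different centers. Torsion (for a $C^3$ arclength-parametrized curve in $\mathbf{R}^n$, $n\ge3$): $\mathbf{T}=\gamma'$, $\kappa=\|\mathbf{T}'\|$, and if $\kappa>0$, $\mathbf{N}=\mathbf{T}'/\kappa$, $\tau=\|\mathbf{N}'+\kappa\mathbf{T}\|\ge0$. *)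

theory Defs
  imports "HOL-Analysis.Analysis"
begin

definition tangent :: "(real \<Rightarrow> 'a::euclidean_space) \<Rightarrow> real \<Rightarrow> real \<Rightarrow> 'a" where
  "tangent \<gamma> L t = vector_derivative \<gamma> (at t within {0..L})"

definition uangle :: "'a::euclidean_space \<Rightarrow> 'a \<Rightarrow> real" where
  "uangle x y = arccos ((x \<bullet> y) / (norm x * norm y))"

definition C1_arclength :: "(real \<Rightarrow> 'a::euclidean_space) \<Rightarrow> real \<Rightarrow> bool" where
  "C1_arclength \<gamma> L \<longleftrightarrow> L > 0 \<and>
     (\<forall>t\<in>{0..L}. \<gamma> differentiable (at t within {0..L})) \<and>
     continuous_on {0..L} (tangent \<gamma> L) \<and>
     (\<forall>t\<in>{0..L}. norm (tangent \<gamma> L t) = 1)"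

text \<open>Generalized curvature (for an arclength parametrization the length of
  gamma([t,u]) is abs(u - t)).\<close>
definition gen_curv :: "(real \<Rightarrow> 'a::euclidean_space) \<Rightarrow> real \<Rightarrow> real \<Rightarrow> ereal" where
  "gen_curv \<gamma> L s = Limsup (at (s, s) within {(t, u). t \<in> {0..L} \<and> u \<in> {0..L} \<and> t \<noteq> u})
      (\<lambda>(t, u). ereal (uangle (tangent \<gamma> L t) (tangent \<gamma> L u) / \<bar>u - t\<bar>))"

definition md_class :: "'a::euclidean_space \<Rightarrow> 'a \<Rightarrow> 'a \<Rightarrow> 'a \<Rightarrow> (real \<Rightarrow> 'a) \<Rightarrow> real \<Rightarrow> bool" where
  "md_class p q v w \<gamma> L \<longleftrightarrow> norm v = 1 \<and> norm w = 1 \<and> C1_arclength \<gamma> L \<and>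
     \<gamma> 0 = p \<and> \<gamma> L = q \<and> tangent \<gamma> L 0 = v \<and> tangent \<gamma> L L = w \<and>
     (\<forall>s\<in>{0..L}. gen_curv \<gamma> L s \<le> 1)"

definition md_minimizer :: "'a::euclidean_space \<Rightarrow> 'a \<Rightarrow> 'a \<Rightarrow> 'a \<Rightarrow> (real \<Rightarrow> 'a) \<Rightarrow> real \<Rightarrow> bool" where
  "md_minimizer p q v w \<gamma> L \<longleftrightarrow> md_class p q v w \<gamma> L \<and>
     (\<forall>\<eta> L'. md_class p q v w \<eta> L' \<longrightarrow> L \<le> L')"

definition smooth_curv1_pos_torsion :: "(real \<Rightarrow> 'a::euclidean_space) \<Rightarrow> real \<Rightarrow> bool" where
  "smooth_curv1_pos_torsion \<gamma> L \<longleftrightarrow>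
     (\<exists>D :: nat \<Rightarrow> real \<Rightarrow> 'a.
        (\<forall>t\<in>{0..L}. D 0 t = \<gamma> t) \<and>
        (\<forall>k. \<forall>t\<in>{0..L}. (D k has_vector_derivative D (Suc k) t) (at t within {0..L})) \<and>
        (\<forall>t\<in>{0..L}. norm (D 2 t) = 1) \<and>
        (\<forall>t\<in>{0..L}.
           norm (vector_derivative (\<lambda>s. (1 / norm (D 2 s)) *\<^sub>R D 2 s) (at t within {0..L})
                 + norm (D 2 t) *\<^sub>R D 1 t) > 0))"

definition unit_arc_on :: "(real \<Rightarrow> 'a::euclidean_space) \<Rightarrow> real \<Rightarrow> real \<Rightarrow> 'a \<Rightarrow> bool" where
  "unit_arc_on \<gamma> a b c \<longleftrightarrow> a < b \<and>
     (\<exists>e1 e2. norm e1 = 1 \<and> norm e2 = 1 \<and> e1 \<bullet> e2 = 0 \<and>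
        (\<forall>s\<in>{a..b}. \<gamma> s = c + cos s *\<^sub>R e1 + sin s *\<^sub>R e2))"

definition segment_on :: "(real \<Rightarrow> 'a::euclidean_space) \<Rightarrow> real \<Rightarrow> real \<Rightarrow> bool" where
  "segment_on \<gamma> a b \<longleftrightarrow> a < b \<and>
     (\<exists>x u. norm u = 1 \<and> (\<forall>s\<in>{a..b}. \<gamma> s = x + s *\<^sub>R u))"

definition arcs_and_segment :: "(real \<Rightarrow> 'a::euclidean_space) \<Rightarrow> real \<Rightarrow> bool" where
  "arcs_and_segment \<gamma> L \<longleftrightarrow> C1_arclength \<gamma> L \<and>
     (\<exists>(k::nat) (s::nat \<Rightarrow> real). s 0 = 0 \<and> s k = L \<and>
        (\<forall>j<k. (\<exists>c. unit_arc_on \<gamma> (s j) (s (Suc j)) c) \<or> segment_on \<gamma> (s j) (s (Suc j))) \<and>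
        card {j. j < k \<and> segment_on \<gamma> (s j) (s (Suc j))} \<le> 1)"

definition CCC_curve :: "(real \<Rightarrow> 'a::euclidean_space) \<Rightarrow> real \<Rightarrow> real \<Rightarrow> real \<Rightarrow> bool" where
  "CCC_curve \<gamma> L a b \<longleftrightarrow> C1_arclength \<gamma> L \<and> 0 < a \<and> a < b \<and> b < L \<and>
     (\<exists>c1 c2 c3. unit_arc_on \<gamma> 0 a c1 \<and> unit_arc_on \<gamma> a b c2 \<and> unit_arc_on \<gamma> b L c3 \<and>
        c1 \<noteq> c2 \<and> c2 \<noteq> c3)"

definition ltan :: "(nat \<Rightarrow> real \<Rightarrow> 'a::euclidean_space) \<Rightarrow> nat \<Rightarrow> real \<Rightarrow> 'a" where
  "ltan \<gamma> i t = vector_derivative (\<gamma> i) (at t)"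

definition is_link :: "nat \<Rightarrow> (nat \<Rightarrow> real \<Rightarrow> 'a::euclidean_space) \<Rightarrow> bool" where
  "is_link m \<gamma> \<longleftrightarrow> m \<ge> 1 \<and>
     (\<forall>i<m. \<forall>t. \<gamma> i (t + 1) = \<gamma> i t) \<and>
     (\<forall>i<m. \<forall>t. \<gamma> i differentiable (at t)) \<and>
     (\<forall>i<m. continuous_on UNIV (ltan \<gamma> i)) \<and>
     (\<forall>i<m. \<forall>t. ltan \<gamma> i t \<noteq> 0) \<and>
     inj_on (\<lambda>(i, t). \<gamma> i t) ({..<m} \<times> {0..<1})"

definition link_image :: "nat \<Rightarrow> (nat \<Rightarrow> real \<Rightarrow> 'a) \<Rightarrow> 'a set" where
  "link_image m \<gamma> = (\<lambda>(i, t). \<gamma> i t) ` ({..<m} \<times> {0..<1})"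

definition link_length :: "nat \<Rightarrow> (nat \<Rightarrow> real \<Rightarrow> 'a::euclidean_space) \<Rightarrow> real" where
  "link_length m \<gamma> = (\<Sum>i<m. integral {0..1} (\<lambda>t. norm (ltan \<gamma> i t)))"

text \<open>C^{1,1}: the derivative of the arclength parametrization is Lipschitz, i.e. the unit
  tangent is Lipschitz with respect to arclength.\<close>
definition C11_link :: "nat \<Rightarrow> (nat \<Rightarrow> real \<Rightarrow> 'a::euclidean_space) \<Rightarrow> bool" where
  "C11_link m \<gamma> \<longleftrightarrow> (\<exists>C. \<forall>i<m. \<forall>s t. s \<le> t \<longrightarrow>
     norm ((1 / norm (ltan \<gamma> i t)) *\<^sub>R ltan \<gamma> i t - (1 / norm (ltan \<gamma> i s)) *\<^sub>R ltan \<gamma> i s)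
       \<le> C * integral {s..t} (\<lambda>r. norm (ltan \<gamma> i r)))"

definition normal_bundle :: "nat \<Rightarrow> (nat \<Rightarrow> real \<Rightarrow> 'a::euclidean_space) \<Rightarrow> real \<Rightarrow> ('a \<times> 'a) set" where
  "normal_bundle m \<gamma> r = {(p, v). \<exists>i<m. \<exists>t. p = \<gamma> i t \<and> v \<bullet> ltan \<gamma> i t = 0 \<and> norm v < r}"

definition NIR :: "nat \<Rightarrow> (nat \<Rightarrow> real \<Rightarrow> 'a::euclidean_space) \<Rightarrow> real" where
  "NIR m \<gamma> = Sup ({0} \<union> {r. r > 0 \<and> inj_on (\<lambda>(p, v). p + v) (normal_bundle m \<gamma> r)})"

definition DCSD :: "nat \<Rightarrow> (nat \<Rightarrow> real \<Rightarrow> 'a::euclidean_space) \<Rightarrow> real" where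
  "DCSD m \<gamma> = Inf {dist p q | p q. \<exists>i j s t. i < m \<and> j < m \<and> p = \<gamma> i s \<and> q = \<gamma> j t \<and> p \<noteq> q \<and>
       (q - p) \<bullet> ltan \<gamma> i s = 0 \<and> (q - p) \<bullet> ltan \<gamma> j t = 0}"

definition ropelength :: "nat \<Rightarrow> (nat \<Rightarrow> real \<Rightarrow> 'a::euclidean_space) \<Rightarrow> ereal" where
  "ropelength m \<gamma> = (if NIR m \<gamma> = 0 then \<infinity> else ereal (link_length m \<gamma> / NIR m \<gamma>))"

definition C1_ambient_isotopy :: "(real \<Rightarrow> 'a::euclidean_space \<Rightarrow> 'a) \<Rightarrow> bool" where
  "C1_ambient_isotopy H \<longleftrightarrow> (\<forall>x. H 0 x = x) \<and>
     continuous_on ({0..1} \<times> UNIV) (\<lambda>(t, x). H t x) \<and>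
     (\<exists>DH :: real \<Rightarrow> 'a \<Rightarrow> 'a \<Rightarrow>\<^sub>L 'a.
        continuous_on ({0..1} \<times> UNIV) (\<lambda>(t, x). DH t x) \<and>
        (\<forall>t\<in>{0..1}. bij (H t) \<and>
           (\<forall>x. (H t has_derivative blinfun_apply (DH t x)) (at x) \<and> inj (blinfun_apply (DH t x)))))"

definition same_link_class :: "nat \<Rightarrow> (nat \<Rightarrow> real \<Rightarrow> 'a::euclidean_space) \<Rightarrow> (nat \<Rightarrow> real \<Rightarrow> 'a) \<Rightarrow> bool" where
  "same_link_class m \<gamma> \<eta> \<longleftrightarrow> is_link m \<gamma> \<and> is_link m \<eta> \<and>
     (\<exists>H. C1_ambient_isotopy H \<and> H 1 ` link_image m \<gamma> = link_image m \<eta>)"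

definition ropelength_rel_min :: "nat \<Rightarrow> (nat \<Rightarrow> real \<Rightarrow> 'a::euclidean_space) \<Rightarrow> bool" where
  "ropelength_rel_min m \<gamma> \<longleftrightarrow> is_link m \<gamma> \<and>
     (\<exists>\<epsilon>>0. \<forall>\<eta>. same_link_class m \<gamma> \<eta> \<and>
        (\<forall>i<m. \<forall>t. norm (\<eta> i t - \<gamma> i t) < \<epsilon> \<and> norm (ltan \<eta> i t - ltan \<gamma> i t) < \<epsilon>)
        \<longrightarrow> ropelength m \<gamma> \<le> ropelength m \<eta>)"

end

theory Submission
  imports Defs
begin

text \<open>Let \<open>R\<close> be the thickness and suppose \<open>2 R < DCSD\<close>. Then near the link, in the \<open>C\<^sup>1\<close> topology, the
  thickness is at least \<open>R\<close> as long as the curvature is at most \<open>1 / R\<close>, so one component, scaled to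
  \<open>R = 1\<close>, is a local minimum of length among closed curves of curvature at most 1. Consider
  first-order variations of its tangent \<open>T\<close> and speed that preserve closedness and the curvature
  bound. They form a convex cone, and only the closing defect (a vector) and the change of length (a
  number) matter, so if no variation shortens the curve a hyperplane in a finite-dimensional space
  separates. Testing it against suitable variations gives a vector \<open>C\<close>, a number \<open>r\<close>, the multiplier
  \<open>lam = r + C \<bullet> T \<ge> 0\<close>, and a periodic solution of \<open>Y' = C + (r - 2 lam) T\<close> with \<open>lam T' = Y\<close> and
  \<open>norm Y = lam\<close>. This equation forces the curve to contain a unit semicircle, whose
  endpoints form a double critical pair at distance \<open>2 R\<close>, a contradiction.\<close>

section \<open>Indefinite integrals and densities of Lipschitz functions\<close>

text \<open>The obstacle is low regularity: the tangent of a C^{1,1} curve is only Lipschitz, so the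
  curvature vector \<open>u\<close> is a bounded measurable function known up to null sets.
  Derivatives are therefore replaced by \<open>indef_integral\<close>, an identity between
  increments and integrals that ignores null sets, and the necessary conditions are found by the du
  Bois-Reymond method, with test variations built from the unknown functions themselves. A
  first-order gain must then be turned into a real curve: half of the gain in length is spent on
  stretching the curve slightly, which makes the curvature condition strict and pays for all
  second-order errors. Parametrizing by the integral of the merely measurable speed factor makes the
  velocity continuous again and keeps the new curve C^1-close. Thickness is controlled without
  second derivatives through tangent balls: the smallest tangent ball that meets the link again, if
  its radius is below the curvature radius, meets it in the antipode of the point of tangency, and
  this produces a double critical pair.\<close>

definition indef_integral :: "(real \<Rightarrow> 'b::euclidean_space) \<Rightarrow> (real \<Rightarrow> 'b) \<Rightarrow> bool" where
  "indef_integral P g \<longleftrightarrow> (\<forall>s t. s \<le> t \<longrightarrow> (g has_integral (P t - P s)) {s..t})"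

lemma indef_integralD: "indef_integral P g \<Longrightarrow> s \<le> t \<Longrightarrow> (g has_integral (P t - P s)) {s..t}"
  unfolding indef_integral_def by blast

lemma indef_integral_exists:
  assumes "\<And>a b. g integrable_on {a..b}"
  shows "\<exists>P. indef_integral P g \<and> P 0 = y"
proof -
  define P where "P t = y + (if t \<ge> 0 then integral {0..t} g else - integral {t..0} g)" for t
  have "P t - P s = integral {s..t} g" if "s \<le> t" for s t
  proof -
    consider "0 \<le> s" | "s < 0" "0 \<le> t" | "t < 0" by linarith
    then show ?thesis
    proof cases
      case 1
      then show ?thesis
        using Henstock_Kurzweil_Integration.integral_combine[where a=0 and c=s and b=t and f=g] that assms by (simp add: P_def algebra_simps)
    next
      case 2
      then show ?thesis
        using Henstock_Kurzweil_Integration.integral_combine[where a=s and c=0 and b=t and f=g] that assms by (simp add: P_def algebra_simps)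
    next
      case 3
      then show ?thesis
        using Henstock_Kurzweil_Integration.integral_combine[where a=s and c=t and b=0 and f=g] that assms by (cases "t = 0") (auto simp: P_def algebra_simps)
    qed
  qed
  then have "indef_integral P g"
    unfolding indef_integral_def using assms by (metis integrable_integral)
  then show ?thesis by (auto simp: P_def intro!: exI[of _ P])
qed

lemma indef_integral_add:
  "indef_integral P f \<Longrightarrow> indef_integral Q g \<Longrightarrow> indef_integral (\<lambda>t. P t + Q t) (\<lambda>t. f t + g t)"
  unfolding indef_integral_def add_diff_add by (auto intro: has_integral_add)

lemma indef_integral_scaleR:
  "indef_integral P f \<Longrightarrow> indef_integral (\<lambda>t. c *\<^sub>R P t) (\<lambda>t. c *\<^sub>R f t)"
  unfolding indef_integral_def scaleR_diff_right[symmetric] by (auto intro: has_integral_cmul)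

lemma indef_integral_bounded_linear:
  "bounded_linear h \<Longrightarrow> indef_integral P f \<Longrightarrow> indef_integral (\<lambda>t. h (P t)) (\<lambda>t. h (f t))"
  unfolding indef_integral_def
  using has_integral_linear[of f _ _ h] by (auto simp: o_def linear_diff[OF bounded_linear.linear, symmetric])

lemma indef_integral_const: "indef_integral (\<lambda>t. c) (\<lambda>t. 0)"
  unfolding indef_integral_def by simp

lemma indef_integral_ident: "indef_integral (\<lambda>t::real. t) (\<lambda>t. 1)"
  unfolding indef_integral_def using has_integral_const_real[of "1::real"] by (simp, metis)

lemma indef_integral_sum:
  "(\<And>i. i \<in> I \<Longrightarrow> indef_integral (P i) (f i)) \<Longrightarrow> finite I \<Longrightarrow>
    indef_integral (\<lambda>t. \<Sum>i\<in>I. P i t) (\<lambda>t. \<Sum>i\<in>I. f i t)"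
  unfolding indef_integral_def by (auto simp flip: sum_subtractf intro!: has_integral_sum)

lemma indef_integral_deriv:
  assumes "indef_integral P f" "isCont f t"
  shows "(P has_vector_derivative f t) (at t)"
  unfolding has_vector_derivative_def has_derivative_at_alt
proof (intro conjI allI impI)
  show "bounded_linear (\<lambda>h. h *\<^sub>R f t)" by (rule bounded_linear_scaleR_left)
  fix e :: real assume "e > 0"
  then obtain d where d: "d > 0" "\<And>x. \<bar>x - t\<bar> < d \<Longrightarrow> norm (f x - f t) < e"
    using assms(2) unfolding continuous_at_eps_delta by (metis dist_norm real_norm_def dist_commute)
  have *: "norm (P y - P x - (y - x) *\<^sub>R f t) \<le> e * (y - x)"
    if "x \<le> y" "\<bar>x - t\<bar> < d" "\<bar>y - t\<bar> < d" for x y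
  proof -
    have "((\<lambda>z. f z - f t) has_integral (P y - P x - (y - x) *\<^sub>R f t)) {x..y}"
      using has_integral_diff[OF indef_integralD[OF assms(1) that(1)] has_integral_const_real[of "f t" x y]] that
      by simp
    then have "norm (P y - P x - (y - x) *\<^sub>R f t) \<le> e * measure lborel {x..y}"
      using d that \<open>e > 0\<close> by (intro has_integral_bound_real[where f = "\<lambda>z. f z - f t"]) (auto intro!: less_imp_le d(2))
    then show ?thesis using that by simp
  qed
  show "\<exists>d>0. \<forall>y. norm (y - t) < d \<longrightarrow> norm (P y - P t - (y - t) *\<^sub>R f t) \<le> e * norm (y - t)"
  proof (intro exI conjI allI impI)
    fix y assume y: "norm (y - t) < d"
    show "norm (P y - P t - (y - t) *\<^sub>R f t) \<le> e * norm (y - t)"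
    proof (cases "t \<le> y")
      case True
      then show ?thesis using *[of t y] y d by auto
    next
      case False
      have "norm (P t - P y - (t - y) *\<^sub>R f t) \<le> e * (t - y)" using *[of y t] y d False by auto
      moreover have "P y - P t - (y - t) *\<^sub>R f t = - (P t - P y - (t - y) *\<^sub>R f t)" by (simp add: algebra_simps)
      ultimately show ?thesis using False by (metis abs_minus_commute abs_of_nonneg diff_ge_0_iff_ge linorder_linear norm_minus_cancel real_norm_def)
    qed
  qed (use d in auto)
qed

lemma indef_integral_lipschitz:
  assumes "indef_integral P g" "\<And>t. norm (g t) \<le> B"
  shows "norm (P t - P s) \<le> B * \<bar>t - s\<bar>"
proof -
  have "B \<ge> 0" using assms(2)[of 0] norm_ge_zero order_trans by blast
  have *: "norm (P t - P s) \<le> B * (t - s)" if "s \<le> t" for s t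
    using has_integral_bound_real[OF \<open>B \<ge> 0\<close> finite.emptyI indef_integralD[OF assms(1) that]] assms(2) that by auto
  show ?thesis
    using *[of s t] *[of t s] by (cases "s \<le> t") (auto simp: norm_minus_commute)
qed

lemma indef_integral_continuous:
  assumes "indef_integral P g" "\<And>t. norm (g t) \<le> B"
  shows "continuous_on UNIV P"
proof -
  have "B \<ge> 0" using assms(2)[of 0] norm_ge_zero order_trans by blast
  then have "B-lipschitz_on UNIV P"
    by (auto intro!: lipschitz_onI simp: dist_norm indef_integral_lipschitz[OF assms])
  then show ?thesis by (rule lipschitz_on_continuous_on)
qed

lemma expanding_inverse:
  fixes F :: "real \<Rightarrow> real"
  assumes c: "c > 0" and F: "\<And>s t. s \<le> t \<Longrightarrow> c * (t - s) \<le> F t - F s" and cont: "continuous_on UNIV F"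
  obtains Fi where "\<And>y. F (Fi y) = y" "\<And>x. Fi (F x) = x" "\<And>x y. \<bar>Fi y - Fi x\<bar> \<le> \<bar>y - x\<bar> / c" "strict_mono F"
proof
  have less: "F s < F t" if "s < t" for s t
    using F[of s t] mult_pos_pos[OF c, of "t - s"] that by simp
  then show mono: "strict_mono F" by (simp add: strict_mono_def)
  have "surj F"
    unfolding surj_def
  proof
    fix y
    \<comment> \<open>The expansion rate \<open>c\<close> bounds the distance from 0 to the preimage
      of \<open>y\<close> by \<open>\<bar>y - F 0\<bar> / c\<close>, so these two points bracket
      it.\<close>
    define a b where "a = min 0 ((y - F 0) / c)" and "b = max 0 ((y - F 0) / c)"
    have "F a \<le> y" "y \<le> F b" "a \<le> b"
      using F[of a 0] F[of 0 b] c by (auto simp: a_def b_def min_def max_def field_simps split: if_splits)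
    then show "\<exists>x. y = F x"
      using IVT'[of F a y b] continuous_on_subset[OF cont] by auto
  qed
  then show FFi: "F (inv F y) = y" for y by (simp add: surj_f_inv_f)
  show "inv F (F x) = x" for x using mono by (simp add: strict_mono_imp_inj_on)
  show "\<bar>inv F y - inv F x\<bar> \<le> \<bar>y - x\<bar> / c" for x y
    using F[of "inv F x" "inv F y"] F[of "inv F y" "inv F x"] FFi c
    by (cases "inv F x \<le> inv F y") (auto simp: field_simps)
qed

text \<open>Passes from an infinitesimal comparison to a global one: telescoping over a partition
  finer than \<open>d\<close> costs only the factor \<open>1 + e\<close>, and then \<open>e\<close>
  tends to 0. With arclength as \<open>S\<close> this turns almost optimal curvature estimates on
  short arcs into the exact bound.\<close>

lemma norm_diff_le_of_local:
  fixes f :: "real \<Rightarrow> 'b::real_normed_vector" and S :: "real \<Rightarrow> real"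
  assumes "a \<le> b"
    and loc: "\<And>e. e > 0 \<Longrightarrow> \<exists>d>0. \<forall>s t. a \<le> s \<and> s \<le> t \<and> t \<le> b \<and> t - s < d \<longrightarrow>
       norm (f t - f s) \<le> (1 + e) * (S t - S s)"
  shows "norm (f b - f a) \<le> S b - S a"
proof -
  have *: "norm (f b - f a) \<le> (1 + e) * (S b - S a)" if e: "e > 0" for e
  proof -
    obtain d where d: "d > 0" "\<And>s t. a \<le> s \<Longrightarrow> s \<le> t \<Longrightarrow> t \<le> b \<Longrightarrow> t - s < d \<Longrightarrow>
       norm (f t - f s) \<le> (1 + e) * (S t - S s)" using loc[OF e] by metis
    obtain n :: nat where n: "(b - a) / d < real n" using reals_Archimedean2 by blast
    have n0: "n > 0" using n d(1) \<open>a \<le> b\<close> by (cases n) (auto simp: divide_less_0_iff not_less)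
    define x where "x k = a + real k * ((b - a) / real n)" for k
    have step: "x (Suc k) - x k = (b - a) / real n" for k
    proof -
      have "real (Suc k) * y = real k * y + y" for y :: real by (simp add: ring_distribs)
      then show ?thesis unfolding x_def by (metis add_diff_cancel_left' add.assoc)
    qed
    have small: "(b - a) / real n < d" using n n0 d(1) by (simp add: field_simps)
    have le: "x k \<le> b" if "k \<le> n" for k
    proof -
      have "real k * ((b - a) / real n) \<le> real n * ((b - a) / real n)"
        using that \<open>a \<le> b\<close> by (intro mult_right_mono) auto
      then show ?thesis using n0 by (simp add: x_def)
    qed
    have "norm (f (x k) - f a) \<le> (1 + e) * (S (x k) - S a)" if "k \<le> n" for k
      using that
    proof (induction k)
      case 0 then show ?case by (simp add: x_def)
    next
      case (Suc k)
      have "norm (f (x (Suc k)) - f (x k)) \<le> (1 + e) * (S (x (Suc k)) - S (x k))"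
      proof (rule d(2))
        have "0 \<le> (b - a) / real n" using \<open>a \<le> b\<close> by simp
        then show "x k \<le> x (Suc k)" using step[of k] by linarith
        show "a \<le> x k" using mult_nonneg_nonneg[OF _ \<open>0 \<le> (b - a) / real n\<close>, of "real k"] by (simp add: x_def)
        show "x (Suc k) - x k < d" using step[of k] small by simp
      qed (rule le[OF Suc.prems])
      moreover have "norm (f (x (Suc k)) - f a) \<le> norm (f (x (Suc k)) - f (x k)) + norm (f (x k) - f a)"
        using norm_triangle_ineq[of "f (x (Suc k)) - f (x k)" "f (x k) - f a"] by simp
      ultimately show ?case using Suc by (simp add: algebra_simps)
    qed
    from this[of n] show ?thesis using n0 by (simp add: x_def)
  qed
  \<comment> \<open>The sign needed to let \<open>e\<close> tend to 0 is read off from the case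
    \<open>e = 1\<close>.\<close>
  then have "S b - S a \<ge> 0" using order_trans[OF norm_ge_zero *[of 1]] by simp
  show ?thesis
  proof (rule field_le_epsilon)
    fix e :: real assume e: "e > 0"
    define h where "h = e / (S b - S a + 1)"
    have "h > 0" using e \<open>S b - S a \<ge> 0\<close> by (simp add: h_def)
    moreover have "h * (S b - S a) \<le> e"
      using e \<open>S b - S a \<ge> 0\<close> by (simp add: h_def field_simps)
    ultimately show "norm (f b - f a) \<le> S b - S a + e"
      using *[of h] by (simp add: algebra_simps)
  qed
qed

lemma bdd_borel_integrable:
  fixes g :: "real \<Rightarrow> 'b::euclidean_space"
  assumes "g \<in> borel_measurable borel" "\<And>t. norm (g t) \<le> B"
  shows "g integrable_on {a..b}"
proof (rule measurable_bounded_by_integrable_imp_integrable[where g = "\<lambda>_. B"])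
  have "g \<in> borel_measurable lebesgue" using assms(1) by (simp add: borel_measurable_if_I measurable_completion)
  then show "g \<in> borel_measurable (lebesgue_on {a..b})" by (simp add: measurable_restrict_space1)
qed (use assms in auto)

text \<open>Adding a linear term makes \<open>g\<close> a bi-Lipschitz increasing bijection
  \<open>F\<close>. The measure that assigns to a set the length of its image under \<open>F\<close>
  is absolutely continuous, because Lipschitz maps preserve null sets, and its Radon-Nikodym density
  is the density of \<open>F\<close>; the linear term is removed at the end.\<close>

lemma lipschitz_real_density:
  fixes g :: "real \<Rightarrow> real"
  assumes lip: "\<And>s t. \<bar>g t - g s\<bar> \<le> K * \<bar>t - s\<bar>"
  shows "\<exists>d. indef_integral g d"
proof -
  have K: "K \<ge> 0" using lip[of 1 0] abs_ge_zero[of "g 1 - g 0"] by simp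
  define F where "F x = g x + (K + 1) * x" for x
  have F_diff: "t - s \<le> F t - F s" "F t - F s \<le> (2*K+1) * (t - s)" if "s \<le> t" for s t
    using lip[of t s] that by (auto simp: F_def algebra_simps abs_le_iff)
  have Fcont: "continuous_on UNIV F"
  proof -
    have "K-lipschitz_on UNIV g" using lip K by (auto intro!: lipschitz_onI simp: dist_real_def)
    then show ?thesis unfolding F_def by (intro continuous_intros lipschitz_on_continuous_on)
  qed
  obtain Fi where FFi: "\<And>y. F (Fi y) = y" and FiF: "\<And>x. Fi (F x) = x"
    and Filip: "\<And>x y. \<bar>Fi y - Fi x\<bar> \<le> \<bar>y - x\<bar> / 1" and Fmono: "strict_mono F"
    using expanding_inverse[OF zero_less_one _ Fcont] F_diff(1) by (metis mult_1)
  have Fim: "Fi \<in> borel_measurable borel"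
  proof (rule borel_measurable_continuous_onI)
    have "1-lipschitz_on UNIV Fi" using Filip by (auto intro!: lipschitz_onI simp: dist_real_def)
    then show "continuous_on UNIV Fi" by (rule lipschitz_on_continuous_on)
  qed
  \<comment> \<open>The Stieltjes measure of \<open>F\<close>, realized as the image of Lebesgue
    measure under the inverse of \<open>F\<close>.\<close>
  define M where "M = distr lborel borel Fi"
  have emM: "emeasure M A = emeasure lborel (F ` A)" if "A \<in> sets borel" for A
  proof -
    have "Fi -` A = F ` A" by (metis FFi FiF image_eqI image_subset_iff subsetI subset_antisym vimageE vimageI)
    then show ?thesis unfolding M_def using that Fim by (simp add: emeasure_distr)
  qed
  have ac: "absolutely_continuous lborel M"
    unfolding absolutely_continuous_def
  proof
    fix N :: "real set" assume N: "N \<in> null_sets lborel"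
    then have "negligible N" by (simp add: negligible_iff_null_sets null_sets_completionI)
    then have "negligible (F ` N)"
    proof (rule negligible_locally_Lipschitz_image[rotated])
      fix x assume "x \<in> N"
      have "norm (F y - F x) \<le> (2*K+1) * norm (y - x)" for y
        using F_diff[of x y] F_diff[of y x] by (cases "x \<le> y") (auto simp: algebra_simps)
      then show "\<exists>T B. open T \<and> x \<in> T \<and> (\<forall>y\<in>N \<inter> T. norm (F y - F x) \<le> B * norm (y - x))"
        by (metis UNIV_I open_UNIV)
    qed simp
    moreover have "F ` N = Fi -` N" by (metis FFi FiF image_eqI image_subset_iff subsetI subset_antisym vimageE vimageI)
    moreover have "Fi -` N \<in> sets borel" using N Fim measurable_sets[OF Fim, of N] by auto
    ultimately have "emeasure lborel (F ` N) = 0"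
      by (simp add: negligible_iff_null_sets null_sets_def)
    then show "N \<in> null_sets M" using N emM by (auto simp: null_sets_def M_def)
  qed
  obtain f where f: "f \<in> borel_measurable lborel" "density lborel f = M"
    using sigma_finite_measure.Radon_Nikodym[OF sigma_finite_lborel ac] by (auto simp: M_def)
  have nnf: "(\<integral>\<^sup>+x. f x * indicator {s..t} x \<partial>lborel) = ennreal (F t - F s)" if "s \<le> t" for s t
  proof -
    have "F ` {s..t} = {F s..F t}"
    proof
      show "F ` {s..t} \<subseteq> {F s..F t}" using Fmono by (auto simp: strict_mono_less_eq)
      show "{F s..F t} \<subseteq> F ` {s..t}"
      proof
        fix y assume "y \<in> {F s..F t}"
        then show "y \<in> F ` {s..t}" using FFi Fmono by (metis atLeastAtMost_iff image_eqI strict_mono_less_eq)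
      qed
    qed
    then have "emeasure M {s..t} = ennreal (F t - F s)"
      using emM[of "{s..t}"] that Fmono by (simp add: strict_mono_less_eq)
    then show ?thesis using f(1) by (simp flip: f(2) add: emeasure_density)
  qed
  have fin: "AE x in lborel. f x \<noteq> \<infinity>"
  proof -
    have "AE x in lborel. \<forall>n::nat. f x * indicator {-real n..real n} x \<noteq> \<infinity>"
      unfolding AE_all_countable
      by (intro allI nn_integral_PInf_AE) (use f(1) nnf in auto)
    then show ?thesis
    proof eventually_elim
      case (elim x)
      obtain n :: nat where "\<bar>x\<bar> \<le> real n" using real_arch_simple by blast
      then show ?case using elim[rule_format, of n] by (auto simp: indicator_def abs_le_iff split: if_splits)
    qed
  qed
  define d where "d x = enn2real (f x)" for x
  have dm: "d \<in> borel_measurable borel" using f(1) unfolding d_def by simp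
  have "indef_integral F d"
    unfolding indef_integral_def
  proof (intro allI impI)
    fix s t :: real assume st: "s \<le> t"
    have "(\<integral>\<^sup>+x. ennreal (d x * indicator {s..t} x) \<partial>lborel) = (\<integral>\<^sup>+x. f x * indicator {s..t} x \<partial>lborel)"
      by (rule nn_integral_cong_AE)
        (use fin in \<open>auto simp: d_def indicator_def less_top elim!: eventually_mono\<close>)
    moreover have "(\<lambda>x. d x * indicator {s..t} x) \<in> borel_measurable borel"
      using dm by measurable
    ultimately have "((\<lambda>x. d x * indicator {s..t} x) has_integral (F t - F s)) UNIV"
      using nnf[OF st] F_diff[OF st] st
      by (intro nn_integral_has_integral) (simp_all add: d_def)
    moreover have "(\<lambda>x. d x * indicator {s..t} x) = (\<lambda>x. if x \<in> {s..t} then d x else 0)"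
      by (auto simp: indicator_def)
    ultimately show "(d has_integral (F t - F s)) {s..t}"
      using has_integral_restrict_UNIV[of "{s..t}" d] by metis
  qed
  then have "indef_integral (\<lambda>x. F x + (-(K+1)) *\<^sub>R x) (\<lambda>x. d x + (-(K+1)) *\<^sub>R 1)"
    by (intro indef_integral_add indef_integral_scaleR indef_integral_ident)
  moreover have "(\<lambda>x. F x + (-(K+1)) *\<^sub>R x) = g" by (rule ext) (simp add: F_def ring_distribs)
  ultimately show ?thesis by metis
qed

text \<open>The density is taken as a limit of difference quotients, so that it inherits the Lipschitz
  bound and the periodicity of \<open>T\<close> at every point and not only almost everywhere.\<close>

lemma lipschitz_density:
  fixes T :: "real \<Rightarrow> 'b::euclidean_space"
  assumes lip: "\<And>s t. norm (T t - T s) \<le> K * \<bar>t - s\<bar>"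
    and per: "\<And>t. T (t + l) = T t"
  obtains u where "u \<in> borel_measurable borel" "\<And>t. norm (u t) \<le> K" "\<And>t. u (t + l) = u t"
    "indef_integral T u"
proof -
  have K: "K \<ge> 0" using order_trans[OF norm_ge_zero lip[of 1 0]] by simp
  have "\<forall>b\<in>Basis. \<exists>d. indef_integral (\<lambda>t. T t \<bullet> b) d"
  proof
    fix b :: 'b assume "b \<in> Basis"
    then show "\<exists>d. indef_integral (\<lambda>t. T t \<bullet> b) d"
      by (intro lipschitz_real_density[where K = K])
        (metis Basis_le_norm inner_diff_left lip order_trans)
  qed
  then obtain d where d: "\<And>b. b \<in> Basis \<Longrightarrow> indef_integral (\<lambda>t. T t \<bullet> b) (d b)" by metis
  define v where "v t = (\<Sum>b\<in>Basis. d b t *\<^sub>R b)" for t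
  have "indef_integral (\<lambda>t. \<Sum>b\<in>Basis. (T t \<bullet> b) *\<^sub>R b) v"
    unfolding v_def
    by (intro indef_integral_sum indef_integral_bounded_linear[OF bounded_linear_scaleR_left]) (use d in auto)
  then have v: "indef_integral T v" by (simp add: euclidean_representation)
  have vint: "v integrable_on cbox a b" for a b
    using v indef_integralD[OF v, of a b] by (cases "a \<le> b") (auto simp: integrable_on_def)
  \<comment> \<open>Lebesgue differentiation: off the null set \<open>N\<close> the averages of
    \<open>v\<close> over \<open>[x, x + h]\<close> tend to \<open>v x\<close>.\<close>
  obtain N where N: "negligible N"
    and Nd: "\<And>x e. \<lbrakk>x \<notin> N; 0 < e\<rbrakk> \<Longrightarrow>
         \<exists>d>0. \<forall>h. 0 < h \<and> h < d \<longrightarrow> norm(integral (cbox x (x + h *\<^sub>R One)) v /\<^sub>R h ^ DIM(real) - v x) < e"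
    using integrable_ccontinuous_explicit[OF vint] by blast
  define q where "q n t = real (Suc n) *\<^sub>R (T (t + inverse (real (Suc n))) - T t)" for n t
  \<comment> \<open>The default 0 where the quotients diverge respects both the bound and the
    period.\<close>
  define u where "u t = (if Cauchy (\<lambda>n. q n t) then lim (\<lambda>n. q n t) else 0)" for t
  have qm: "q n \<in> borel_measurable borel" for n
  proof -
    have "K-lipschitz_on UNIV T" using lip K by (auto intro!: lipschitz_onI simp: dist_norm)
    then have c: "continuous_on UNIV T" by (rule lipschitz_on_continuous_on)
    have "continuous_on UNIV (q n)" unfolding q_def
      by (intro continuous_intros continuous_on_compose2[OF c]) auto
    then show ?thesis by (rule borel_measurable_continuous_onI)
  qed
  have uv: "u x = v x" if xN: "x \<notin> N" for x
  proof -
    have "(\<lambda>n. q n x) \<longlonglongrightarrow> v x"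
    proof (rule LIMSEQ_I)
      fix e :: real assume "e > 0"
      then obtain d where d: "d > 0"
        "\<And>h. 0 < h \<Longrightarrow> h < d \<Longrightarrow> norm(integral (cbox x (x + h)) v /\<^sub>R h - v x) < e"
        using Nd[OF xN \<open>e > 0\<close>] by auto
      obtain n0 where n0: "inverse (real (Suc n0)) < d" using reals_Archimedean[OF d(1)] by blast
      show "\<exists>no. \<forall>n\<ge>no. norm (q n x - v x) < e"
      proof (intro exI allI impI)
        fix n assume "n \<ge> n0"
        define h where "h = inverse (real (Suc n))"
        have h: "0 < h" "h < d" using n0 le_imp_inverse_le[of "real (Suc n0)" "real (Suc n)"] \<open>n \<ge> n0\<close> unfolding h_def
          by (auto simp del: inverse_le_iff_le)
        have "integral (cbox x (x + h)) v = T (x + h) - T x"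
          using indef_integralD[OF v, of x "x + h"] h by (simp add: integral_unique)
        moreover have "q n x = (T (x + h) - T x) /\<^sub>R h" by (simp add: q_def h_def)
        ultimately show "norm (q n x - v x) < e" using d(2)[OF h] by simp
      qed
    qed
    then show ?thesis unfolding u_def by (simp add: limI LIMSEQ_imp_Cauchy)
  qed
  show ?thesis
  proof
    have [measurable]: "q n \<in> borel_measurable borel" for n by (rule qm)
    show "u \<in> borel_measurable borel"
      unfolding u_def[abs_def] by measurable
    show "norm (u t) \<le> K" for t
    proof (cases "Cauchy (\<lambda>n. q n t)")
      case True
      then have "(\<lambda>n. q n t) \<longlonglongrightarrow> u t" by (simp add: u_def Cauchy_convergent_iff convergent_LIMSEQ_iff)
      moreover have "norm (q n t) \<le> K" for n
      proof -
        define h where "h = inverse (real (Suc n))"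
        have h: "h > 0" by (simp add: h_def)
        have q: "q n t = (1 / h) *\<^sub>R (T (t + h) - T t)" unfolding q_def h_def by (simp add: field_simps)
        have "norm (T (t + h) - T t) \<le> K * h" using lip[of "t + h" t] h by simp
        then show ?thesis using h by (simp add: q divide_simps mult.commute)
      qed
      ultimately show ?thesis by (intro Lim_norm_ubound[of sequentially]) auto
    qed (use K in \<open>simp add: u_def\<close>)
    show "u (t + l) = u t" for t
    proof -
      have "q n (t + l) = q n t" for n
        using per[of "t + inverse (real (Suc n))"] per[of t] by (simp add: q_def algebra_simps)
      then show ?thesis by (simp add: u_def)
    qed
    show "indef_integral T u"
      unfolding indef_integral_def
      by (intro allI impI has_integral_spike[OF N _ indef_integralD[OF v]]) (auto simp: uv)
  qed
qed

section \<open>The adjoint equation\<close>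

lemma norm_add_scaleR_square:
  fixes a b :: "'a::real_inner"
  shows "(norm (a + c *\<^sub>R b))\<^sup>2 = (norm a)\<^sup>2 + 2 * (c * (a \<bullet> b)) + c\<^sup>2 * (norm b)\<^sup>2"
  unfolding power2_norm_eq_inner
  by (simp add: inner_add_left inner_add_right inner_commute[of b a] power2_eq_square algebra_simps)

lemma has_real_derivativeI:
  "(f has_derivative (\<lambda>h. h * c)) F \<Longrightarrow> (f has_real_derivative c) F"
  unfolding has_field_derivative_def by (erule has_derivative_eq_rhs) (simp add: fun_eq_iff)

lemma periodic_of_int:
  fixes f :: "real \<Rightarrow> 'b"
  assumes "\<And>t. f (t + l) = f t"
  shows "f (t + of_int k * l) = f t"
proof (induction k rule: int_induct[where k = 0])
  case base then show ?case by simp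
next
  case (step1 i) then show ?case using assms[of "t + of_int i * l"] by (simp add: algebra_simps)
next
  case (step2 i) then show ?case using assms[of "t + of_int (i - 1) * l"] by (simp add: algebra_simps)
qed

text \<open>A nondecreasing periodic function is squeezed between its values at \<open>t - l\<close>
  and \<open>t + l\<close>, hence constant.\<close>

lemma periodic_nonneg_deriv_eq_0:
  fixes f f' :: "real \<Rightarrow> real"
  assumes "l > 0" and per: "\<And>t. f (t + l) = f t"
    and d: "\<And>t. (f has_real_derivative f' t) (at t)" and nn: "\<And>t. f' t \<ge> 0"
  shows "f' t = 0"
proof -
  have mono: "f x \<le> f y" if "x \<le> y" for x y
    using DERIV_nonneg_imp_nondecreasing[OF that] d nn by metis
  have "f x = f (t - l)" if "x \<in> {t - l<..<t + l}" for x
    using mono[of "t - l" x] mono[of x "t + l"] that per[of t] per[of "t - l"] by simp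
  then have "((\<lambda>x. f (t - l)) has_real_derivative f' t) (at t)"
    using \<open>l > 0\<close> by (intro has_field_derivative_transform_within_open[where S = "{t - l<..<t + l}", OF d]) auto
  then show ?thesis using DERIV_unique DERIV_const by blast
qed

text \<open>Uniqueness for a linear system by conservation of energy: the deviations
  \<open>A\<close> and \<open>B\<close> from the explicit rotation solve the same system, so
  \<open>E\<close> is constant, and it vanishes at \<open>m\<close>.\<close>

lemma circle_ode:
  fixes T N :: "real \<Rightarrow> 'a::real_inner"
  assumes T: "\<And>t. t \<in> {a<..<b} \<Longrightarrow> (T has_vector_derivative N t) (at t)"
    and N: "\<And>t. t \<in> {a<..<b} \<Longrightarrow> (N has_vector_derivative - T t) (at t)"
    and m: "m \<in> {a<..<b}" and t: "t \<in> {a<..<b}"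
  shows "T t = cos (t - m) *\<^sub>R T m + sin (t - m) *\<^sub>R N m"
proof -
  define A where "A t = T t - (cos (t - m) *\<^sub>R T m + sin (t - m) *\<^sub>R N m)" for t
  define B where "B t = N t - (cos (t - m) *\<^sub>R N m - sin (t - m) *\<^sub>R T m)" for t
  have A: "(A has_vector_derivative B t) (at t)" if "t \<in> {a<..<b}" for t
    unfolding A_def B_def using that
    by (auto intro!: derivative_eq_intros T)
  have B: "(B has_vector_derivative - A t) (at t)" if "t \<in> {a<..<b}" for t
    unfolding A_def B_def using that
    by (auto intro!: derivative_eq_intros N simp: algebra_simps)
  define E where "E t = A t \<bullet> A t + B t \<bullet> B t" for t
  have E: "(E has_real_derivative 0) (at t)" if "t \<in> {a<..<b}" for t
  proof -
    note A' = A[OF that, unfolded has_vector_derivative_def]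
    note B' = B[OF that, unfolded has_vector_derivative_def]
    have "(E has_derivative (\<lambda>h. h * 0)) (at t)"
      unfolding E_def
      by (rule derivative_eq_intros A' B' refl)+ (simp add: fun_eq_iff inner_commute)
    then show ?thesis by (rule has_real_derivativeI)
  qed
  have "E t = E m"
  proof (rule has_derivative_zero_unique_connected[of "{a<..<b}" E])
    show "\<And>x. x \<in> {a<..<b} \<Longrightarrow> (E has_derivative (\<lambda>h. 0)) (at x)"
      using E by (simp add: has_field_derivative_def lambda_zero)
  qed (use m t in auto)
  also have "E m = 0" by (simp add: E_def A_def B_def)
  finally have "A t \<bullet> A t = 0"
    using inner_ge_zero[of "A t"] inner_ge_zero[of "B t"] unfolding E_def by linarith
  then show ?thesis by (simp add: A_def)
qed

lemma zero_interval:
  fixes f :: "real \<Rightarrow> real"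
  assumes c: "continuous_on UNIV f" and x: "x1 \<le> t0" "t0 \<le> x2" "f x1 = 0" "f x2 = 0" "f t0 \<noteq> 0"
  obtains a b where "a < t0" "t0 < b" "f a = 0" "f b = 0" "\<And>t. t \<in> {a<..<b} \<Longrightarrow> f t \<noteq> 0"
proof -
  have cl: "closed {t. f t = 0}"
    using c by (intro closed_Collect_eq) auto
  have "compact ({x1..t0} \<inter> {t. f t = 0})" "{x1..t0} \<inter> {t. f t = 0} \<noteq> {}"
    using x cl by (auto intro: compact_Int_closed)
  then obtain a where a: "a \<in> {x1..t0} \<inter> {t. f t = 0}" "\<And>t. t \<in> {x1..t0} \<inter> {t. f t = 0} \<Longrightarrow> t \<le> a"
    using compact_attains_sup by metis
  have "compact ({t0..x2} \<inter> {t. f t = 0})" "{t0..x2} \<inter> {t. f t = 0} \<noteq> {}"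
    using x cl by (auto intro: compact_Int_closed)
  then obtain b where b: "b \<in> {t0..x2} \<inter> {t. f t = 0}" "\<And>t. t \<in> {t0..x2} \<inter> {t. f t = 0} \<Longrightarrow> b \<le> t"
    using compact_attains_inf by metis
  show ?thesis
  proof
    show "a < t0" "t0 < b" using a b x by (auto simp: less_le)
    show "f a = 0" "f b = 0" using a b by auto
    fix t assume "t \<in> {a<..<b}"
    then show "f t \<noteq> 0" using a(1) b(1) a(2)[of t] b(2)[of t] by (cases "t \<le> t0") auto
  qed
qed

lemma semicircle_chord:
  fixes T G :: "real \<Rightarrow> 'a::real_inner"
  assumes G: "\<And>t. (G has_vector_derivative T t) (at t)"
    and T: "\<And>t. t \<in> {a..a + pi} \<Longrightarrow> T t = cos (t - m) *\<^sub>R e1 + sin (t - m) *\<^sub>R e2"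
    and e: "norm e1 = 1" "norm e2 = 1" "e1 \<bullet> e2 = 0"
  shows "T (a + pi) = - T a" "(G (a + pi) - G a) \<bullet> T a = 0" "norm (G (a + pi) - G a) = 2"
proof -
  \<comment> \<open>Subtracting an antiderivative of the explicit tangent leaves a function that is
    constant on the arc.\<close>
  define F where "F t = G t - (sin (t - m) *\<^sub>R e1 - cos (t - m) *\<^sub>R e2)" for t
  have "(F has_vector_derivative 0) (at t within {a..a+pi})" if "t \<in> {a..a + pi}" for t
    unfolding F_def using T[OF that]
    by (auto intro!: derivative_eq_intros has_vector_derivative_at_within[OF G])
  then obtain c where "\<And>t. t \<in> {a..a+pi} \<Longrightarrow> F t = c"
    using has_vector_derivative_zero_constant[of "{a..a+pi}" F] by auto
  then have "F (a + pi) = F a" using pi_ge_zero by simp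
  then have eq: "G (a + pi) - G a = (-2 * sin (a - m)) *\<^sub>R e1 + (2 * cos (a - m)) *\<^sub>R e2"
  proof -
    have *: "x = y + p - q" if "x - p = y - q" for x y p q :: 'a
      using that by (simp add: algebra_simps)
    have am: "a + pi - m = (a - m) + pi" by simp
    have "G (a + pi) = G a + (sin (a + pi - m) *\<^sub>R e1 - cos (a + pi - m) *\<^sub>R e2)
        - (sin (a - m) *\<^sub>R e1 - cos (a - m) *\<^sub>R e2)"
      by (rule *) (use \<open>F (a + pi) = F a\<close> in \<open>simp only: F_def\<close>)
    then have 1: "G (a + pi) - G a = - (sin (a - m) *\<^sub>R e1) - sin (a - m) *\<^sub>R e1
        + (cos (a - m) *\<^sub>R e2 + cos (a - m) *\<^sub>R e2)"
      unfolding am by simp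
    have 2: "- 2 * x = - x - x" "2 * x = x + x" for x :: real by simp_all
    show ?thesis unfolding 1 2 by (simp only: scaleR_left_distrib scaleR_left_diff_distrib scaleR_minus_left)
  qed
  have Ta: "T a = cos (a - m) *\<^sub>R e1 + sin (a - m) *\<^sub>R e2" using T pi_ge_zero by simp
  have "T (a + pi) = cos (a - m + pi) *\<^sub>R e1 + sin (a - m + pi) *\<^sub>R e2"
    using T[of "a + pi"] pi_ge_zero by (simp add: algebra_simps)
  then show "T (a + pi) = - T a" by (simp add: Ta)
  have ee: "e1 \<bullet> e1 = 1" "e2 \<bullet> e2 = 1" "e2 \<bullet> e1 = 0" using e by (simp_all add: dot_square_norm inner_commute)
  show "(G (a + pi) - G a) \<bullet> T a = 0"
    by (simp add: eq Ta inner_simps ee e)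
  have "(norm (G (a + pi) - G a))\<^sup>2 = 4 * ((sin (a - m))\<^sup>2 + (cos (a - m))\<^sup>2)"
    unfolding power2_norm_eq_inner eq
    by (simp add: inner_add_left inner_add_right inner_diff_left inner_diff_right ee e power2_eq_square)
  then have "(norm (G (a + pi) - G a))\<^sup>2 = 2\<^sup>2" by simp
  then show "norm (G (a + pi) - G a) = 2" by (rule power2_eq_imp_eq) auto
qed

text \<open>The equation for \<open>Y\<close> is the adjoint equation of minimising length under the bound 1 on
  curvature; \<open>J\<close> is its first integral. If the multiplier \<open>lam\<close> vanishes somewhere then \<open>J = 0\<close>,
  otherwise \<open>C \<bullet> N + C \<bullet> G\<close> is periodic with derivative \<open>J / lam\<^sup>3\<close>, so again \<open>J = 0\<close>. Either way
  the normal satisfies \<open>N' = -T\<close>, which is a unit circle.\<close>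

lemma adjoint_ode_semicircle_normalized:
  fixes T Y G :: "real \<Rightarrow> 'a::real_inner"
  assumes l: "l > 0"
    and G: "\<And>t. (G has_vector_derivative T t) (at t)" and Gper: "\<And>t. G (t + l) = G t"
    and T1: "\<And>t. norm (T t) = 1" and Tper: "\<And>t. T (t + l) = T t" and Tcont: "continuous_on UNIV T"
    and lam: "\<And>t. lam t = 1 + C \<bullet> T t" and lam0: "\<And>t. lam t \<ge> 0"
    and Y: "\<And>t. (Y has_vector_derivative (C + (1 - 2 * lam t) *\<^sub>R T t)) (at t)"
    and Yper: "\<And>t. Y (t + l) = Y t"
    and Ynorm: "\<And>t. norm (Y t) = lam t"
    and T': "\<And>t. lam t > 0 \<Longrightarrow> (T has_vector_derivative (1 / lam t) *\<^sub>R Y t) (at t)"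
  shows "\<exists>a. T (a + pi) = - T a \<and> (G (a + pi) - G a) \<bullet> T a = 0 \<and> norm (G (a + pi) - G a) = 2"
proof -
  note Gd = G[unfolded has_vector_derivative_def]
  note Yd = Y[unfolded has_vector_derivative_def]
  have TT: "T t \<bullet> T t = 1" for t using T1[of t] by (simp add: dot_square_norm)
  have YY: "Y t \<bullet> Y t = (lam t)\<^sup>2" for t using Ynorm[of t] by (simp add: dot_square_norm)
  have TY: "T t \<bullet> Y t = 0" for t
  proof (cases "lam t > 0")
    case True
    note d = T'[OF True, unfolded has_vector_derivative_def]
    have "((\<lambda>s. T s \<bullet> T s) has_derivative (\<lambda>h. h * (2 / lam t * (T t \<bullet> Y t)))) (at t)"
      by (rule derivative_eq_intros d refl)+ (simp add: fun_eq_iff inner_commute)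
    then have "((\<lambda>s. 1) has_real_derivative (2 / lam t * (T t \<bullet> Y t))) (at t)"
      unfolding TT by (rule has_real_derivativeI)
    then have "2 / lam t * (T t \<bullet> Y t) = 0" using DERIV_unique DERIV_const by blast
    then show ?thesis using True by simp
  next
    case False
    then have "Y t = 0" using lam0[of t] Ynorm[of t] by simp
    then show ?thesis by simp
  qed
  have CT: "C \<bullet> T t = lam t - 1" for t using lam[of t] by simp
  define q where "q t = C \<bullet> Y t" for t
  define c2 where "c2 = C \<bullet> C"
  have q': "(q has_real_derivative (c2 + (1 - 2 * lam t) * (lam t - 1))) (at t)" for t
  proof -
    have "(q has_derivative (\<lambda>h. h * (c2 + (1 - 2 * lam t) * (lam t - 1)))) (at t)"
      unfolding q_def c2_def
      by (rule derivative_eq_intros Yd refl)+ (simp add: fun_eq_iff inner_simps CT)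
    then show ?thesis by (rule has_real_derivativeI)
  qed
  have lam': "(lam has_real_derivative (q t / lam t)) (at t)" if "lam t > 0" for t
  proof -
    note d = T'[OF that, unfolded has_vector_derivative_def]
    have "((\<lambda>t. 1 + C \<bullet> T t) has_derivative (\<lambda>h. h * (q t / lam t))) (at t)"
      unfolding q_def by (rule derivative_eq_intros d refl)+ (simp add: fun_eq_iff)
    then show ?thesis unfolding lam[symmetric] by (rule has_real_derivativeI)
  qed
  \<comment> \<open>\<open>J t\<close> is the Gram determinant of \<open>C\<close>,
    \<open>T t\<close> and \<open>Y t\<close>. Where \<open>lam t > 0\<close> it vanishes exactly
    when \<open>C\<close> lies in the plane of tangent and normal.\<close>
  define J where "J t = (lam t)\<^sup>2 * (c2 - (lam t - 1)\<^sup>2) - (q t)\<^sup>2" for t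
  have J': "(J has_real_derivative 0) (at t)" if "lam t > 0" for t
    unfolding J_def using that
    by (auto intro!: derivative_eq_intros q' lam' simp: divide_simps) (simp add: algebra_simps power2_eq_square)
  define N where "N t = (1 / lam t) *\<^sub>R Y t" for t
  \<comment> \<open>The part of \<open>C\<close> orthogonal to \<open>T t\<close> and
    \<open>Y t\<close>. The formula for the derivative of \<open>N\<close> below shows that
    \<open>norm (Q t) / lam t\<close> is the torsion where \<open>lam t > 0\<close>.\<close>
  define Q where "Q t = C - (lam t - 1) *\<^sub>R T t - (q t / (lam t)\<^sup>2) *\<^sub>R Y t" for t
  have CQ: "C \<bullet> Q t = J t / (lam t)\<^sup>2" if "lam t > 0" for t
    using that unfolding Q_def J_def
    by (simp add: inner_simps CT c2_def[symmetric] q_def[symmetric] divide_simps) (simp add: power2_eq_square algebra_simps)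
  have QQ: "Q t \<bullet> Q t = J t / (lam t)\<^sup>2" if "lam t > 0" for t
  proof -
    have "Q t \<bullet> T t = 0" unfolding Q_def by (simp add: inner_simps CT TT inner_commute[of "Y t"] TY)
    moreover have "Q t \<bullet> Y t = 0" unfolding Q_def
      using that by (simp add: inner_simps TY YY q_def[symmetric])
    moreover have "Q t \<bullet> Q t = Q t \<bullet> C - (lam t - 1) * (Q t \<bullet> T t) - (q t / (lam t)\<^sup>2) * (Q t \<bullet> Y t)"
      by (subst (2) Q_def) (simp add: inner_diff_right)
    ultimately have "Q t \<bullet> Q t = C \<bullet> Q t" by (simp add: inner_commute)
    then show ?thesis using CQ[OF that] by simp
  qed
  have N': "(N has_vector_derivative ((1 / lam t) *\<^sub>R Q t - T t)) (at t)" if "lam t > 0" for t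
  proof -
    have "((\<lambda>t. 1 / lam t) has_real_derivative (- (q t / lam t) / (lam t)\<^sup>2)) (at t)"
      using that lam'[OF that] by (auto intro!: derivative_eq_intros simp: power2_eq_square)
    then have "(N has_vector_derivative ((1 / lam t) *\<^sub>R (C + (1 - 2 * lam t) *\<^sub>R T t)
        + (- (q t / lam t) / (lam t)\<^sup>2) *\<^sub>R Y t)) (at t)"
      unfolding N_def using has_vector_derivative_scaleR[OF _ Y] by blast
    moreover have "(1 / lam t) *\<^sub>R (C + (1 - 2 * lam t) *\<^sub>R T t) + (- (q t / lam t) / (lam t)\<^sup>2) *\<^sub>R Y t
       = (1 / lam t) *\<^sub>R (C + (1 - 2 * lam t) *\<^sub>R T t - (q t / (lam t)\<^sup>2) *\<^sub>R Y t)"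
      by (simp add: scaleR_diff_right)
    moreover have "\<dots> = (1 / lam t) *\<^sub>R (Q t - lam t *\<^sub>R T t)"
      unfolding Q_def by (simp add: algebra_simps scaleR_2)
    moreover have "\<dots> = (1 / lam t) *\<^sub>R Q t - T t"
      using that by (simp add: scaleR_diff_right)
    ultimately show ?thesis by simp
  qed
  have Nn: "norm (N t) = 1" "T t \<bullet> N t = 0" if "lam t > 0" for t
    using that Ynorm[of t] TY[of t] by (auto simp: N_def)
  have lamcont: "continuous_on UNIV lam"
  proof -
    have "continuous_on UNIV (\<lambda>t. 1 + C \<bullet> T t)" by (intro continuous_intros Tcont)
    then show ?thesis using lam by presburger
  qed
  have GC: "((\<lambda>t. C \<bullet> G t) has_real_derivative (lam t - 1)) (at t)" for t
  proof -
    have "((\<lambda>t. C \<bullet> G t) has_derivative (\<lambda>h. h * (lam t - 1))) (at t)"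
      by (rule derivative_eq_intros Gd refl)+ (simp add: fun_eq_iff CT)
    then show ?thesis by (rule has_real_derivativeI)
  qed
  show ?thesis
  proof (cases "\<exists>z. lam z = 0")
    case False
    then have pos: "lam t > 0" for t using lam0[of t] by (simp add: less_le)
    \<comment> \<open>The summand \<open>C \<bullet> G t\<close> has derivative
      \<open>lam t - 1\<close> and cancels the contribution of \<open>- T t\<close> to the
      derivative of \<open>C \<bullet> N t\<close>. What remains is a multiple of
      \<open>Q t \<bullet> Q t\<close>, which has a sign.\<close>
    define f where "f t = C \<bullet> N t + C \<bullet> G t" for t
    have f': "(f has_real_derivative (1 / lam t * (Q t \<bullet> Q t))) (at t)" for t
    proof -
      note d = N'[OF pos[of t], unfolded has_vector_derivative_def]
      have "((\<lambda>t. C \<bullet> N t) has_derivative (\<lambda>h. h * (1 / lam t * (Q t \<bullet> Q t) - (lam t - 1)))) (at t)"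
        by (rule derivative_eq_intros d refl)+ (simp add: fun_eq_iff inner_simps CT CQ QQ pos)
      then have "((\<lambda>t. C \<bullet> N t) has_real_derivative (1 / lam t * (Q t \<bullet> Q t) - (lam t - 1))) (at t)"
        by (rule has_real_derivativeI)
      from DERIV_add[OF this GC] show ?thesis by (simp add: f_def[abs_def])
    qed
    have "1 / lam t * (Q t \<bullet> Q t) = 0" for t
    proof (rule periodic_nonneg_deriv_eq_0[OF l _ f'])
      show "f (t + l) = f t" for t by (simp add: f_def N_def Yper Gper lam Tper)
      show "0 \<le> 1 / lam t * (Q t \<bullet> Q t)" for t using pos[of t] by simp
    qed
    then have "Q t = 0" for t using pos[of t] by (auto simp: less_le)
    then have N'': "(N has_vector_derivative - T t) (at t)" for t using N'[OF pos[of t]] by simp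
    have "T t = cos (t - 0) *\<^sub>R T 0 + sin (t - 0) *\<^sub>R N 0" for t
      by (rule circle_ode[of "- \<bar>t\<bar> - 1" "\<bar>t\<bar> + 1"]) (use T' pos N'' in \<open>auto simp flip: N_def\<close>)
    from semicircle_chord[OF G this T1[of 0] Nn[OF pos, of 0]] show ?thesis by blast
  next
    case True
    then obtain z where z: "lam z = 0" by blast
    have lper: "lam (t + l) = lam t" for t by (simp add: lam Tper)
    obtain t0 where t0: "lam t0 \<noteq> 0"
    proof -
      have "\<exists>t. lam t \<noteq> 0"
      proof (rule ccontr)
        assume "\<nexists>t. lam t \<noteq> 0"
        then have "((\<lambda>t. - (C \<bullet> G t)) has_real_derivative 1) (at t)" for t
          using DERIV_minus[OF GC[of t]] by simp
        from periodic_nonneg_deriv_eq_0[OF l _ this] Gper show False by simp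
      qed
      then show ?thesis using that by blast
    qed
    have zn: "lam (z + of_int k * l) = 0" for k
      using periodic_of_int[of lam l z k] lper z by simp
    \<comment> \<open>Two translates of the zero \<open>z\<close> by whole periods enclose
      \<open>t0\<close>, so \<open>t0\<close> lies in a bounded interval on which \<open>lam\<close>
      is positive and at whose ends it vanishes.\<close>
    define k where "k = \<lfloor>(t0 - z) / l\<rfloor>"
    have "of_int k \<le> (t0 - z) / l" "(t0 - z) / l \<le> of_int (k + 1)" unfolding k_def by linarith+
    then have "z + of_int k * l \<le> t0" "t0 \<le> z + of_int (k + 1) * l" using l by (auto simp: field_simps)
    then obtain a b where ab: "a < t0" "t0 < b" "lam a = 0" "lam b = 0" "\<And>t. t \<in> {a<..<b} \<Longrightarrow> lam t \<noteq> 0"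
      using zero_interval[OF lamcont _ _ zn zn t0] by metis
    then have pos: "lam t > 0" if "t \<in> {a<..<b}" for t using lam0[of t] that by (metis less_le)
    have qcont: "continuous_on UNIV q"
      using q' by (meson DERIV_isCont continuous_at_imp_continuous_on)
    have Jcont: "continuous_on {a..b} J"
      unfolding J_def by (intro continuous_intros continuous_on_subset[OF lamcont] continuous_on_subset[OF qcont]) auto
    have "Y a = 0" using Ynorm[of a] ab by simp
    then have "J a = 0" by (simp add: J_def ab q_def)
    then have J0: "J t = 0" if "t \<in> {a<..<b}" for t
      using DERIV_isconst2[OF _ Jcont, of t] J' pos that ab by auto
    have "Q t = 0" if "t \<in> {a<..<b}" for t
      using QQ[OF pos[OF that]] J0[OF that] by simp
    then have N'': "(N has_vector_derivative - T t) (at t)" if "t \<in> {a<..<b}" for t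
      using N'[OF pos[OF that]] that by simp
    define m where "m = (a + b) / 2"
    have m: "m \<in> {a<..<b}" using ab by (simp add: m_def)
    have Top: "T t = cos (t - m) *\<^sub>R T m + sin (t - m) *\<^sub>R N m" if "t \<in> {a<..<b}" for t
      by (rule circle_ode[of a b]) (use T' pos N'' m that in \<open>auto simp flip: N_def\<close>)
    have Tcl: "T t = cos (t - m) *\<^sub>R T m + sin (t - m) *\<^sub>R N m" if "t \<in> {a..b}" for t
    proof -
      have "{t. T t = cos (t - m) *\<^sub>R T m + sin (t - m) *\<^sub>R N m} \<supseteq> closure {a<..<b}"
        by (intro closure_minimal closed_Collect_eq continuous_intros Tcont) (use Top in auto)
      then show ?thesis using that ab by auto
    qed
    \<comment> \<open>On the arc, \<open>lam\<close> is 1 plus a sinusoid. Its vanishing at both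
      ends gives \<open>cos h * (C \<bullet> T m) = -1\<close> for the half-length \<open>h\<close>,
      while positivity at the midpoint gives \<open>C \<bullet> T m > -1\<close>. These contradict
      each other if \<open>0 < cos h\<close>, that is, if the interval is shorter than
      \<open>pi\<close>.\<close>
    have "b - a \<ge> pi"
    proof (rule ccontr)
      assume "\<not> b - a \<ge> pi"
      define h where "h = (b - a) / 2"
      have h: "0 < h" "h < pi / 2" using ab \<open>\<not> b - a \<ge> pi\<close> by (auto simp: h_def)
      have hm: "a - m = - h" "b - m = h" by (auto simp: h_def m_def field_simps)
      have "1 + (cos h * (C \<bullet> T m) - sin h * (C \<bullet> N m)) = 0"
        using ab(3) Tcl[of a] ab by (simp add: lam hm inner_simps)
      moreover have "1 + (cos h * (C \<bullet> T m) + sin h * (C \<bullet> N m)) = 0"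
        using ab(4) Tcl[of b] ab by (simp add: lam hm inner_simps)
      ultimately have e: "cos h * (C \<bullet> T m) = -1" by linarith
      have c: "0 < cos h" "cos h \<le> 1" using h by (auto intro!: cos_gt_zero)
      have "C \<bullet> T m > -1" using pos[OF m] lam by simp
      then have "cos h * (C \<bullet> T m) > cos h * (-1)" using c(1) by (rule mult_strict_left_mono)
      then show False using e c by linarith
    qed
    then have "T t = cos (t - m) *\<^sub>R T m + sin (t - m) *\<^sub>R N m" if "t \<in> {a..a+pi}" for t
      using Tcl that by auto
    from semicircle_chord[OF G this T1[of m] Nn[OF pos[OF m]]] show ?thesis by blast
  qed
qed

text \<open>\<open>r\<close> is the multiplier of the length. In the abnormal case
  \<open>r = 0\<close> the multiplier \<open>lam\<close> is the derivative of the periodic function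
  \<open>C \<bullet> G\<close>, hence zero; then \<open>Y\<close> vanishes and with it
  \<open>C\<close>, against nontriviality. Otherwise division by \<open>r\<close> normalizes the
  system.\<close>

lemma adjoint_ode_semicircle:
  fixes T Y G :: "real \<Rightarrow> 'a::real_inner"
  assumes l: "l > 0"
    and G: "\<And>t. (G has_vector_derivative T t) (at t)" and Gper: "\<And>t. G (t + l) = G t"
    and T1: "\<And>t. norm (T t) = 1" and Tper: "\<And>t. T (t + l) = T t" and Tcont: "continuous_on UNIV T"
    and lam: "\<And>t. lam t = r + C \<bullet> T t" and lam0: "\<And>t. lam t \<ge> 0"
    and Y: "\<And>t. (Y has_vector_derivative (C + (r - 2 * lam t) *\<^sub>R T t)) (at t)"
    and Yper: "\<And>t. Y (t + l) = Y t"
    and Ynorm: "\<And>t. norm (Y t) = lam t"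
    and T': "\<And>t. lam t > 0 \<Longrightarrow> (T has_vector_derivative (1 / lam t) *\<^sub>R Y t) (at t)"
    and r: "r \<ge> 0" "(C, r) \<noteq> 0"
  shows "\<exists>a. T (a + pi) = - T a \<and> (G (a + pi) - G a) \<bullet> T a = 0 \<and> norm (G (a + pi) - G a) = 2"
proof -
  have "r \<noteq> 0"
  proof
    assume r0: "r = 0"
    have GC: "((\<lambda>t. C \<bullet> G t) has_real_derivative lam t) (at t)" for t
    proof -
      note Gd = G[unfolded has_vector_derivative_def]
      have "((\<lambda>t. C \<bullet> G t) has_derivative (\<lambda>h. h * lam t)) (at t)"
        by (rule derivative_eq_intros Gd refl)+ (simp add: fun_eq_iff lam r0)
      then show ?thesis by (rule has_real_derivativeI)
    qed
    have lz: "lam t = 0" for t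
      by (rule periodic_nonneg_deriv_eq_0[OF l _ GC lam0]) (simp add: Gper)
    then have "Y = (\<lambda>t. 0)" using Ynorm by (simp add: fun_eq_iff)
    then have "((\<lambda>t. 0) has_vector_derivative C) (at 0)" using Y[of 0] by (simp add: lz r0)
    then have "C = 0" by (simp add: has_vector_derivative_const vector_derivative_unique_at)
    then show False using r r0 by (simp add: zero_prod_def)
  qed
  then have r: "r > 0" using r by simp
  show ?thesis
  proof (rule adjoint_ode_semicircle_normalized[OF l G Gper T1 Tper Tcont, of "\<lambda>t. lam t / r" "C /\<^sub>R r" "\<lambda>t. Y t /\<^sub>R r"])
    show "((\<lambda>t. Y t /\<^sub>R r) has_vector_derivative C /\<^sub>R r + (1 - 2 * (lam t / r)) *\<^sub>R T t) (at t)" for t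
    proof -
      have "((\<lambda>t. Y t /\<^sub>R r) has_vector_derivative (C + (r - 2 * lam t) *\<^sub>R T t) /\<^sub>R r) (at t)"
        using has_vector_derivative_scaleR[OF DERIV_const Y, of "inverse r"] by simp
      moreover have "(C + (r - 2 * lam t) *\<^sub>R T t) /\<^sub>R r = C /\<^sub>R r + (1 - 2 * (lam t / r)) *\<^sub>R T t"
      proof -
        have "1 - 2 * (lam t / r) = (r - 2 * lam t) / r" using r by (simp add: diff_divide_distrib)
        then show ?thesis by (simp add: scaleR_add_right divide_inverse mult.commute)
      qed
      ultimately show ?thesis by simp
    qed
    show "(T has_vector_derivative (1 / (lam t / r)) *\<^sub>R (Y t /\<^sub>R r)) (at t)" if "0 < lam t / r" for t
      using T'[of t] that r by (simp add: zero_less_divide_iff)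
  qed (use r in \<open>auto simp: lam[abs_def] lam0[unfolded lam] Yper Ynorm[unfolded lam] field_simps\<close>)
qed

section \<open>Bounded measurable functions\<close>

text \<open>A class that is closed under sums and products and integrable on every interval.
  Integrability in the gauge sense alone would not survive the products from which the test
  variations are formed.\<close>

definition bdd_borel :: "(real \<Rightarrow> 'b::euclidean_space) \<Rightarrow> bool" where
  "bdd_borel g \<longleftrightarrow> g \<in> borel_measurable borel \<and> bounded (range g)"

lemma bdd_borelI: "g \<in> borel_measurable borel \<Longrightarrow> (\<And>t. norm (g t) \<le> B) \<Longrightarrow> bdd_borel g"
  unfolding bdd_borel_def by (auto simp: bounded_iff)

lemma bdd_borelE:
  assumes "bdd_borel g"
  obtains B where "B > 0" "\<And>t. norm (g t) \<le> B"
  using assms unfolding bdd_borel_def bounded_pos by auto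

lemma bdd_borel_measurable: "bdd_borel g \<Longrightarrow> g \<in> borel_measurable borel"
  by (simp add: bdd_borel_def)

lemma bdd_borel_integrable_on: "bdd_borel g \<Longrightarrow> g integrable_on {a..b}"
  by (metis bdd_borelE bdd_borel_integrable bdd_borel_measurable)

lemma bdd_borel_const: "bdd_borel (\<lambda>t. c)"
  by (rule bdd_borelI) auto

lemma bdd_borel_add:
  assumes "bdd_borel f" "bdd_borel g" shows "bdd_borel (\<lambda>t. f t + g t)"
proof -
  obtain A B where "\<And>t. norm (f t) \<le> A" "\<And>t. norm (g t) \<le> B" using assms bdd_borelE by metis
  then show ?thesis using assms
    by (intro bdd_borelI[of _ "A + B"]) (auto simp: bdd_borel_def intro: norm_triangle_mono)
qed

lemma bdd_borel_bilinear:
  assumes "bdd_borel f" "bdd_borel g" "bounded_bilinear h"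
  shows "bdd_borel (\<lambda>t. h (f t) (g t))"
proof -
  interpret bounded_bilinear h by fact
  obtain K where K: "K > 0" "\<And>a b. norm (h a b) \<le> norm a * norm b * K" using pos_bounded by blast
  obtain A B where AB: "A > 0" "B > 0" "\<And>t. norm (f t) \<le> A" "\<And>t. norm (g t) \<le> B" using assms bdd_borelE by metis
  show ?thesis
  proof (rule bdd_borelI)
    have "continuous_on UNIV (\<lambda>z. h (fst z) (snd z))" by (intro continuous_on continuous_intros)
    then have "(\<lambda>z. h (fst z) (snd z)) \<in> borel_measurable borel" by (rule borel_measurable_continuous_onI)
    then show "(\<lambda>t. h (f t) (g t)) \<in> borel_measurable borel"
      using measurable_compose[of "\<lambda>t. (f t, g t)" borel borel "\<lambda>z. h (fst z) (snd z)"] assms(1,2)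
      by (simp add: bdd_borel_measurable borel_measurable_Pair)
    show "norm (h (f t) (g t)) \<le> A * B * K" for t
      by (rule order_trans[OF K(2)]) (use AB K in \<open>auto intro!: mult_mono\<close>)
  qed
qed

lemmas bdd_borel_scaleR = bdd_borel_bilinear[OF _ _ bounded_bilinear_scaleR]
lemmas bdd_borel_inner = bdd_borel_bilinear[OF _ _ bounded_bilinear_inner]
lemmas bdd_borel_mult = bdd_borel_bilinear[OF _ _ bounded_bilinear_mult]

lemma bdd_borel_uminus: "bdd_borel f \<Longrightarrow> bdd_borel (\<lambda>t. - f t)"
  using bdd_borel_scaleR[OF bdd_borel_const, of f "-1"] by simp

lemma bdd_borel_diff: "bdd_borel f \<Longrightarrow> bdd_borel g \<Longrightarrow> bdd_borel (\<lambda>t. f t - g t)"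
  using bdd_borel_add[OF _ bdd_borel_uminus, of f g] by simp

lemma bdd_borel_norm: "bdd_borel f \<Longrightarrow> bdd_borel (\<lambda>t. norm (f t))"
  unfolding bdd_borel_def by (auto simp: bounded_iff)

lemmas bdd_borel_intros = bdd_borel_const bdd_borel_add bdd_borel_diff bdd_borel_uminus
  bdd_borel_scaleR bdd_borel_inner bdd_borel_mult bdd_borel_norm

lemma period_reduce:
  fixes l :: real
  assumes "l > 0"
  obtains k :: int where "t + of_int k * l \<in> {0..<l}"
proof
  have "of_int \<lfloor>t / l\<rfloor> * l \<le> t / l * l" "t / l * l < (of_int \<lfloor>t / l\<rfloor> + 1) * l"
    using assms by (intro mult_right_mono mult_strict_right_mono; linarith)+
  then have "of_int \<lfloor>t / l\<rfloor> * l \<le> t" "t < (of_int \<lfloor>t / l\<rfloor> + 1) * l"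
    using assms by auto
  then show "t + of_int (- \<lfloor>t / l\<rfloor>) * l \<in> {0..<l}"
    by (auto simp: algebra_simps)
qed

lemma bdd_borel_periodic:
  fixes f :: "real \<Rightarrow> 'b::euclidean_space"
  assumes "l > 0" "\<And>t. f (t + l) = f t" "continuous_on UNIV f"
  shows "bdd_borel f"
proof -
  have "compact (f ` {0..l})"
    by (intro compact_continuous_image continuous_on_subset[OF assms(3)]) auto
  moreover have "range f \<subseteq> f ` {0..l}"
  proof clarify
    fix t
    obtain k where "t + of_int k * l \<in> {0..<l}" using period_reduce[OF assms(1)] by metis
    then show "f t \<in> f ` {0..l}"
      using periodic_of_int[of f l t k] assms(2) by (intro image_eqI[of _ _ "t + of_int k * l"]) auto
  qed
  ultimately show ?thesis
    unfolding bdd_borel_def using assms(3)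
    by (meson bounded_subset compact_imp_bounded borel_measurable_continuous_onI)
qed

section \<open>Uniqueness, periodicity and the product rule for indefinite integrals\<close>

lemma indef_integral_unique:
  assumes "indef_integral P g" "indef_integral Q g"
  shows "P t - Q t = P s - Q s"
proof -
  have *: "P t - P s = Q t - Q s" if "s \<le> t" for s t
    using has_integral_unique[OF indef_integralD[OF assms(1) that] indef_integralD[OF assms(2) that]] .
  show ?thesis using *[of s t] *[of t s] by (cases "s \<le> t") (auto simp: algebra_simps)
qed

lemma indef_integral_shift:
  assumes "indef_integral P g"
  shows "indef_integral (\<lambda>t. P (t + l)) (\<lambda>t. g (t + l))"
  unfolding indef_integral_def
proof (intro allI impI)
  fix s t :: real assume "s \<le> t"
  then have "(g has_integral (P (t + l) - P (s + l))) {s + l..t + l}"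
    using indef_integralD[OF assms, of "s + l" "t + l"] by simp
  then show "((\<lambda>t. g (t + l)) has_integral (P (t + l) - P (s + l))) {s..t}"
    using has_integral_shift_real_ivl[of g _ "s + l" "t + l" l] by simp
qed

lemma indef_integral_periodic:
  assumes "indef_integral P g" "\<And>t. g (t + l) = g t" "l \<ge> 0" "(g has_integral 0) {0..l}"
  shows "P (t + l) = P t"
proof -
  have "P (t + l) - P t = P (0 + l) - P 0"
    using indef_integral_shift[OF assms(1), of l] assms(1,2) by (intro indef_integral_unique) auto
  moreover have "P l - P 0 = 0"
    using has_integral_unique[OF indef_integralD[OF assms(1,3)] assms(4)] .
  ultimately show ?thesis by simp
qed

text \<open>Integration by parts for integrands that are only bounded and measurable. The difference
  \<open>D\<close> between the integral of the product rule and the product changes by at most a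
  constant times the square of the step, so its derivative is 0 everywhere.\<close>

lemma indef_integral_inner:
  assumes P: "indef_integral P p" "bdd_borel p" and Q: "indef_integral Q q" "bdd_borel q"
    and m: "bdd_borel P" "bdd_borel Q"
  shows "indef_integral (\<lambda>t. P t \<bullet> Q t) (\<lambda>t. p t \<bullet> Q t + P t \<bullet> q t)"
proof -
  define h where "h t = p t \<bullet> Q t + P t \<bullet> q t" for t
  have hm: "bdd_borel h" unfolding h_def by (intro bdd_borel_intros assms)
  obtain H where H: "indef_integral H h"
    using indef_integral_exists[of h] bdd_borel_integrable_on[OF hm] by metis
  obtain A where A: "A > 0" "\<And>t. norm (p t) \<le> A" using bdd_borelE[OF P(2)] by metis
  obtain B where B: "B > 0" "\<And>t. norm (q t) \<le> B" using bdd_borelE[OF Q(2)] by metis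
  define D where "D t = H t - P t \<bullet> Q t" for t
  have *: "\<bar>D t - D s\<bar> \<le> (2 * A * B * (t - s)) * (t - s)" if st: "s \<le> t" for s t
  proof -
    have 1: "((\<lambda>x. p x \<bullet> Q t) has_integral ((P t - P s) \<bullet> Q t)) {s..t}"
      using has_integral_linear[OF indef_integralD[OF P(1) st] bounded_linear_inner_left[of "Q t"]] by (simp add: o_def)
    have 2: "((\<lambda>x. P s \<bullet> q x) has_integral (P s \<bullet> (Q t - Q s))) {s..t}"
      using has_integral_linear[OF indef_integralD[OF Q(1) st] bounded_linear_inner_right[of "P s"]] by (simp add: o_def)
    have "((\<lambda>x. h x - (p x \<bullet> Q t + P s \<bullet> q x)) has_integral (H t - H s - ((P t - P s) \<bullet> Q t + P s \<bullet> (Q t - Q s)))) {s..t}"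
      by (intro has_integral_diff has_integral_add 1 2 indef_integralD[OF H st])
    moreover have "H t - H s - ((P t - P s) \<bullet> Q t + P s \<bullet> (Q t - Q s)) = D t - D s"
      by (simp add: D_def inner_simps)
    moreover have "norm (h x - (p x \<bullet> Q t + P s \<bullet> q x)) \<le> 2 * A * B * (t - s)" if x: "x \<in> {s..t}" for x
    proof -
      have "h x - (p x \<bullet> Q t + P s \<bullet> q x) = p x \<bullet> (Q x - Q t) + (P x - P s) \<bullet> q x"
        by (simp add: h_def inner_simps)
      moreover have "norm (Q x - Q t) \<le> B * (t - s)"
        using order_trans[OF indef_integral_lipschitz[OF Q(1) B(2), of x t], of "B * (t - s)"] x B by auto
      then have "\<bar>p x \<bullet> (Q x - Q t)\<bar> \<le> A * (B * (t - s))"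
        using A by (intro order_trans[OF Cauchy_Schwarz_ineq2] mult_mono) auto
      moreover have "norm (P x - P s) \<le> A * (t - s)"
        using order_trans[OF indef_integral_lipschitz[OF P(1) A(2), of x s], of "A * (t - s)"] x A by auto
      then have "\<bar>(P x - P s) \<bullet> q x\<bar> \<le> (A * (t - s)) * B"
        using A B st by (intro order_trans[OF Cauchy_Schwarz_ineq2] mult_mono) auto
      ultimately show ?thesis by (auto simp: algebra_simps intro: order_trans[OF abs_triangle_ineq])
    qed
    ultimately show ?thesis
      using has_integral_bound_real[of "2 * A * B * (t - s)" "{}" "\<lambda>x. h x - (p x \<bullet> Q t + P s \<bullet> q x)" "D t - D s" s t]
        A B st by simp
  qed
  have "(D has_real_derivative 0) (at t)" for t
    unfolding has_field_derivative_def has_derivative_at_alt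
  proof (intro conjI allI impI)
    fix e :: real assume "e > 0"
    define d where "d = e / (2 * A * B)"
    have "\<bar>D y - D t\<bar> \<le> e * \<bar>y - t\<bar>" if "\<bar>y - t\<bar> < d" for y
    proof -
      have 1: "2 * A * B * \<bar>y - t\<bar> \<le> e" using that A B by (simp add: d_def field_simps)
      have "\<bar>D y - D t\<bar> \<le> 2 * A * B * \<bar>y - t\<bar> * \<bar>y - t\<bar>"
        using *[of t y] *[of y t] by (cases "t \<le> y") (auto simp: abs_minus_commute)
      also have "\<dots> \<le> e * \<bar>y - t\<bar>" by (rule mult_right_mono[OF 1]) simp
      finally show ?thesis .
    qed
    then show "\<exists>d>0. \<forall>y. norm (y - t) < d \<longrightarrow> norm (D y - D t - 0 * (y - t)) \<le> e * norm (y - t)"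
      using \<open>e > 0\<close> A B by (intro exI[of _ d]) (auto simp: d_def)
  qed (rule bounded_linear_mult_right)
  then have D: "D t = D s" for s t
    using DERIV_isconst_all by blast
  show ?thesis
    unfolding indef_integral_def h_def[symmetric]
  proof (intro allI impI)
    fix s t :: real assume st: "s \<le> t"
    have "H t - H s = P t \<bullet> Q t - P s \<bullet> Q s" using D[of t s] by (simp add: D_def)
    then show "(h has_integral P t \<bullet> Q t - P s \<bullet> Q s) {s..t}" using indef_integralD[OF H st] by simp
  qed
qed

lemma has_integral_0_AE:
  fixes g :: "real \<Rightarrow> real"
  assumes "g \<in> borel_measurable borel" "\<And>t. g t \<ge> 0" "(g has_integral 0) {a..b}"
  obtains N where "negligible N" "\<And>t. t \<in> {a..b} - N \<Longrightarrow> g t = 0"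
proof -
  define h where "h t = g t * indicator {a..b} t" for t
  have hm: "h \<in> borel_measurable borel" unfolding h_def using assms(1) by measurable
  have "h = (\<lambda>t. if t \<in> {a..b} then g t else 0)" by (auto simp: h_def indicator_def)
  then have "(h has_integral 0) UNIV" using assms(3) has_integral_restrict_UNIV[of "{a..b}" g] by metis
  then have "integral\<^sup>N lborel h = ennreal 0"
    by (rule nn_integral_has_integral_lborel[OF hm, rotated]) (use assms(2) in \<open>auto simp: h_def\<close>)
  then have "AE t in lborel. h t = 0"
  proof -
    have "AE t in lborel. ennreal (h t) = 0"
      using \<open>integral\<^sup>N lborel h = ennreal 0\<close> hm by (subst (asm) ennreal_0, subst (asm) nn_integral_0_iff_AE) auto
    then show ?thesis
    proof eventually_elim
      case (elim t)
      moreover have "h t \<ge> 0" using assms(2) by (simp add: h_def)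
      ultimately show ?case by (simp add: ennreal_eq_0_iff)
    qed
  qed
  then obtain N where N: "{t. h t \<noteq> 0} \<subseteq> N" "N \<in> null_sets lborel"
    by (auto elim!: AE_E simp: null_sets_def)
  show ?thesis
  proof
    show "negligible N" using N by (simp add: negligible_iff_null_sets null_sets_completionI)
    show "g t = 0" if "t \<in> {a..b} - N" for t using N that by (auto simp: h_def)
  qed
qed

section \<open>First-order variations of a closed curve\<close>

text \<open>A closed curve of length \<open>l\<close>, scaled so that the curvature bound is 1.
  \<open>u\<close> is one fixed representative of the curvature vector, bounded and periodic at
  every point, so that test variations built from it inherit both properties.\<close>

locale closed_curve =
  fixes G T u :: "real \<Rightarrow> 'a::euclidean_space" and l :: real
  assumes l: "l > 0"
    and G: "\<And>t. (G has_vector_derivative T t) (at t)" and Gper: "\<And>t. G (t + l) = G t"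
    and T1: "\<And>t. norm (T t) = 1" and Tper: "\<And>t. T (t + l) = T t"
    and um: "u \<in> borel_measurable borel" and u1: "\<And>t. norm (u t) \<le> 1"
    and uper: "\<And>t. u (t + l) = u t" and Tu: "indef_integral T u"
begin

lemma Tcont: "continuous_on UNIV T"
  using indef_integral_continuous[OF Tu u1] .

lemma bT: "bdd_borel T" and bu: "bdd_borel u"
  using bdd_borel_periodic[OF l Tper Tcont] bdd_borelI[OF um u1] by auto

lemma T_has_integral_0: "(T has_integral 0) {0..l}"
proof -
  have "(T has_integral (G l - G 0)) {0..l}"
    using l by (intro fundamental_theorem_of_calculus has_vector_derivative_at_within[OF G]) auto
  then show ?thesis using Gper[of 0] by simp
qed

text \<open>\<open>psi\<close> is the first-order change of the tangent and \<open>phi\<close> that of the speed. Since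
  \<open>norm (u t + e *\<^sub>R p t)\<close> is \<open>1 + e * (u t \<bullet> p t)\<close> to first order where \<open>norm (u t) = 1\<close>, the condition
  says that the curvature does not exceed 1 to first order; the term with \<open>K\<close> expresses that
  there is no constraint where \<open>norm (u t) < 1\<close>.\<close>

definition admissible :: "(real \<Rightarrow> 'a) \<Rightarrow> (real \<Rightarrow> 'a) \<Rightarrow> (real \<Rightarrow> real) \<Rightarrow> real \<Rightarrow> bool" where
  "admissible psi p phi K \<longleftrightarrow> bdd_borel p \<and> bdd_borel phi \<and> indef_integral psi p \<and>
     (\<forall>t. psi (t + l) = psi t \<and> p (t + l) = p t \<and> phi (t + l) = phi t) \<and> K \<ge> 0 \<and>
     (\<forall>t. phi t \<ge> u t \<bullet> p t - 2 * (T t \<bullet> psi t) - K * (1 - norm (u t)))"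

text \<open>The varied velocity is \<open>(1 + e phi) (T + e psi)\<close>. The first integrand is
  its derivative at \<open>e = 0\<close> and the second is the derivative of its norm, so
  \<open>A\<close> is the closing defect and \<open>B\<close> the change of length.
  \<open>T + e psi\<close> is not normalized; the term \<open>2 * (T t \<bullet> psi t)\<close> in
  the admissibility condition compensates for this.\<close>

definition variations :: "('a \<times> real) set" where
  "variations = {(A, B). \<exists>psi p phi K. admissible psi p phi K \<and>
     ((\<lambda>t. phi t *\<^sub>R T t + psi t) has_integral A) {0..l} \<and>
     ((\<lambda>t. phi t + T t \<bullet> psi t) has_integral B) {0..l}}"

lemma admissible_bpsi: "admissible psi p phi K \<Longrightarrow> bdd_borel psi"
  unfolding admissible_def
  using bdd_borel_periodic[OF l] indef_integral_continuous bdd_borelE by metis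

lemma variations_add:
  assumes "x \<in> variations" "y \<in> variations"
  shows "x + y \<in> variations"
proof -
  obtain A B where x: "x = (A, B)" by (cases x)
  obtain A' B' where y: "y = (A', B')" by (cases y)
  obtain psi p phi K where 1: "admissible psi p phi K"
     "((\<lambda>t. phi t *\<^sub>R T t + psi t) has_integral A) {0..l}"
     "((\<lambda>t. phi t + T t \<bullet> psi t) has_integral B) {0..l}"
    using assms(1) unfolding x variations_def by blast
  obtain psi' p' phi' K' where 2: "admissible psi' p' phi' K'"
     "((\<lambda>t. phi' t *\<^sub>R T t + psi' t) has_integral A') {0..l}"
     "((\<lambda>t. phi' t + T t \<bullet> psi' t) has_integral B') {0..l}"
    using assms(2) unfolding y variations_def by blast
  have "admissible (\<lambda>t. psi t + psi' t) (\<lambda>t. p t + p' t) (\<lambda>t. phi t + phi' t) (K + K')"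
    unfolding admissible_def
  proof (intro conjI allI)
    fix t
    have "phi t \<ge> u t \<bullet> p t - 2 * (T t \<bullet> psi t) - K * (1 - norm (u t))"
      "phi' t \<ge> u t \<bullet> p' t - 2 * (T t \<bullet> psi' t) - K' * (1 - norm (u t))"
      using 1 2 unfolding admissible_def by blast+
    then show "phi t + phi' t \<ge> u t \<bullet> (p t + p' t) - 2 * (T t \<bullet> (psi t + psi' t)) - (K + K') * (1 - norm (u t))"
      by (simp add: inner_add_right ring_distribs)
  qed (use 1 2 in \<open>auto simp: admissible_def intro!: bdd_borel_intros indef_integral_add\<close>)
  moreover have "((\<lambda>t. (phi t + phi' t) *\<^sub>R T t + (psi t + psi' t)) has_integral A + A') {0..l}"
    using has_integral_add[OF 1(2) 2(2)] by (simp add: algebra_simps)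
  moreover have "((\<lambda>t. (phi t + phi' t) + T t \<bullet> (psi t + psi' t)) has_integral B + B') {0..l}"
    using has_integral_add[OF 1(3) 2(3)] by (simp add: algebra_simps)
  ultimately show ?thesis unfolding x y variations_def by auto
qed

lemma variations_scale:
  assumes "x \<in> variations" "c \<ge> 0"
  shows "c *\<^sub>R x \<in> variations"
proof -
  obtain A B where x: "x = (A, B)" by (cases x)
  obtain psi p phi K where 1: "admissible psi p phi K"
     "((\<lambda>t. phi t *\<^sub>R T t + psi t) has_integral A) {0..l}"
     "((\<lambda>t. phi t + T t \<bullet> psi t) has_integral B) {0..l}"
    using assms(1) unfolding x variations_def by blast
  have "admissible (\<lambda>t. c *\<^sub>R psi t) (\<lambda>t. c *\<^sub>R p t) (\<lambda>t. c * phi t) (c * K)"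
    unfolding admissible_def
  proof (intro conjI allI)
    fix t
    have "phi t \<ge> u t \<bullet> p t - 2 * (T t \<bullet> psi t) - K * (1 - norm (u t))"
      using 1 unfolding admissible_def by blast
    then have "c * phi t \<ge> c * (u t \<bullet> p t - 2 * (T t \<bullet> psi t) - K * (1 - norm (u t)))"
      using assms(2) by (rule mult_left_mono)
    then show "c * phi t \<ge> u t \<bullet> (c *\<^sub>R p t) - 2 * (T t \<bullet> (c *\<^sub>R psi t)) - (c * K) * (1 - norm (u t))"
      by (simp add: algebra_simps)
  qed (use 1 assms in \<open>auto simp: admissible_def intro!: bdd_borel_intros indef_integral_scaleR\<close>)
  moreover have "((\<lambda>t. (c * phi t) *\<^sub>R T t + c *\<^sub>R psi t) has_integral c *\<^sub>R A) {0..l}"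
    using has_integral_cmul[OF 1(2), of c] by (simp add: algebra_simps)
  moreover have "((\<lambda>t. (c * phi t) + T t \<bullet> (c *\<^sub>R psi t)) has_integral c * B) {0..l}"
    using has_integral_cmul[OF 1(3), of c] by (simp add: algebra_simps)
  ultimately have "(c *\<^sub>R A, c * B) \<in> variations" unfolding variations_def by blast
  then show ?thesis by (simp add: x)
qed

lemma zero_in_variations: "0 \<in> variations"
proof -
  have "admissible (\<lambda>t. 0) (\<lambda>t. 0) (\<lambda>t. 0) 0"
    unfolding admissible_def by (auto intro!: bdd_borel_intros indef_integral_const)
  then show ?thesis unfolding variations_def zero_prod_def
    by (auto intro!: exI[of _ "\<lambda>t::real. 0::'a"] exI[of _ "\<lambda>t::real. 0::real"])
qed

text \<open>The cone is separated from the ray of pure shortenings \<open>(0, -s)\<close>. In finite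
  dimension disjoint nonempty convex sets can be separated even if the cone is not closed.\<close>

lemma variations_separation:
  assumes "\<And>B. B < 0 \<Longrightarrow> (0, B) \<notin> variations"
  obtains C r where "(C, r) \<noteq> 0" "r \<ge> 0" "\<And>A B. (A, B) \<in> variations \<Longrightarrow> C \<bullet> A + r * B \<ge> 0"
proof -
  define S where "S = (\<lambda>s. s *\<^sub>R (0::'a, -1::real)) ` {0<..}"
  have "convex S" unfolding S_def
    by (intro convex_linear_image bounded_linear.linear[OF bounded_linear_scaleR_left]) simp
  moreover have "convex variations"
    by (auto intro!: convexI variations_add variations_scale)
  moreover have "S \<noteq> {}" "variations \<noteq> {}" using zero_in_variations by (auto simp: S_def)
  moreover have "S \<inter> variations = {}" using assms by (auto simp: S_def)
  ultimately obtain a b where ab: "a \<noteq> 0" "\<And>x. x \<in> S \<Longrightarrow> inner a x \<le> b" "\<And>x. x \<in> variations \<Longrightarrow> inner a x \<ge> b"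
    using separating_hyperplane_sets by metis
  have b0: "b \<le> 0" using ab(3)[OF zero_in_variations] by simp
  \<comment> \<open>A linear functional bounded below on a cone is nonnegative there: otherwise
    scaling would take it below any bound.\<close>
  have cone: "inner a x \<ge> 0" if x: "x \<in> variations" for x
  proof (rule ccontr)
    assume "\<not> inner a x \<ge> 0"
    then have neg: "inner a x < 0" by simp
    define c where "c = (b - 1) / inner a x"
    have "c \<ge> 0" using neg b0 by (simp add: c_def divide_nonpos_neg)
    from ab(3)[OF variations_scale[OF x this]] show False using neg by (simp add: c_def)
  qed
  obtain C r where a: "a = (C, r)" by (cases a)
  show ?thesis
  proof
    show "(C, r) \<noteq> 0" using ab a by simp
    show "C \<bullet> A + r * B \<ge> 0" if "(A, B) \<in> variations" for A B using cone[OF that] by (simp add: a)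
    have "- (s * r) \<le> 0" if "s > 0" for s
      using ab(2)[of "s *\<^sub>R (0, -1)"] b0 that by (auto simp: S_def a mult.commute)
    from this[of 1] show "r \<ge> 0" by simp
  qed
qed

text \<open>Each property of the multiplier comes from one test variation for which the separating
  inequality becomes minus the integral of a nonnegative quantity, so that this quantity must vanish
  almost everywhere. Continuity and periodicity then spread the result to the whole line where it is
  needed.\<close>

lemma semicircle_if_no_variation:
  assumes "\<And>B. B < 0 \<Longrightarrow> (0, B) \<notin> variations"
  shows "\<exists>a. T (a + pi) = - T a \<and> (G (a + pi) - G a) \<bullet> T a = 0 \<and> norm (G (a + pi) - G a) = 2"
proof -
  obtain C r where Cr: "(C, r) \<noteq> 0" "r \<ge> 0" "\<And>A B. (A, B) \<in> variations \<Longrightarrow> C \<bullet> A + r * B \<ge> 0"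
    using variations_separation[OF assms] by metis
  define lam where "lam t = r + C \<bullet> T t" for t
  define y where "y t = C + (r - 2 * lam t) *\<^sub>R T t" for t
  have lamper: "lam (t + l) = lam t" for t by (simp add: lam_def Tper)
  have yper: "y (t + l) = y t" for t by (simp add: y_def lamper Tper)
  have lamcont: "continuous_on UNIV lam" unfolding lam_def by (intro continuous_intros Tcont)
  have ycont: "continuous_on UNIV y" unfolding y_def by (intro continuous_intros Tcont lamcont)
  have blam: "bdd_borel lam" and bY: "bdd_borel y"
    using bdd_borel_periodic[OF l lamper lamcont] bdd_borel_periodic[OF l yper ycont] by auto
  \<comment> \<open>\<open>C \<bullet> A + r * B\<close> with the terms collected: the coefficient
    of \<open>phi\<close> is \<open>lam\<close>, that of \<open>psi\<close> is
    \<open>C + r *\<^sub>R T t\<close>.\<close>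
  have ineq: "0 \<le> integral {0..l} (\<lambda>t. phi t * lam t + (C + r *\<^sub>R T t) \<bullet> psi t)"
    if adm: "admissible psi p phi K" for psi p phi K
  proof -
    have b: "bdd_borel psi" "bdd_borel phi" using admissible_bpsi[OF adm] adm by (auto simp: admissible_def)
    define A where "A = integral {0..l} (\<lambda>t. phi t *\<^sub>R T t + psi t)"
    define B where "B = integral {0..l} (\<lambda>t. phi t + T t \<bullet> psi t)"
    have A: "((\<lambda>t. phi t *\<^sub>R T t + psi t) has_integral A) {0..l}"
      unfolding A_def by (intro integrable_integral bdd_borel_integrable_on bdd_borel_intros b bT)
    have B: "((\<lambda>t. phi t + T t \<bullet> psi t) has_integral B) {0..l}"
      unfolding B_def by (intro integrable_integral bdd_borel_integrable_on bdd_borel_intros b bT)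
    have "((\<lambda>t. C \<bullet> (phi t *\<^sub>R T t + psi t)) has_integral C \<bullet> A) {0..l}"
      using has_integral_linear[OF A bounded_linear_inner_right[of C]] by (simp add: o_def)
    from has_integral_add[OF this has_integral_mult_right[OF B, of r]]
    have "((\<lambda>t. phi t * lam t + (C + r *\<^sub>R T t) \<bullet> psi t) has_integral (C \<bullet> A + r * B)) {0..l}"
      by (simp add: lam_def inner_simps algebra_simps)
    moreover have "C \<bullet> A + r * B \<ge> 0" using adm A B by (intro Cr(3)) (auto simp: variations_def)
    ultimately show ?thesis by (simp add: integral_unique)
  qed
  \<comment> \<open>Admissibility bounds \<open>phi\<close> only from below, so the negative part of
    \<open>lam\<close> may serve as \<open>phi\<close>, with \<open>psi = 0\<close>.\<close>
  have lam0: "lam t \<ge> 0" for t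
  proof -
    define phi where "phi t = max 0 (- lam t)" for t
    have phicont: "continuous_on UNIV phi" unfolding phi_def by (intro continuous_intros lamcont)
    have "admissible (\<lambda>t. 0) (\<lambda>t. 0) phi 0"
      unfolding admissible_def
      using bdd_borel_periodic[OF l _ phicont] lamper
      by (auto intro!: bdd_borel_intros indef_integral_const simp: phi_def)
    from ineq[OF this] have "0 \<le> integral {0..l} (\<lambda>t. phi t * lam t)" by simp
    moreover have "(\<lambda>t. phi t * lam t) = (\<lambda>t. - (phi t)\<^sup>2)"
      by (auto simp: phi_def max_def power2_eq_square)
    ultimately have "integral {0..l} (\<lambda>t. (phi t)\<^sup>2) \<le> 0" by simp
    moreover have "integral {0..l} (\<lambda>t. (phi t)\<^sup>2) \<ge> 0" by (rule integral_nonneg) (auto intro!: integrable_continuous_real continuous_intros continuous_on_subset[OF phicont])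
    ultimately have "integral {0..l} (\<lambda>t. (phi t)\<^sup>2) = 0" by simp
    moreover have "continuous_on {0..l} (\<lambda>t. (phi t)\<^sup>2)"
      by (intro continuous_intros continuous_on_subset[OF phicont]) auto
    ultimately have "\<forall>t\<in>{0..l}. (phi t)\<^sup>2 = 0" using l by (subst (asm) integral_eq_0_iff) auto
    moreover obtain k where k: "t + of_int k * l \<in> {0..<l}" using period_reduce[OF l] by metis
    ultimately have "phi (t + of_int k * l) = 0" by auto
    then have "lam (t + of_int k * l) \<ge> 0" by (auto simp: phi_def max_def split: if_splits)
    then show ?thesis using periodic_of_int[of lam l t k] lamper by simp
  qed
  \<comment> \<open>Complementary slackness: the term with \<open>K = 1\<close> admits slowing down
    where the curvature is below 1, so \<open>lam\<close> must vanish there almost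
    everywhere.\<close>
  obtain N1 where N1: "negligible N1" "\<And>t. t \<in> {0..l} - N1 \<Longrightarrow> (1 - norm (u t)) * lam t = 0"
  proof -
    have adm: "admissible (\<lambda>t. 0) (\<lambda>t. 0) (\<lambda>t. - (1 - norm (u t))) 1"
      unfolding admissible_def using uper
      by (auto intro!: bdd_borel_intros indef_integral_const bu)
    have b: "bdd_borel (\<lambda>t. (1 - norm (u t)) * lam t)" by (intro bdd_borel_intros bu blam)
    have nn: "(1 - norm (u t)) * lam t \<ge> 0" for t using u1[of t] lam0[of t] by simp
    have "0 \<le> integral {0..l} (\<lambda>t. - ((1 - norm (u t)) * lam t))"
      using ineq[OF adm] by (simp add: algebra_simps)
    then have "integral {0..l} (\<lambda>t. (1 - norm (u t)) * lam t) \<le> 0" by simp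
    moreover have "integral {0..l} (\<lambda>t. (1 - norm (u t)) * lam t) \<ge> 0"
      by (rule integral_nonneg[OF bdd_borel_integrable_on[OF b]]) (rule nn)
    ultimately have "((\<lambda>t. (1 - norm (u t)) * lam t) has_integral 0) {0..l}"
      using integrable_integral[OF bdd_borel_integrable_on[OF b], of 0 l] by simp
    from has_integral_0_AE[OF bdd_borel_measurable[OF b] nn this] that show ?thesis by metis
  qed
  \<comment> \<open>A constant \<open>psi\<close> with the least admissible \<open>phi\<close> gives
    the integrand \<open>y t \<bullet> e\<close>. Taking for \<open>e\<close> minus the integral of
    \<open>y\<close> shows that this integral is 0, so that \<open>Y\<close> below is
    periodic.\<close>
  have yint: "(y has_integral 0) {0..l}"
  proof -
    define e where "e = - integral {0..l} y"
    have yi: "(y has_integral (- e)) {0..l}"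
      unfolding e_def using integrable_integral[OF bdd_borel_integrable_on[OF bY]] by simp
    have adm: "admissible (\<lambda>t. e) (\<lambda>t. 0) (\<lambda>t. - 2 * (T t \<bullet> e)) 0"
      unfolding admissible_def using Tper
      by (auto intro!: bdd_borel_intros indef_integral_const bT)
    have "((\<lambda>t. y t \<bullet> e) has_integral (- e \<bullet> e)) {0..l}"
      using has_integral_linear[OF yi bounded_linear_inner_left[of e]] by (simp add: o_def)
    moreover have "(\<lambda>t. - 2 * (T t \<bullet> e) * lam t + (C + r *\<^sub>R T t) \<bullet> e) = (\<lambda>t. y t \<bullet> e)"
      by (simp add: y_def inner_simps algebra_simps)
    ultimately have "0 \<le> - e \<bullet> e" using ineq[OF adm] by (simp add: integral_unique)
    then have "e = 0" using inner_ge_zero[of e] by (simp add: order_antisym_conv)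
    then show ?thesis using yi by simp
  qed
  obtain Y where Y: "indef_integral Y y"
    using indef_integral_exists[of y] bdd_borel_integrable_on[OF bY] by metis
  have Yper: "Y (t + l) = Y t" for t
    by (rule indef_integral_periodic[OF Y yper _ yint]) (use l in simp)
  have Ycont: "continuous_on UNIV Y" using bdd_borelE[OF bY] indef_integral_continuous[OF Y] by metis
  have bYY: "bdd_borel Y" by (rule bdd_borel_periodic[OF l Yper Ycont])
  \<comment> \<open>With the least admissible \<open>phi\<close> the integrand is
    \<open>lam t * (u t \<bullet> p t) + y t \<bullet> psi t\<close>. Since \<open>Y\<close>
    integrates \<open>y\<close>, integration by parts turns its integral into that of
    \<open>w t \<bullet> p t\<close>.\<close>
  define w where "w t = lam t *\<^sub>R u t - Y t" for t
  have bw: "bdd_borel w" unfolding w_def by (intro bdd_borel_intros blam bu bYY)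
  have wper: "w (t + l) = w t" for t by (simp add: w_def lamper uper Yper)
  define c where "c = (1 / l) *\<^sub>R integral {0..l} w"
  \<comment> \<open>The du Bois-Reymond choice: mean value minus \<open>w\<close>. It has mean zero,
    so \<open>psi\<close> is periodic, and the integral of \<open>w t \<bullet> p t\<close> is minus
    that of \<open>p t \<bullet> p t\<close>. Hence \<open>w\<close> is constant almost
    everywhere.\<close>
  define p where "p t = c - w t" for t
  have bp: "bdd_borel p" unfolding p_def by (intro bdd_borel_intros bw)
  have pint: "(p has_integral 0) {0..l}"
  proof -
    have "(p has_integral (l *\<^sub>R c - integral {0..l} w)) {0..l}"
      unfolding p_def using has_integral_const_real[of c 0 l] l
      by (intro has_integral_diff integrable_integral bdd_borel_integrable_on bw) auto
    then show ?thesis using l by (simp add: c_def)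
  qed
  obtain psi where psi: "indef_integral psi p"
    using indef_integral_exists[of p] bdd_borel_integrable_on[OF bp] by metis
  have psiper: "psi (t + l) = psi t" for t
    by (rule indef_integral_periodic[OF psi _ _ pint]) (use l wper in \<open>auto simp: p_def\<close>)
  have psicont: "continuous_on UNIV psi" using bdd_borelE[OF bp] indef_integral_continuous[OF psi] by metis
  have bpsi: "bdd_borel psi" by (rule bdd_borel_periodic[OF l psiper psicont])
  obtain N2 where N2: "negligible N2" "\<And>t. t \<in> {0..l} - N2 \<Longrightarrow> p t \<bullet> p t = 0"
  proof -
    define phi where "phi t = u t \<bullet> p t - 2 * (T t \<bullet> psi t)" for t
    have bphi: "bdd_borel phi" unfolding phi_def by (intro bdd_borel_intros bu bp bT bpsi)
    have adm: "admissible psi p phi 0"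
      unfolding admissible_def using psi bp bphi psiper wper uper Tper by (auto simp: phi_def p_def)
    have 1: "((\<lambda>t. y t \<bullet> psi t + Y t \<bullet> p t) has_integral 0) {0..l}"
      using indef_integralD[OF indef_integral_inner[OF Y bY psi bp bYY bpsi], of 0 l] l Yper[of 0] psiper[of 0] by simp
    have 2: "((\<lambda>t. c \<bullet> p t) has_integral 0) {0..l}"
      using has_integral_linear[OF pint bounded_linear_inner_right[of c]] by (simp add: o_def)
    have "(\<lambda>t. phi t * lam t + (C + r *\<^sub>R T t) \<bullet> psi t)
        = (\<lambda>t. (y t \<bullet> psi t + Y t \<bullet> p t) + c \<bullet> p t - p t \<bullet> p t)"
    proof
      fix t
      have "phi t * lam t + (C + r *\<^sub>R T t) \<bullet> psi t = (lam t *\<^sub>R u t) \<bullet> p t + y t \<bullet> psi t"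
        by (simp add: phi_def y_def inner_simps algebra_simps)
      also have "lam t *\<^sub>R u t = Y t + c - p t" by (simp add: p_def w_def)
      finally show "phi t * lam t + (C + r *\<^sub>R T t) \<bullet> psi t = (y t \<bullet> psi t + Y t \<bullet> p t) + c \<bullet> p t - p t \<bullet> p t"
        by (simp add: inner_simps)
    qed
    then have ge: "0 \<le> integral {0..l} (\<lambda>t. (y t \<bullet> psi t + Y t \<bullet> p t) + c \<bullet> p t - p t \<bullet> p t)"
      using ineq[OF adm] by simp
    have b: "bdd_borel (\<lambda>t. p t \<bullet> p t)" by (intro bdd_borel_intros bp)
    note 3 = integrable_integral[OF bdd_borel_integrable_on[OF b], of 0 l]
    have "integral {0..l} (\<lambda>t. p t \<bullet> p t) \<le> 0"
      using ge integral_unique[OF has_integral_diff[OF has_integral_add[OF 1 2] 3]] by simp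
    moreover have "integral {0..l} (\<lambda>t. p t \<bullet> p t) \<ge> 0"
      by (rule integral_nonneg[OF bdd_borel_integrable_on[OF b]]) auto
    ultimately have "((\<lambda>t. p t \<bullet> p t) has_integral 0) {0..l}" using 3 by simp
    from has_integral_0_AE[OF bdd_borel_measurable[OF b] inner_ge_zero this] that show ?thesis by metis
  qed
  \<comment> \<open>The integration constant of \<open>Y\<close> is fixed so that
    \<open>lam t *\<^sub>R u t = Z t\<close> almost everywhere.\<close>
  define Z where "Z t = Y t + c" for t
  have Zcont: "continuous_on UNIV Z" unfolding Z_def by (intro continuous_intros Ycont)
  have Zper: "Z (t + l) = Z t" for t by (simp add: Z_def Yper)
  have Zu: "lam t *\<^sub>R u t = Z t" if "t \<in> {0..l} - N2" for t
  proof -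
    have "p t = 0" using N2(2)[OF that] by simp
    then show ?thesis by (simp add: p_def w_def Z_def algebra_simps)
  qed
  \<comment> \<open>Almost everywhere \<open>norm (u t) = 1\<close> or \<open>lam t = 0\<close>, so
    the two sides agree almost everywhere; both are continuous.\<close>
  have Znorm: "norm (Z t) = lam t" for t
  proof -
    define h where "h t = (norm (Z t) - lam t)\<^sup>2" for t
    have hcont: "continuous_on UNIV h" unfolding h_def by (intro continuous_intros Zcont lamcont)
    have "(h has_integral 0) {0..l}"
    proof (rule has_integral_spike[where S = "N1 \<union> N2" and f = "\<lambda>t. 0"])
      show "negligible (N1 \<union> N2)" using N1(1) N2(1) by (rule negligible_Un)
      show "h t = 0" if "t \<in> {0..l} - (N1 \<union> N2)" for t
      proof -
        have "Z t = lam t *\<^sub>R u t" "(1 - norm (u t)) * lam t = 0" using Zu[of t] N1(2)[of t] that by auto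
        then show ?thesis using lam0[of t] by (auto simp: h_def)
      qed
    qed simp
    then have "\<forall>t\<in>{0..l}. h t = 0"
      using l integral_eq_0_iff[of 0 l h] hcont by (auto simp: integral_unique h_def intro: continuous_on_subset)
    moreover obtain k where k: "t + of_int k * l \<in> {0..<l}" using period_reduce[OF l] by metis
    ultimately have "h (t + of_int k * l) = 0" by auto
    moreover have "h (s + l) = h s" for s by (simp add: h_def Zper lamper)
    ultimately have "h t = 0" using periodic_of_int[of h l t k] by simp
    then show ?thesis by (simp add: h_def)
  qed
  \<comment> \<open>The exceptional set of one period, copied to all periods.\<close>
  define N where "N = (\<Union>k::int. (\<lambda>t. of_int k * l + t) ` N2)"
  have N: "negligible N"
    unfolding N_def using N2(1) by (intro negligible_countable_Union) (auto intro: negligible_translation)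
  have Zu': "lam t *\<^sub>R u t = Z t" if "t \<notin> N" for t
  proof -
    obtain k where k: "t + of_int k * l \<in> {0..<l}" using period_reduce[OF l] by metis
    have "t + of_int k * l \<notin> N2"
    proof
      assume "t + of_int k * l \<in> N2"
      then have "t \<in> (\<lambda>t. of_int (-k) * l + t) ` N2" by (intro image_eqI[of _ _ "t + of_int k * l"]) auto
      then show False using that unfolding N_def by blast
    qed
    then have "lam (t + of_int k * l) *\<^sub>R u (t + of_int k * l) = Z (t + of_int k * l)" using Zu k by auto
    then show ?thesis using periodic_of_int[of lam l t k] periodic_of_int[of u l t k] periodic_of_int[of Z l t k] lamper uper Zper by simp
  qed
  have T': "(T has_vector_derivative (1 / lam t) *\<^sub>R Z t) (at t)" if pos: "lam t > 0" for t
  proof -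
    \<comment> \<open>A version of \<open>u\<close>, equal to it off \<open>N\<close>, that is
      continuous where \<open>lam\<close> is positive. Hence \<open>T\<close> is differentiable
      there in the ordinary sense.\<close>
    define v where "v s = (if lam s > 0 then (1 / lam s) *\<^sub>R Z s else u s)" for s
    have "indef_integral T v"
      unfolding indef_integral_def
    proof (intro allI impI has_integral_spike[OF N _ indef_integralD[OF Tu]])
      fix a b s assume "s \<in> {a..b} - N"
      then show "v s = u s" using Zu'[of s, symmetric] by (auto simp: v_def)
    qed
    moreover have "isCont v t"
    proof -
      have "open {s. lam s > 0}" using lamcont by (intro open_Collect_less) auto
      then have "\<forall>\<^sub>F s in nhds t. v s = (1 / lam s) *\<^sub>R Z s"
        using pos by (auto simp: eventually_nhds v_def intro!: exI[of _ "{s. lam s > 0}"])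
      moreover have "isCont (\<lambda>s. (1 / lam s) *\<^sub>R Z s) t"
        using pos Zcont lamcont by (intro continuous_intros) (auto simp: continuous_on_eq_continuous_at)
      ultimately show ?thesis by (rule isCont_cong[THEN iffD2])
    qed
    ultimately show ?thesis using indef_integral_deriv[of T v t] pos by (simp add: v_def)
  qed
  show ?thesis
  proof (rule adjoint_ode_semicircle[OF l G Gper T1 Tper Tcont lam_def lam0 _ Zper Znorm T' Cr(2,1)])
    fix t
    have "isCont y t" using ycont by (simp add: continuous_on_eq_continuous_at)
    then have "(Y has_vector_derivative y t) (at t)" by (rule indef_integral_deriv[OF Y])
    then show "(Z has_vector_derivative C + (r - 2 * lam t) *\<^sub>R T t) (at t)"
      unfolding Z_def y_def by (auto intro!: derivative_eq_intros)
  qed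
qed

end

section \<open>Shortening a closed curve\<close>

lemma norm_has_integral_le:
  fixes f :: "'n::euclidean_space \<Rightarrow> 'b::banach"
  assumes "(f has_integral I) S" "(g has_integral J) S" "\<And>x. x \<in> S \<Longrightarrow> norm (f x) \<le> g x"
  shows "norm I \<le> J"
  using integral_norm_bound_integral[of f S g] assms by (metis has_integral_integrable integral_unique)

text \<open>Rests on the identity that
  \<open>(norm (sgn a - sgn b))\<^sup>2 * (norm a * norm b)\<close> equals
  \<open>(norm (a - b))\<^sup>2 - (norm a - norm b)\<^sup>2\<close>.\<close>

lemma norm_sgn_diff_le:
  fixes a b :: "'a::real_inner"
  assumes "0 < m" "m \<le> norm a" "m \<le> norm b"
  shows "norm (sgn a - sgn b) \<le> norm (a - b) / m"
proof -
  have ab: "norm a > 0" "norm b > 0" using assms by linarith+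
  then have "a \<noteq> 0" "b \<noteq> 0" by auto
  have e: "(norm (sgn a - sgn b))\<^sup>2 = 2 - 2 * (a \<bullet> b) / (norm a * norm b)"
  proof -
    have "(norm (sgn a - sgn b))\<^sup>2 = (norm (sgn a))\<^sup>2 + (norm (sgn b))\<^sup>2 - 2 * (sgn a \<bullet> sgn b)"
      by (simp add: power2_norm_eq_inner inner_simps inner_commute)
    then show ?thesis using \<open>a \<noteq> 0\<close> \<open>b \<noteq> 0\<close> by (simp add: norm_sgn) (simp add: sgn_div_norm divide_simps)
  qed
  have "(norm (sgn a - sgn b))\<^sup>2 * (norm a * norm b) = 2 * (norm a * norm b) - 2 * (a \<bullet> b)"
    unfolding e using ab by (simp add: field_simps)
  also have "\<dots> \<le> (norm (a - b))\<^sup>2"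
  proof -
    have "(norm (a - b))\<^sup>2 = (norm a)\<^sup>2 + (norm b)\<^sup>2 - 2 * (a \<bullet> b)"
      by (simp add: power2_norm_eq_inner inner_simps inner_commute)
    then show ?thesis using sum_squares_bound[of "norm a" "norm b"] by simp
  qed
  finally have "(norm (sgn a - sgn b))\<^sup>2 * (norm a * norm b) \<le> (norm (a - b))\<^sup>2" .
  moreover have "(norm (sgn a - sgn b))\<^sup>2 * (m * m) \<le> (norm (sgn a - sgn b))\<^sup>2 * (norm a * norm b)"
    using assms by (intro mult_left_mono mult_mono) auto
  ultimately have "(norm (sgn a - sgn b) * m)\<^sup>2 \<le> (norm (a - b))\<^sup>2"
    by (simp add: power_mult_distrib power2_eq_square[of m])
  then have "norm (sgn a - sgn b) * m \<le> norm (a - b)" by (rule power2_le_imp_le) simp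
  then show ?thesis using assms(1) by (simp add: field_simps)
qed

text \<open>Change of variable without integrability of the inverse: \<open>P\<close> is an integral of \<open>h\<close> with
  respect to \<open>F\<close>, whose density \<open>f\<close> need not be continuous.\<close>

lemma reparam_deriv:
  fixes h :: "real \<Rightarrow> 'b::euclidean_space"
  assumes P: "indef_integral P (\<lambda>t. f t *\<^sub>R h t)" and F: "indef_integral F f"
    and f0: "\<And>t. f t \<ge> 0" and h: "continuous_on UNIV h"
    and w: "continuous_on UNIV w" "\<And>s. F (w s) = k * s"
  shows "((\<lambda>s. P (w s)) has_vector_derivative (k *\<^sub>R h (w s))) (at s)"
  unfolding has_vector_derivative_def has_derivative_at_alt
proof (intro conjI allI impI)
  show "bounded_linear (\<lambda>x. x *\<^sub>R k *\<^sub>R h (w s))" by (rule bounded_linear_scaleR_left)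
  fix e :: real assume e: "e > 0"
  define e' where "e' = e / (\<bar>k\<bar> + 1)"
  have e': "e' > 0" "e' * \<bar>k\<bar> \<le> e" using e by (auto simp: e'_def field_simps)
  have "isCont h (w s)" using h by (simp add: continuous_on_eq_continuous_at)
  then obtain d1 where d1: "d1 > 0" "\<And>x. \<bar>x - w s\<bar> < d1 \<Longrightarrow> norm (h x - h (w s)) < e'"
    using e'(1) unfolding continuous_at_eps_delta by (metis dist_norm real_norm_def)
  have "isCont w s" using w(1) by (simp add: continuous_on_eq_continuous_at)
  then obtain d where d: "d > 0" "\<And>x. \<bar>x - s\<bar> < d \<Longrightarrow> \<bar>w x - w s\<bar> < d1"
    using d1(1) unfolding continuous_at_eps_delta by (metis dist_norm real_norm_def)
  have *: "norm (P b - P a - (F b - F a) *\<^sub>R h (w s)) \<le> e' * \<bar>F b - F a\<bar>"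
    if "a \<le> b" "\<bar>a - w s\<bar> < d1" "\<bar>b - w s\<bar> < d1" for a b
  proof -
    have 1: "((\<lambda>t. f t *\<^sub>R h t - f t *\<^sub>R h (w s)) has_integral (P b - P a - (F b - F a) *\<^sub>R h (w s))) {a..b}"
      using has_integral_linear[OF indef_integralD[OF F that(1)] bounded_linear_scaleR_left[of "h (w s)"]]
      by (intro has_integral_diff indef_integralD[OF P that(1)]) (simp add: o_def)
    have 2: "((\<lambda>t. e' * f t) has_integral (e' * (F b - F a))) {a..b}"
      by (intro has_integral_mult_right indef_integralD[OF F that(1)])
    have "norm (f t *\<^sub>R h t - f t *\<^sub>R h (w s)) \<le> e' * f t" if t: "t \<in> {a..b}" for t
    proof -
      have "norm (h t - h (w s)) < e'" using d1(2)[of t] t \<open>\<bar>a - w s\<bar> < d1\<close> \<open>\<bar>b - w s\<bar> < d1\<close> by auto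
      then have "f t * norm (h t - h (w s)) \<le> f t * e'" using f0 by (intro mult_left_mono) auto
      then show ?thesis using f0[of t] by (simp add: scaleR_diff_right[symmetric] mult.commute)
    qed
    then have "norm (P b - P a - (F b - F a) *\<^sub>R h (w s)) \<le> e' * (F b - F a)"
      by (rule norm_has_integral_le[OF 1 2])
    also have "\<dots> \<le> e' * \<bar>F b - F a\<bar>" using e'(1) by (intro mult_left_mono) auto
    finally show ?thesis .
  qed
  show "\<exists>d>0. \<forall>y. norm (y - s) < d \<longrightarrow>
      norm (P (w y) - P (w s) - (y - s) *\<^sub>R k *\<^sub>R h (w s)) \<le> e * norm (y - s)"
  proof (intro exI conjI allI impI)
    fix y assume y: "norm (y - s) < d"
    have F': "F (w y) - F (w s) = k * (y - s)" using w(2) by (simp add: algebra_simps)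
    have "norm (P (w y) - P (w s) - (F (w y) - F (w s)) *\<^sub>R h (w s)) \<le> e' * \<bar>F (w y) - F (w s)\<bar>"
    proof (cases "w s \<le> w y")
      case True
      have "\<bar>w y - w s\<bar> < d1" using d(2) y by simp
      then show ?thesis using *[OF True] d1 by simp
    next
      case False
      then have "norm (P (w s) - P (w y) - (F (w s) - F (w y)) *\<^sub>R h (w s)) \<le> e' * \<bar>F (w s) - F (w y)\<bar>"
        using *[of "w y" "w s"] d(2)[of y] y d1 by simp
      moreover have "P (w y) - P (w s) - (F (w y) - F (w s)) *\<^sub>R h (w s)
          = - (P (w s) - P (w y) - (F (w s) - F (w y)) *\<^sub>R h (w s))" by (simp add: algebra_simps)
      ultimately show ?thesis by (metis abs_minus_commute norm_minus_cancel)
    qed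
    also have "\<dots> = (e' * \<bar>k\<bar>) * \<bar>y - s\<bar>" by (simp add: F' abs_mult)
    also have "\<dots> \<le> e * \<bar>y - s\<bar>" by (rule mult_right_mono[OF e'(2)]) simp
    finally show "norm (P (w y) - P (w s) - (y - s) *\<^sub>R k *\<^sub>R h (w s)) \<le> e * norm (y - s)"
      by (simp add: F' mult.commute)
  qed (use d in auto)
qed

context closed_curve
begin

text \<open>Realizes a first-order shortening by an actual closed curve. \<open>Z\<close> is the new
  direction and \<open>f\<close> the new speed factor. The curvature bound is obtained exactly, not
  only to first order, because the speed is raised by the extra amount \<open>ep * a\<close>;
  closedness is restored exactly by a second-order correction of the direction.\<close>

lemma shorten:
  assumes V: "(0, B) \<in> variations" and B: "B < 0" and e: "e > 0"
  obtains G2 Z2 L where "\<And>t. (G2 has_vector_derivative Z2 t) (at t)" "continuous_on UNIV Z2"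
    "\<And>t. G2 (t + l) = G2 t" "\<And>t. norm (Z2 t - T t) < e" "\<And>t. norm (G2 t - G t) < e"
    "\<And>t. (L has_real_derivative norm (Z2 t)) (at t)"
    "\<And>s t. s \<le> t \<Longrightarrow> norm (sgn (Z2 t) - sgn (Z2 s)) \<le> L t - L s"
    "L l - L 0 < l"
proof -
  obtain psi p phi K where adm: "admissible psi p phi K"
     and iA: "((\<lambda>t. phi t *\<^sub>R T t + psi t) has_integral 0) {0..l}"
     and iB: "((\<lambda>t. phi t + T t \<bullet> psi t) has_integral B) {0..l}"
    using V unfolding variations_def by blast
  \<comment> \<open>Raising the speed by \<open>ep * a\<close> costs half of the first-order gain
    \<open>- ep * B\<close> in length; the other half covers the second-order errors in the
    length.\<close>
  define a where "a = - B / (2 * l)"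
  have a: "a > 0" "a * l = - B / 2" using B l by (auto simp: a_def divide_neg_pos)
  define m where "m t = phi t + a" for t
  have bp: "bdd_borel p" "bdd_borel phi" "bdd_borel psi" and ipsi: "indef_integral psi p" and K: "K \<ge> 0"
    and per: "psi (t + l) = psi t" "p (t + l) = p t" "m (t + l) = m t"
    and phi: "phi t \<ge> u t \<bullet> p t - 2 * (T t \<bullet> psi t) - K * (1 - norm (u t))" for t
    using adm admissible_bpsi[OF adm] unfolding admissible_def by (auto simp: m_def)
  have bm: "bdd_borel m" unfolding m_def by (intro bdd_borel_intros bp)
  obtain M1 M2 M3 where M123: "\<And>t. norm (p t) \<le> M1" "\<And>t. norm (psi t) \<le> M2" "\<And>t. norm (m t) \<le> M3"
    using bp bm bdd_borelE by metis
  define M where "M = max 1 (max M1 (max M2 M3))"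
  have M: "M \<ge> 1" "\<And>t. norm (p t) \<le> M" "\<And>t. norm (psi t) \<le> M" "\<And>t. \<bar>m t\<bar> \<le> M"
    using M123 unfolding M_def by (auto simp: le_max_iff_disj)
  \<comment> \<open>Collects all smallness requirements: \<open>ep = 1 / (2 * D)\<close> makes
    \<open>ep * x < 1\<close> for every summand \<open>x\<close>. The summand with 11 dominates the
    second-order errors, which are below 8 times \<open>(M * ep)\<^sup>2\<close> in the curvature
    and at most 9 times that in the integrand of the length. The last summand gives the distance
    \<open>e\<close>.\<close>
  define D where "D = 4 * M + 2 * K + 11 * M\<^sup>2 / a + M * (4 + 2 * l) * (1 + l) / e"
  have D: "D > 0" using M(1) K a e l by (auto simp: D_def intro!: add_pos_nonneg)
  define ep where "ep = 1 / (2 * D)"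
  have ep: "ep > 0" "ep * D < 1" using D by (auto simp: ep_def)
  have le: "ep * x < 1" if "x \<le> D" for x
    using mult_left_mono[OF that, of ep] ep by linarith
  have nn: "4 * M \<ge> 0" "2 * K \<ge> 0" "11 * M\<^sup>2 / a \<ge> 0" "M * (4 + 2 * l) * (1 + l) / e \<ge> 0"
    using M(1) K a e l by auto
  have ep1: "ep * M \<le> 1 / 4" using le[of "4 * M"] nn unfolding D_def by auto
  have ep2: "ep * K \<le> 1 / 2" using le[of "2 * K"] nn unfolding D_def by auto
  have "11 * M\<^sup>2 / a \<le> D" using nn unfolding D_def by linarith
  from le[OF this] have ep3: "11 * M\<^sup>2 * ep < a" using a(1) by (simp add: field_simps)
  have "M * (4 + 2 * l) * (1 + l) / e \<le> D" using nn unfolding D_def by linarith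
  from le[OF this] have ep4: "ep * (M * (4 + 2 * l) * (1 + l)) < e"
    using e unfolding times_divide_eq_right by (subst (asm) pos_divide_less_eq) auto
  define f where "f t = 1 + ep * m t" for t
  have epm: "\<bar>ep * m t\<bar> \<le> ep * M" for t using M(4)[of t] ep by (simp add: abs_mult)
  have f: "3 / 4 \<le> f t" "f t \<le> 5 / 4" for t using epm[of t] ep1 unfolding f_def by linarith+
  have bf: "bdd_borel f" unfolding f_def by (intro bdd_borel_intros bm)
  obtain F where F: "indef_integral F f" "F 0 = 0"
    using indef_integral_exists[of f 0] bdd_borel_integrable_on[OF bf] by metis
  have Fb: "norm (F t - F s - (t - s)) \<le> ep * M * (t - s)" if "s \<le> t" for s t
  proof -
    have "((\<lambda>t. f t - 1) has_integral (F t - F s - (t - s))) {s..t}"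
      using that has_integral_const_real[of "1::real" s t]
      by (intro has_integral_diff indef_integralD[OF F(1) that]) simp
    from has_integral_bound_real[OF _ finite.emptyI this, of "ep * M"] show ?thesis
      using that epm ep M(1) by (simp add: f_def)
  qed
  have Fexp: "1 / 2 * (t - s) \<le> F t - F s" if "s \<le> t" for s t
  proof -
    have "ep * M * (t - s) \<le> 1 / 4 * (t - s)" using ep1 that by (intro mult_right_mono) auto
    then show ?thesis using Fb[OF that] that by (simp add: abs_le_iff field_simps)
  qed
  have fbound: "norm (f t) \<le> 5 / 4" for t using f[of t] by simp
  have Fcont: "continuous_on UNIV F"
    using indef_integral_continuous[OF F(1) fbound] .
  obtain Fi where Fi: "\<And>y. F (Fi y) = y" "\<And>x. Fi (F x) = x" "\<And>x y. \<bar>Fi y - Fi x\<bar> \<le> \<bar>y - x\<bar> / (1/2)" "strict_mono F"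
    using expanding_inverse[of "1/2" F] Fexp Fcont by (metis half_gt_zero zero_less_one)
  define Fl where "Fl = F l"
  have Fl: "norm (Fl - l) \<le> ep * M * l" "Fl \<ge> l / 2" using Fb[of 0 l] Fexp[of 0 l] l F(2) by (auto simp: Fl_def)
  have Fl0: "Fl > 0" using Fl(2) l by simp
  have Fper: "F (t + l) = F t + Fl" for t
  proof -
    have "F (t + l) - F t = F (0 + l) - F 0"
      using indef_integral_shift[OF F(1), of l] F(1) by (intro indef_integral_unique) (auto simp: f_def[abs_def] per)
    then show ?thesis using F(2) by (simp add: Fl_def)
  qed
  \<comment> \<open>The first-order closing defect is 0, and what is left is
    \<open>ep\<^sup>2\<close> times the integral of \<open>m t *\<^sub>R psi t\<close>. Since the
    speed factor has total integral \<open>Fl\<close>, subtracting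
    \<open>ep\<^sup>2 *\<^sub>R c1\<close> from the direction removes it exactly.\<close>
  define c1 where "c1 = (1 / Fl) *\<^sub>R integral {0..l} (\<lambda>t. m t *\<^sub>R psi t)"
  define psi' where "psi' t = psi t - ep *\<^sub>R c1" for t
  define Z where "Z t = T t + ep *\<^sub>R psi' t" for t
  have ic1: "((\<lambda>t. m t *\<^sub>R psi t) has_integral Fl *\<^sub>R c1) {0..l}"
    using integrable_integral[OF bdd_borel_integrable_on, of "\<lambda>t. m t *\<^sub>R psi t" 0 l] Fl0 bm bp
    by (simp add: c1_def bdd_borel_intros)
  have c1: "norm c1 \<le> 2 * M\<^sup>2"
  proof -
    have "norm (Fl *\<^sub>R c1) \<le> M\<^sup>2 * l"
      using has_integral_bound_real[OF _ finite.emptyI ic1, of "M\<^sup>2"] l mult_mono[OF M(4) M(3)] M(1)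
      by (simp add: power2_eq_square)
    then have "norm c1 * Fl \<le> M\<^sup>2 * l" using Fl0 by (simp add: mult.commute)
    moreover have "norm c1 * (l / 2) \<le> norm c1 * Fl" using Fl by (intro mult_left_mono) auto
    ultimately have "norm c1 * (l / 2) \<le> (2 * M\<^sup>2) * (l / 2)" by simp
    then show ?thesis using l by simp
  qed
  have epc1: "norm (ep *\<^sub>R c1) \<le> 2 * M\<^sup>2 * ep" using c1 ep by (simp add: mult.commute)
  have Mep: "M\<^sup>2 * ep \<le> M / 4" using mult_left_mono[OF ep1, of M] M(1) by (simp add: power2_eq_square mult_ac)
  have psi'b: "norm (psi' t) \<le> 2 * M" for t
  proof -
    have "norm (psi' t) \<le> norm (psi t) + norm (ep *\<^sub>R c1)" unfolding psi'_def by (rule norm_triangle_ineq4)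
    then show ?thesis using M(3)[of t] epc1 Mep M(1) by linarith
  qed
  have ZT: "norm (Z t - T t) \<le> 2 * (ep * M)" for t
    using psi'b[of t] ep by (simp add: Z_def)
  have Zb: "1 / 2 \<le> norm (Z t)" "norm (Z t) \<le> 2" for t
    using ZT[of t] ep1 T1[of t] norm_triangle_ineq2[of "T t" "Z t"] norm_triangle_ineq2[of "Z t" "T t"]
    by (simp_all add: norm_minus_commute)
  define q where "q t = ep * (T t \<bullet> psi t)" for t
  have Tpsi: "\<bar>T t \<bullet> psi t\<bar> \<le> M" for t
    using Cauchy_Schwarz_ineq2[of "T t" "psi t"] M(3)[of t] T1[of t] by simp
  have q: "\<bar>q t\<bar> \<le> ep * M" for t
    using Tpsi[of t] ep by (simp add: q_def abs_mult)
  have ZZ: "(norm (Z t))\<^sup>2 \<ge> 1 + 2 * q t - 4 * M\<^sup>2 * ep\<^sup>2" "(norm (Z t))\<^sup>2 \<le> 1 + 2 * q t + 8 * M\<^sup>2 * ep\<^sup>2" for t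
  proof -
    have 0: "(norm (Z t))\<^sup>2 = 1 + 2 * (ep * (T t \<bullet> psi' t)) + ep\<^sup>2 * (norm (psi' t))\<^sup>2"
      using T1[of t] unfolding Z_def norm_add_scaleR_square by simp
    have 1: "ep * (T t \<bullet> psi' t) = q t - ep\<^sup>2 * (T t \<bullet> c1)"
      by (simp add: psi'_def q_def inner_simps power2_eq_square algebra_simps)
    have "\<bar>T t \<bullet> c1\<bar> \<le> 2 * M\<^sup>2" using Cauchy_Schwarz_ineq2[of "T t" c1] c1 T1[of t] by simp
    then have "\<bar>ep\<^sup>2 * (T t \<bullet> c1)\<bar> \<le> ep\<^sup>2 * (2 * M\<^sup>2)" by (simp add: abs_mult mult_left_mono)
    then have 2: "\<bar>ep\<^sup>2 * (T t \<bullet> c1)\<bar> \<le> 2 * (M\<^sup>2 * ep\<^sup>2)" by (simp add: mult_ac)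
    have "ep\<^sup>2 * (norm (psi' t))\<^sup>2 \<le> ep\<^sup>2 * (2 * M)\<^sup>2"
      using psi'b[of t] by (intro mult_left_mono power_mono) auto
    then have 3: "ep\<^sup>2 * (norm (psi' t))\<^sup>2 \<le> 4 * (M\<^sup>2 * ep\<^sup>2)" by (simp add: power_mult_distrib mult_ac)
    have 4: "0 \<le> ep\<^sup>2 * (norm (psi' t))\<^sup>2" by simp
    show "(norm (Z t))\<^sup>2 \<ge> 1 + 2 * q t - 4 * M\<^sup>2 * ep\<^sup>2" "(norm (Z t))\<^sup>2 \<le> 1 + 2 * q t + 8 * M\<^sup>2 * ep\<^sup>2"
      using 0 1 2 3 4 unfolding mult.assoc by linarith+
  qed
  have em: "\<bar>ep * m t\<bar> * \<bar>q t\<bar> \<le> (ep * M) * (ep * M)" for t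
    by (intro mult_mono epm q) (use ep M in auto)
  have emq: "- (M\<^sup>2 * ep\<^sup>2) \<le> ep * m t * q t" "ep * m t * q t \<le> M\<^sup>2 * ep\<^sup>2" for t
    using em[of t] by (auto simp: abs_mult[symmetric] abs_le_iff power2_eq_square algebra_simps)
  have Mep2: "M\<^sup>2 * ep\<^sup>2 \<ge> 0" by simp
  have fem: "f t * (M\<^sup>2 * ep\<^sup>2) \<le> 5 / 4 * (M\<^sup>2 * ep\<^sup>2)" for t
    by (intro mult_right_mono f) simp
  \<comment> \<open>A curve with velocity \<open>f t *\<^sub>R Z t\<close> has curvature at most the
    norm of the derivative of \<open>Z\<close> divided by \<open>f t * (norm (Z t))\<^sup>2\<close>,
    so this is the bound 1. The norm is linearized by \<open>2 * x \<le> 1 + x\<^sup>2\<close>, and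
    \<open>(norm (u t))\<^sup>2 \<le> norm (u t)\<close> leaves a surplus
    \<open>1 - norm (u t)\<close> that pays for the term with \<open>K\<close>.\<close>
  have curv: "norm (u t + ep *\<^sub>R p t) \<le> f t * (norm (Z t))\<^sup>2" for t
  proof -
    have "f t * (norm (Z t))\<^sup>2 \<ge> f t * (1 + 2 * q t - 4 * M\<^sup>2 * ep\<^sup>2)"
      using ZZ(1)[of t] f[of t] by (intro mult_left_mono) auto
    moreover have "f t * (1 + 2 * q t - 4 * M\<^sup>2 * ep\<^sup>2) = 1 + ep * m t + 2 * q t + 2 * (ep * m t * q t) - 4 * (f t * (M\<^sup>2 * ep\<^sup>2))"
      by (simp add: f_def algebra_simps)
    ultimately have 1: "f t * (norm (Z t))\<^sup>2 \<ge> 1 + ep * m t + 2 * q t - 7 * (M\<^sup>2 * ep\<^sup>2)"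
      using emq[of t] fem[of t] by linarith
    define x where "x = norm (u t + ep *\<^sub>R p t)"
    have "2 * x \<le> 1 + x\<^sup>2" using zero_le_power2[of "x - 1"] by (simp add: power2_eq_square algebra_simps)
    moreover have "x\<^sup>2 = (norm (u t))\<^sup>2 + 2 * (ep * (u t \<bullet> p t)) + ep\<^sup>2 * (norm (p t))\<^sup>2"
      unfolding x_def norm_add_scaleR_square by simp
    moreover have "(norm (u t))\<^sup>2 \<le> norm (u t)" using u1[of t] by (simp add: power2_eq_square mult_left_le)
    moreover have "ep\<^sup>2 * (norm (p t))\<^sup>2 \<le> ep\<^sup>2 * M\<^sup>2" using M(2)[of t] by (intro mult_left_mono power_mono) auto
    moreover have "ep * (u t \<bullet> p t) \<le> ep * phi t + 2 * q t + (ep * K) * (1 - norm (u t))"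
      using mult_left_mono[OF phi[of t], of ep] ep by (simp add: q_def algebra_simps)
    moreover have "(ep * K) * (1 - norm (u t)) \<le> 1 / 2 * (1 - norm (u t))"
      using ep2 u1[of t] by (intro mult_right_mono) auto
    ultimately have "2 * x \<le> 2 + 2 * (ep * phi t) + 4 * q t + M\<^sup>2 * ep\<^sup>2" by (simp add: mult.commute)
    moreover have "ep * m t = ep * phi t + ep * a" by (simp add: m_def ring_distribs)
    moreover have "11 * (M\<^sup>2 * ep\<^sup>2) \<le> ep * a"
      using mult_left_mono[OF less_imp_le[OF ep3], of ep] ep by (simp add: power2_eq_square algebra_simps)
    ultimately show ?thesis using 1 Mep2 unfolding x_def by linarith
  qed
  have bZ: "bdd_borel Z" unfolding Z_def psi'_def by (intro bdd_borel_intros bT bp)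
  have Zper: "Z (t + l) = Z t" for t by (simp add: Z_def psi'_def Tper per)
  have iZ: "indef_integral Z (\<lambda>t. u t + ep *\<^sub>R p t)"
  proof -
    have "indef_integral (\<lambda>t. (T t + ep *\<^sub>R psi t) + (- (ep *\<^sub>R ep *\<^sub>R c1))) (\<lambda>t. (u t + ep *\<^sub>R p t) + 0)"
      by (intro indef_integral_add indef_integral_scaleR indef_integral_const Tu ipsi)
    then show ?thesis by (simp add: Z_def[abs_def] psi'_def algebra_simps)
  qed
  have up2: "norm (u t + ep *\<^sub>R p t) \<le> 2" for t
  proof -
    have "norm (ep *\<^sub>R p t) \<le> ep * M" using M(2)[of t] ep by simp
    then show ?thesis using norm_triangle_ineq[of "u t" "ep *\<^sub>R p t"] u1[of t] ep1 by linarith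
  qed
  have Zlip: "norm (Z t - Z s) \<le> 2 * \<bar>t - s\<bar>" for s t
    using indef_integral_lipschitz[OF iZ up2] .
  have Zcont: "continuous_on UNIV Z" using indef_integral_continuous[OF iZ up2] .
  \<comment> \<open>Running through the curve at constant rate with respect to \<open>F\<close>
    removes the measurable factor \<open>f\<close> from the velocity, which becomes the continuous
    function \<open>Fl / l\<close> times \<open>Z (w s)\<close>. The rate \<open>Fl / l\<close>
    keeps the period \<open>l\<close>.\<close>
  define w where "w s = Fi (Fl / l * s)" for s
  have Fw: "F (w s) = Fl / l * s" for s by (simp add: w_def Fi)
  have wcont: "continuous_on UNIV w"
  proof -
    have "\<bar>Fi y - Fi x\<bar> \<le> 2 * \<bar>y - x\<bar>" for x y using Fi(3)[of y x] by simp
    then have "2-lipschitz_on UNIV Fi" by (auto intro!: lipschitz_onI simp: dist_real_def abs_minus_commute)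
    then have "continuous_on UNIV Fi" by (rule lipschitz_on_continuous_on)
    moreover have "continuous_on UNIV (\<lambda>s. Fl / l * s)" by (rule continuous_on_mult_left) simp
    ultimately show ?thesis unfolding w_def by (rule continuous_on_compose2) simp
  qed
  have wper: "w (s + l) = w s + l" for s
  proof -
    have "F (w (s + l)) = F (w s + l)" using l by (simp add: Fper Fw ring_distribs)
    then show ?thesis using Fi(2) by metis
  qed
  have w0: "w 0 = 0" using Fi(2)[of 0] F(2) by (simp add: w_def)
  have f0: "f t \<ge> 0" for t using f[of t] by simp
  have bfZ: "bdd_borel (\<lambda>t. f t *\<^sub>R Z t)" by (intro bdd_borel_intros bf bZ)
  obtain P where P: "indef_integral P (\<lambda>t. f t *\<^sub>R Z t)" "P 0 = G 0"
    using indef_integral_exists[of "\<lambda>t. f t *\<^sub>R Z t" "G 0"] bdd_borel_integrable_on[OF bfZ] by metis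
  have closed: "((\<lambda>t. f t *\<^sub>R Z t) has_integral 0) {0..l}"
  proof -
    have i1: "(f has_integral Fl) {0..l}" using indef_integralD[OF F(1), of 0 l] l F(2) by (simp add: Fl_def)
    have i2: "((\<lambda>t. T t + (ep *\<^sub>R (phi t *\<^sub>R T t + psi t) + (ep * a) *\<^sub>R T t + ep\<^sup>2 *\<^sub>R (m t *\<^sub>R psi t)) - f t *\<^sub>R (ep\<^sup>2 *\<^sub>R c1))
       has_integral 0 + (ep *\<^sub>R 0 + (ep * a) *\<^sub>R 0 + ep\<^sup>2 *\<^sub>R (Fl *\<^sub>R c1)) - Fl *\<^sub>R (ep\<^sup>2 *\<^sub>R c1)) {0..l}"
      by (intro has_integral_add has_integral_diff has_integral_cmul iA T_has_integral_0 ic1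
          has_integral_linear[OF i1 bounded_linear_scaleR_left, unfolded o_def])
    moreover have "(\<lambda>t. T t + (ep *\<^sub>R (phi t *\<^sub>R T t + psi t) + (ep * a) *\<^sub>R T t + ep\<^sup>2 *\<^sub>R (m t *\<^sub>R psi t)) - f t *\<^sub>R (ep\<^sup>2 *\<^sub>R c1)) = (\<lambda>t. f t *\<^sub>R Z t)"
      by (simp add: fun_eq_iff f_def Z_def psi'_def m_def algebra_simps power2_eq_square)
    ultimately show ?thesis by (simp add: mult.commute)
  qed
  have Pper: "P (t + l) = P t" for t
    by (rule indef_integral_periodic[OF P(1) _ _ closed]) (use l per in \<open>auto simp: f_def Zper\<close>)
  have bfn: "bdd_borel (\<lambda>t. f t *\<^sub>R norm (Z t))" by (intro bdd_borel_intros bf bZ)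
  obtain S where S: "indef_integral S (\<lambda>t. f t *\<^sub>R norm (Z t))"
    using indef_integral_exists[of "\<lambda>t. f t *\<^sub>R norm (Z t)"] bdd_borel_integrable_on[OF bfn] by metis
  define k where "k = Fl / l"
  have k: "\<bar>k - 1\<bar> \<le> ep * M" "k > 0"
  proof -
    have "k - 1 = (Fl - l) / l" using l by (simp add: k_def field_simps)
    then have "\<bar>k - 1\<bar> = \<bar>Fl - l\<bar> / l" using l by simp
    also have "\<dots> \<le> ep * M" using Fl(1) l by (subst pos_divide_le_eq) auto
    finally show "\<bar>k - 1\<bar> \<le> ep * M" .
    show "k > 0" using Fl0 l by (simp add: k_def)
  qed
  define G2 where "G2 s = P (w s)" for s
  define Z2 where "Z2 s = k *\<^sub>R Z (w s)" for s
  define L where "L s = S (w s)" for s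
  have G2: "(G2 has_vector_derivative Z2 s) (at s)" for s
    unfolding G2_def Z2_def by (rule reparam_deriv[OF P(1) F(1) f0 Zcont wcont]) (simp add: Fw k_def)
  have L: "(L has_real_derivative norm (Z2 s)) (at s)" for s
  proof -
    have "((\<lambda>s. S (w s)) has_vector_derivative k *\<^sub>R norm (Z (w s))) (at s)"
      by (rule reparam_deriv[OF S F(1) f0 _ wcont]) (auto simp: Fw k_def intro!: continuous_intros Zcont)
    then show ?thesis using k(2) by (simp add: L_def[abs_def] Z2_def has_real_derivative_iff_has_vector_derivative)
  qed
  \<comment> \<open>The integrated curvature bound, with \<open>S\<close> as arclength. On a short
    interval \<open>norm (Z t)\<close> is nearly constant, so one factor of its square in
    \<open>curv\<close> can be traded for the minimum \<open>mm\<close> of the end values, as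
    normalizing the tangents requires.\<close>
  have Smono: "norm (sgn (Z t) - sgn (Z s)) \<le> S t - S s" if st: "s \<le> t" for s t
  proof (rule norm_diff_le_of_local[OF st])
    fix h :: real assume h: "h > 0"
    have "norm (sgn (Z t') - sgn (Z s')) \<le> (1 + h) * (S t' - S s')" if s't': "s' \<le> t'" "t' - s' < h / 8" for s' t'
    proof -
      define mm where "mm = min (norm (Z s')) (norm (Z t'))"
      have mm: "mm \<ge> 1 / 2" using Zb by (simp add: mm_def)
      have Zx: "norm (Z x) \<le> (1 + h) * mm" if x: "x \<in> {s'..t'}" for x
      proof -
        have "norm (Z x) \<le> norm (Z s') + 2 * (t' - s')" "norm (Z x) \<le> norm (Z t') + 2 * (t' - s')"
          using norm_triangle_ineq2[of "Z x" "Z s'"] norm_triangle_ineq2[of "Z x" "Z t'"] Zlip[of x s'] Zlip[of x t'] x by auto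
        then have "norm (Z x) \<le> mm + 2 * (t' - s')" by (simp add: mm_def min_def)
        also have "2 * (t' - s') \<le> h * (1 / 2)" using s't' by simp
        also have "h * (1 / 2) \<le> h * mm" using h mm by (intro mult_left_mono) auto
        finally show ?thesis by (simp add: algebra_simps)
      qed
      have 1: "((\<lambda>x. ((1 + h) * mm) * (f x *\<^sub>R norm (Z x))) has_integral ((1 + h) * mm) * (S t' - S s')) {s'..t'}"
        by (intro has_integral_mult_right indef_integralD[OF S] s't')
      have "norm (u x + ep *\<^sub>R p x) \<le> ((1 + h) * mm) * (f x *\<^sub>R norm (Z x))" if "x \<in> {s'..t'}" for x
      proof -
        have "f x * (norm (Z x))\<^sup>2 = norm (Z x) * (f x * norm (Z x))" by (simp add: power2_eq_square)
        also have "\<dots> \<le> ((1 + h) * mm) * (f x * norm (Z x))" using Zx[OF that] f0 by (intro mult_right_mono) auto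
        finally show ?thesis using curv[of x] by simp
      qed
      then have "norm (Z t' - Z s') \<le> ((1 + h) * mm) * (S t' - S s')"
        by (rule norm_has_integral_le[OF indef_integralD[OF iZ s't'(1)] 1])
      then have "norm (Z t' - Z s') / mm \<le> (1 + h) * (S t' - S s')" using mm by (simp add: field_simps)
      moreover have "norm (sgn (Z t') - sgn (Z s')) \<le> norm (Z t' - Z s') / mm"
        by (rule norm_sgn_diff_le) (use mm in \<open>auto simp: mm_def\<close>)
      ultimately show ?thesis by simp
    qed
    then show "\<exists>d>0. \<forall>s' t'. s \<le> s' \<and> s' \<le> t' \<and> t' \<le> t \<and> t' - s' < d \<longrightarrow>
        norm (sgn (Z t') - sgn (Z s')) \<le> (1 + h) * (S t' - S s')"
      using h by (intro exI[of _ "h / 8"]) auto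
  qed
  have wmono: "w s \<le> w t" if "s \<le> t" for s t
  proof -
    have "F (w s) \<le> F (w t)" using that k(2) by (simp add: Fw k_def[symmetric])
    then show ?thesis using Fi(4) by (simp add: strict_mono_less_eq)
  qed
  have short: "S l - S 0 < l"
  proof -
    have "f t *\<^sub>R norm (Z t) \<le> 1 + ep * (phi t + T t \<bullet> psi t) + ep * a + 9 * (M\<^sup>2 * ep\<^sup>2)" for t
    proof -
      have "2 * norm (Z t) \<le> 1 + (norm (Z t))\<^sup>2" using zero_le_power2[of "norm (Z t) - 1"] by (simp add: power2_eq_square algebra_simps)
      then have "norm (Z t) \<le> 1 + q t + 4 * M\<^sup>2 * ep\<^sup>2" using ZZ(2)[of t] by simp
      then have "f t * norm (Z t) \<le> f t * (1 + q t + 4 * M\<^sup>2 * ep\<^sup>2)" using f0 by (rule mult_left_mono)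
      also have "\<dots> = 1 + ep * m t + q t + ep * m t * q t + 4 * (f t * (M\<^sup>2 * ep\<^sup>2))" by (simp add: f_def algebra_simps)
      also have "\<dots> \<le> 1 + ep * m t + q t + 9 * (M\<^sup>2 * ep\<^sup>2)" using emq(2)[of t] fem[of t] Mep2 by linarith
      finally show ?thesis by (simp add: m_def q_def algebra_simps)
    qed
    moreover have "((\<lambda>t. 1 + ep * (phi t + T t \<bullet> psi t) + ep * a + 9 * (M\<^sup>2 * ep\<^sup>2)) has_integral
        (l + ep * B + ep * a * l + 9 * (M\<^sup>2 * ep\<^sup>2) * l)) {0..l}"
    proof -
      have "((\<lambda>t. c) has_integral (c * l)) {0..l}" for c :: real
        using has_integral_const_real[of c 0 l] l by (simp add: mult.commute)
      from this[of 1] this[of "ep * a"] this[of "9 * (M\<^sup>2 * ep\<^sup>2)"] show ?thesis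
        by (intro has_integral_add has_integral_mult_right iB) auto
    qed
    ultimately have "S l - S 0 \<le> l + ep * B + ep * a * l + 9 * (M\<^sup>2 * ep\<^sup>2) * l"
      using has_integral_le[OF indef_integralD[OF S, of 0 l]] l by auto
    also have "9 * (M\<^sup>2 * ep\<^sup>2) * l < ep * a * l"
    proof -
      have "9 * M\<^sup>2 * ep \<le> 11 * M\<^sup>2 * ep" using ep by (intro mult_right_mono) auto
      then have "9 * M\<^sup>2 * ep < a" using ep3 by linarith
      then have "ep * (9 * M\<^sup>2 * ep) < ep * a" using ep(1) by (rule mult_strict_left_mono)
      then have "ep * (9 * M\<^sup>2 * ep) * l < ep * a * l" using l by (intro mult_strict_right_mono) auto
      then show ?thesis by (simp add: power2_eq_square mult_ac)
    qed
    also have "l + ep * B + ep * a * l + ep * a * l = l"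
      using a(2) by (simp add: mult.assoc)
    finally show ?thesis by simp
  qed
  \<comment> \<open>\<open>2 * (ep * M)\<close> for rescaling by \<open>k\<close>,
    \<open>2 * (ep * M)\<close> for \<open>Z\<close> against \<open>T\<close>, and
    \<open>2 * (ep * M) * l\<close> for the shift of the parameter. Integration over a period costs
    another factor \<open>l\<close> for the positions.\<close>
  define e1 where "e1 = ep * (M * (4 + 2 * l))"
  have e1: "e1 > 0" "e1 * (1 + l) < e" "e1 < e"
  proof -
    show "e1 > 0" using ep M(1) l by (simp add: e1_def)
    show "e1 * (1 + l) < e" using ep4 by (simp add: e1_def mult_ac)
    moreover have "e1 \<le> e1 * (1 + l)" using \<open>e1 > 0\<close> l by simp
    ultimately show "e1 < e" by linarith
  qed
  have Z2T: "norm (Z2 s - T s) \<le> e1" if s: "s \<in> {0..l}" for s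
  proof -
    have "norm (Z2 s - T s) \<le> norm (Z2 s - Z (w s)) + norm (Z (w s) - T (w s)) + norm (T (w s) - T s)"
      using norm_triangle_ineq[of "Z2 s - Z (w s)" "Z (w s) - T s"]
        norm_triangle_ineq[of "Z (w s) - T (w s)" "T (w s) - T s"] by simp
    moreover have "norm (Z2 s - Z (w s)) \<le> 2 * (ep * M)"
    proof -
      have "Z2 s - Z (w s) = (k - 1) *\<^sub>R Z (w s)" by (simp add: Z2_def algebra_simps)
      moreover have "\<bar>k - 1\<bar> * norm (Z (w s)) \<le> (ep * M) * 2"
        by (intro mult_mono k Zb) (use ep M in auto)
      ultimately show ?thesis by simp
    qed
    moreover have "norm (T (w s) - T s) \<le> 2 * (ep * M) * l"
    proof -
      have w: "0 \<le> w s" "w s \<le> l" using wmono[of 0 s] wmono[of s l] s w0 wper[of 0] by auto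
      have "\<bar>F (w s) - w s\<bar> \<le> ep * M * w s" using Fb[of 0 "w s"] w F(2) by simp
      also have "\<dots> \<le> ep * M * l" using w ep M(1) by (intro mult_left_mono) auto
      finally have "\<bar>k * s - w s\<bar> \<le> ep * M * l" using Fw[of s] by (simp add: k_def)
      moreover have "\<bar>k * s - s\<bar> \<le> ep * M * l"
      proof -
        have "k * s - s = (k - 1) * s" by (simp add: algebra_simps)
        moreover have "\<bar>k - 1\<bar> * \<bar>s\<bar> \<le> (ep * M) * l" by (intro mult_mono k) (use s ep M in auto)
        ultimately show ?thesis by (simp add: abs_mult)
      qed
      ultimately have "\<bar>w s - s\<bar> \<le> 2 * (ep * M) * l" by linarith
      then show ?thesis using indef_integral_lipschitz[OF Tu u1, of "w s" s] by simp
    qed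
    ultimately show ?thesis using ZT[of "w s"] by (simp add: e1_def algebra_simps)
  qed
  have G2G: "norm (G2 s - G s) \<le> e1 * l" if s: "s \<in> {0..l}" for s
  proof -
    have "((\<lambda>t. G2 t - G t) has_derivative (\<lambda>h. h *\<^sub>R (Z2 t - T t))) (at t within {0..l})" for t
      using has_vector_derivative_diff[OF G2 G, of t]
      by (auto simp: has_vector_derivative_def intro: has_derivative_at_withinI)
    moreover have "onorm (\<lambda>h. h *\<^sub>R (Z2 t - T t)) \<le> e1" if "t \<in> {0..l}" for t
    proof (rule onorm_le)
      fix x :: real
      show "norm (x *\<^sub>R (Z2 t - T t)) \<le> e1 * norm x"
        using mult_right_mono[OF Z2T[OF that], of "\<bar>x\<bar>"] by (simp add: mult.commute)
    qed
    ultimately have "norm ((G2 s - G s) - (G2 0 - G 0)) \<le> e1 * norm (s - 0)"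
      by (intro differentiable_bound[of "{0..l}"]) (use s l in auto)
    moreover have "G2 0 = G 0" by (simp add: G2_def w0 P(2))
    moreover have "e1 * s \<le> e1 * l" using s e1 by (intro mult_left_mono) auto
    ultimately show ?thesis using s by simp
  qed
  show ?thesis
  proof
    show "(G2 has_vector_derivative Z2 t) (at t)" for t by (rule G2)
    show "continuous_on UNIV Z2" unfolding Z2_def
      by (intro continuous_intros continuous_on_compose2[OF Zcont] wcont) auto
    show G2per: "G2 (t + l) = G2 t" for t by (simp add: G2_def wper Pper)
    have Z2per: "Z2 (t + l) = Z2 t" for t by (simp add: Z2_def wper Zper)
    fix t
    obtain j where j: "t + of_int j * l \<in> {0..<l}" using period_reduce[OF l] by metis
    define t' where "t' = t + of_int j * l"
    have t': "t' \<in> {0..l}" using j by (auto simp: t'_def)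
    have "Z2 t' = Z2 t" "T t' = T t" "G2 t' = G2 t" "G t' = G t"
      unfolding t'_def using periodic_of_int[of Z2 l t j] periodic_of_int[of T l t j]
        periodic_of_int[of G2 l t j] periodic_of_int[of G l t j] Z2per Tper G2per Gper by auto
    then show "norm (Z2 t - T t) < e" "norm (G2 t - G t) < e"
      using Z2T[OF t'] G2G[OF t'] e1 by (auto simp: algebra_simps)
    show "(L has_real_derivative norm (Z2 t)) (at t)" by (rule L)
    show "norm (sgn (Z2 t) - sgn (Z2 s)) \<le> L t - L s" if "s \<le> t" for s t
      using Smono[OF wmono[OF that]] k(2) by (simp add: Z2_def L_def sgn_scaleR)
    show "L l - L 0 < l" using short w0 wper[of 0] by (simp add: L_def)
  qed
qed

lemma semicircle_or_shorten:
  assumes "\<nexists>a. T (a + pi) = - T a \<and> (G (a + pi) - G a) \<bullet> T a = 0 \<and> norm (G (a + pi) - G a) = 2"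
    and e: "e > 0"
  obtains G2 Z2 L where "\<And>t. (G2 has_vector_derivative Z2 t) (at t)" "continuous_on UNIV Z2"
    "\<And>t. G2 (t + l) = G2 t" "\<And>t. norm (Z2 t - T t) < e" "\<And>t. norm (G2 t - G t) < e"
    "\<And>t. (L has_real_derivative norm (Z2 t)) (at t)"
    "\<And>s t. s \<le> t \<Longrightarrow> norm (sgn (Z2 t) - sgn (Z2 s)) \<le> L t - L s"
    "L l - L 0 < l"
proof -
  obtain B where "B < 0" "(0, B) \<in> variations"
    using semicircle_if_no_variation assms(1) by blast
  from shorten[OF this(2,1) e] that show ?thesis by metis
qed

end

section \<open>Links and their thickness\<close>

lemma finite_min_pos:
  fixes P :: "nat \<Rightarrow> real \<Rightarrow> bool"
  assumes "\<And>i. i < m \<Longrightarrow> \<exists>d>0. P i d" and "\<And>i d d'. P i d \<Longrightarrow> 0 < d' \<Longrightarrow> d' \<le> d \<Longrightarrow> P i d'"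
  shows "\<exists>d>0. \<forall>i<m. P i d"
  using assms(1)
proof (induction m)
  case 0 then show ?case by (auto intro: exI[of _ 1])
next
  case (Suc m)
  then obtain d d' where "d > 0" "\<forall>i<m. P i d" "d' > 0" "P m d'" by (meson lessI less_Suc_eq)
  then show ?case
    using assms(2) by (intro exI[of _ "min d d'"]) (auto simp: less_Suc_eq)
qed

lemma continuous_on_family:
  fixes g :: "nat \<Rightarrow> real \<Rightarrow> 'b::topological_space"
  assumes "\<And>i. i < m \<Longrightarrow> continuous_on UNIV (g i)"
  shows "continuous_on ({..<m} \<times> UNIV) (\<lambda>x. g (fst x) (snd x))"
proof -
  have "continuous_on ({i} \<times> UNIV) (\<lambda>x. g (fst x) (snd x))" if "i < m" for i
  proof -
    have "continuous_on ({i} \<times> UNIV) (\<lambda>x. g i (snd x))"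
      by (intro continuous_on_compose2[OF assms[OF that]] continuous_intros) auto
    then show ?thesis by (rule continuous_on_eq) auto
  qed
  then have "continuous_on (\<Union>i\<in>{..<m}. {i} \<times> UNIV) (\<lambda>x. g (fst x) (snd x))"
    by (intro continuous_on_open_UN) (auto intro!: open_Times open_discrete)
  moreover have "(\<Union>i\<in>{..<m}. {i} \<times> (UNIV :: real set)) = {..<m} \<times> UNIV" by auto
  ultimately show ?thesis by simp
qed

lemma continuous_attains_pos_inf:
  fixes f :: "'b::t2_space \<Rightarrow> real"
  assumes "compact A" "continuous_on A f" "\<And>x. x \<in> A \<Longrightarrow> f x > 0"
  shows "\<exists>c>0. \<forall>x\<in>A. c \<le> f x"
proof (cases "A = {}")
  case False
  then show ?thesis using continuous_attains_inf[OF assms(1) _ assms(2)] assms(3) by metis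
qed (auto intro: exI[of _ 1])

section \<open>Periodicity, compactness and arclength for links\<close>

context
  fixes m :: nat and g :: "nat \<Rightarrow> real \<Rightarrow> 'a::euclidean_space"
  assumes lk: "is_link m g"
begin

lemma link_deriv: "i < m \<Longrightarrow> (g i has_vector_derivative ltan g i t) (at t)"
  using lk unfolding is_link_def ltan_def by (simp add: vector_derivative_works)

lemma link_periodic: "i < m \<Longrightarrow> g i (t + 1) = g i t"
  using lk unfolding is_link_def by simp

lemma link_periodic_int: "i < m \<Longrightarrow> g i (t + of_int k) = g i t"
  using periodic_of_int[of "g i" 1 t k] link_periodic by simp

lemma ltan_periodic: "i < m \<Longrightarrow> ltan g i (t + 1) = ltan g i t"
proof -
  assume i: "i < m"
  have "((\<lambda>s. s + 1) has_real_derivative 1) (at t)" by (auto intro!: derivative_eq_intros)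
  then have "(g i \<circ> (\<lambda>s. s + 1) has_vector_derivative 1 *\<^sub>R ltan g i (t + 1)) (at t)"
    using link_deriv[OF i, of "t + 1"] by (intro vector_diff_chain_at) (auto simp: has_real_derivative_iff_has_vector_derivative)
  moreover have "g i \<circ> (\<lambda>s. s + 1) = g i" using link_periodic[OF i] by (auto simp: fun_eq_iff)
  ultimately show ?thesis using link_deriv[OF i, of t] vector_derivative_unique_at by auto
qed

lemma ltan_periodic_int: "i < m \<Longrightarrow> ltan g i (t + of_int k) = ltan g i t"
  using periodic_of_int[of "ltan g i" 1 t k] ltan_periodic by simp

lemma link_cont: "i < m \<Longrightarrow> continuous_on UNIV (g i)"
  using link_deriv by (meson continuous_at_imp_continuous_on has_vector_derivative_continuous)

lemma ltan_cont: "i < m \<Longrightarrow> continuous_on UNIV (ltan g i)"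
  using lk unfolding is_link_def by simp

lemma ltan_nonzero: "i < m \<Longrightarrow> ltan g i t \<noteq> 0"
  using lk unfolding is_link_def by simp

lemma unit_interval_reduce: obtains k :: int where "t + of_int k \<in> {0..<1::real}"
  using period_reduce[of 1 t] by auto

lemma link_inj:
  assumes "i < m" "j < m" "g i s = g j t"
  shows "i = j \<and> (\<exists>k::int. t = s + of_int k)"
proof -
  obtain k where k: "s + of_int k \<in> {0..<1::real}" by (rule unit_interval_reduce)
  obtain n where n: "t + of_int n \<in> {0..<1::real}" by (rule unit_interval_reduce)
  have inj: "inj_on (\<lambda>(i, t). g i t) ({..<m} \<times> {0..<1})" using lk unfolding is_link_def by simp
  have "(i, s + of_int k) = (j, t + of_int n)"
    by (rule inj_onD[OF inj]) (use k n assms link_periodic_int in auto)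
  then show ?thesis by (auto intro!: exI[of _ "k - n"])
qed

lemma link_image_eq: "link_image m g = (\<lambda>x. g (fst x) (snd x)) ` ({..<m} \<times> {0..1})"
proof
  show "link_image m g \<subseteq> (\<lambda>x. g (fst x) (snd x)) ` ({..<m} \<times> {0..1})"
    unfolding link_image_def by force
  show "(\<lambda>x. g (fst x) (snd x)) ` ({..<m} \<times> {0..1}) \<subseteq> link_image m g"
  proof clarsimp
    fix i :: nat and t :: real assume i: "i < m"
    obtain k where "t + of_int k \<in> {0..<1::real}" by (rule unit_interval_reduce)
    then show "g i t \<in> link_image m g" unfolding link_image_def
      using i link_periodic_int[OF i, of t k] by (intro image_eqI[of _ _ "(i, t + of_int k)"]) auto
  qed
qed

lemma link_in_image: "i < m \<Longrightarrow> g i t \<in> link_image m g"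
proof -
  assume i: "i < m"
  obtain k where "t + of_int k \<in> {0..<1::real}" by (rule unit_interval_reduce)
  then show "g i t \<in> link_image m g" unfolding link_image_def
    using i link_periodic_int[OF i, of t k] by (intro image_eqI[of _ _ "(i, t + of_int k)"]) auto
qed

lemma compact_link_domain: "compact ({..<m} \<times> {0..1::real})"
  by (intro compact_Times finite_imp_compact[of "{..<m}"]) auto

lemma link_cont_domain: "continuous_on ({..<m} \<times> {0..1}) (\<lambda>x. g (fst x) (snd x))"
  and ltan_cont_domain: "continuous_on ({..<m} \<times> {0..1}) (\<lambda>x. ltan g (fst x) (snd x))"
  using link_cont ltan_cont
  by (auto intro!: continuous_on_subset[OF continuous_on_family[of m g]]
      continuous_on_subset[OF continuous_on_family[of m "ltan g"]])

lemma compact_link_image: "compact (link_image m g)"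
  unfolding link_image_eq by (intro compact_continuous_image link_cont_domain compact_link_domain)

lemma speed_bounds: "\<exists>a b. 0 < a \<and> a \<le> b \<and> (\<forall>i<m. \<forall>t. a \<le> norm (ltan g i t) \<and> norm (ltan g i t) \<le> b)"
proof -
  have c: "continuous_on ({..<m} \<times> {0..1}) (\<lambda>x. norm (ltan g (fst x) (snd x)))"
    by (intro continuous_intros ltan_cont_domain)
  obtain a where a: "a > 0" "\<And>x. x \<in> {..<m} \<times> {0..1} \<Longrightarrow> a \<le> norm (ltan g (fst x) (snd x))"
    using continuous_attains_pos_inf[OF compact_link_domain c] ltan_nonzero by fastforce
  have cb: "compact ((\<lambda>x. norm (ltan g (fst x) (snd x))) ` ({..<m} \<times> {0..1}))"
    by (intro compact_continuous_image c compact_link_domain)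
  obtain b where b: "\<And>x. x \<in> {..<m} \<times> {0..1} \<Longrightarrow> norm (ltan g (fst x) (snd x)) \<le> b"
  proof -
    from compact_imp_bounded[OF cb] obtain b where "\<And>y. y \<in> (\<lambda>x. norm (ltan g (fst x) (snd x))) ` ({..<m} \<times> {0..1}) \<Longrightarrow> norm y \<le> b"
      unfolding bounded_iff by blast
    then have "norm (norm (ltan g (fst x) (snd x))) \<le> b" if "x \<in> {..<m} \<times> {0..1}" for x using that by blast
    then show ?thesis by (intro that[of b]) simp
  qed
  have "a \<le> norm (ltan g i t) \<and> norm (ltan g i t) \<le> max a b" if i: "i < m" for i t
  proof -
    obtain k where "t + of_int k \<in> {0..<1::real}" by (rule unit_interval_reduce)
    then have "(i, t + of_int k) \<in> {..<m} \<times> {0..1}" using i by auto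
    from a(2)[OF this] b[OF this] show ?thesis using ltan_periodic_int[OF i, of t k] by auto
  qed
  then show ?thesis using a(1) by (intro exI[of _ a] exI[of _ "max a b"]) auto
qed

text \<open>Injectivity made quantitative by compactness: on the pairs of parameters that are not
  close on the circle the distance of the points has a positive minimum.\<close>

lemma link_close_params:
  assumes d: "d > 0"
  shows "\<exists>e>0. \<forall>i<m. \<forall>j<m. \<forall>s t. norm (g i s - g j t) < e \<longrightarrow> i = j \<and> (\<exists>k::int. \<bar>s - (t + of_int k)\<bar> < d)"
proof (rule finite_min_pos)
  fix i assume i: "i < m"
  show "\<exists>e>0. \<forall>j<m. \<forall>s t. norm (g i s - g j t) < e \<longrightarrow> i = j \<and> (\<exists>k::int. \<bar>s - (t + of_int k)\<bar> < d)"
  proof (rule finite_min_pos)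
    fix j assume j: "j < m"
    \<comment> \<open>For parameters in \<open>[0, 1]\<close> the bounds \<open>d\<close> and
      \<open>1 - d\<close> say that they are at least \<open>d\<close> apart on the circle of length
      1. Different components need no such restriction.\<close>
    define A where "A = ({0..1} \<times> {0..1}) \<inter> (if i = j then {p::real\<times>real. d \<le> \<bar>fst p - snd p\<bar> \<and> \<bar>fst p - snd p\<bar> \<le> 1 - d} else UNIV)"
    have "closed {p::real\<times>real. d \<le> \<bar>fst p - snd p\<bar> \<and> \<bar>fst p - snd p\<bar> \<le> 1 - d}"
      by (intro closed_Collect_conj closed_Collect_le continuous_intros)
    then have cA: "compact A" unfolding A_def by (intro compact_Int_closed compact_Times) auto
    have "\<exists>c>0. \<forall>p\<in>A. c \<le> norm (g i (fst p) - g j (snd p))"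
    proof (rule continuous_attains_pos_inf[OF cA])
      show "continuous_on A (\<lambda>p. norm (g i (fst p) - g j (snd p)))"
        by (intro continuous_intros continuous_on_compose2[OF link_cont[OF i]] continuous_on_compose2[OF link_cont[OF j]]) auto
      fix p assume p: "p \<in> A"
      show "0 < norm (g i (fst p) - g j (snd p))"
      proof (rule ccontr)
        assume "\<not> 0 < norm (g i (fst p) - g j (snd p))"
        then have "g i (fst p) = g j (snd p)" by simp
        from link_inj[OF i j this] obtain k :: int where ij: "i = j" and k: "snd p = fst p + of_int k" by blast
        then have "d \<le> \<bar>real_of_int k\<bar>" "\<bar>real_of_int k\<bar> \<le> 1 - d" using p by (auto simp: A_def)
        then have "of_int \<bar>k\<bar> < (1::real)" "of_int \<bar>k\<bar> > (0::real)" using d by auto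
        then have "\<bar>k\<bar> < 1" "\<bar>k\<bar> > 0" by (simp_all only: of_int_less_1_iff of_int_0_less_iff)
        then show False by simp
      qed
    qed
    then obtain c where c: "c > 0" "\<And>p. p \<in> A \<Longrightarrow> c \<le> norm (g i (fst p) - g j (snd p))" by blast
    have "i = j \<and> (\<exists>k::int. \<bar>s - (t + of_int k)\<bar> < d)" if "norm (g i s - g j t) < c" for s t
    proof -
      obtain k where k: "s + of_int k \<in> {0..<1::real}" by (rule unit_interval_reduce)
      obtain n where n: "t + of_int n \<in> {0..<1::real}" by (rule unit_interval_reduce)
      have "(s + of_int k, t + of_int n) \<notin> A"
        using c(2)[of "(s + of_int k, t + of_int n)"] that link_periodic_int[OF i, of s k] link_periodic_int[OF j, of t n] by auto
      then have ij: "i = j" and "\<bar>s + of_int k - (t + of_int n)\<bar> < d \<or> \<bar>s + of_int k - (t + of_int n)\<bar> > 1 - d"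
        using k n by (auto simp: A_def split: if_splits)
      then consider "\<bar>s - (t + of_int (n - k))\<bar> < d" | "\<bar>s - (t + of_int (n - k - 1))\<bar> < d" | "\<bar>s - (t + of_int (n - k + 1))\<bar> < d"
        using k n by (auto simp: abs_if split: if_splits)
      then show ?thesis using ij by cases blast+
    qed
    then show "\<exists>e>0. \<forall>s t. norm (g i s - g j t) < e \<longrightarrow> i = j \<and> (\<exists>k::int. \<bar>s - (t + of_int k)\<bar> < d)"
      using c(1) by blast
  qed (meson less_le_trans)
qed (meson less_le_trans)

text \<open>By compactness the speed is bounded below, so arclength is an expanding bijection of the
  line that commutes with the periods. Working with periodic functions on the whole line avoids
  charts on the circle.\<close>

lemma arclength:
  assumes i: "i < m"
  obtains S G T l where "l > 0" "S 0 = 0" "\<And>t. (S has_real_derivative norm (ltan g i t)) (at t)"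
    "\<And>t. S (t + 1) = S t + l" "strict_mono S" "surj S"
    "\<And>t. g i t = G (S t)" "\<And>t. T (S t) = sgn (ltan g i t)"
    "\<And>s. (G has_vector_derivative T s) (at s)" "\<And>s. norm (T s) = 1" "continuous_on UNIV T"
    "\<And>s. G (s + l) = G s" "\<And>s. T (s + l) = T s"
    "\<And>s t. s \<le> t \<Longrightarrow> integral {s..t} (\<lambda>r. norm (ltan g i r)) = S t - S s"
proof -
  define n where "n t = norm (ltan g i t)" for t
  have nc: "continuous_on UNIV n" unfolding n_def by (intro continuous_intros ltan_cont i)
  obtain a b where ab: "0 < a" "\<And>t. a \<le> n t" "\<And>t. n t \<le> b"
    using speed_bounds i unfolding n_def by blast
  have nint: "n integrable_on {x..y}" for x y
    by (rule integrable_continuous_real[OF continuous_on_subset[OF nc]]) auto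
  obtain S where S: "indef_integral S n" "S 0 = 0" using indef_integral_exists[of n 0] nint by metis
  have S': "(S has_real_derivative n t) (at t)" for t
    using indef_integral_deriv[OF S(1), of t] nc
    by (simp add: has_real_derivative_iff_has_vector_derivative continuous_on_eq_continuous_at)
  have Sint: "integral {s..t} n = S t - S s" if "s \<le> t" for s t
    using indef_integralD[OF S(1) that] by (rule integral_unique)
  have Sexp: "a * (t - s) \<le> S t - S s" if "s \<le> t" for s t
    using has_integral_le[OF _ indef_integralD[OF S(1) that], of "\<lambda>_. a" "a * (t - s)"] ab
      has_integral_const_real[of a s t] that by (simp add: mult.commute)
  have Sc: "continuous_on UNIV S" using S' by (meson DERIV_isCont continuous_at_imp_continuous_on)
  obtain I where I: "\<And>y. S (I y) = y" "\<And>x. I (S x) = x" "\<And>x y. \<bar>I y - I x\<bar> \<le> \<bar>y - x\<bar> / a" and Sm: "strict_mono S"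
    using expanding_inverse[OF ab(1) Sexp Sc] by metis
  have Ic: "isCont I y" for y
  proof -
    have "(1/a)-lipschitz_on UNIV I" using I(3) ab(1) by (auto intro!: lipschitz_onI simp: dist_real_def abs_minus_commute)
    from lipschitz_on_continuous_on[OF this] show ?thesis by (simp add: continuous_on_eq_continuous_at)
  qed
  have I': "(I has_real_derivative inverse (n (I y))) (at y)" for y
    by (rule DERIV_inverse_function[where f = S and a = "y - 1" and b = "y + 1"])
      (use S' ab(1) ab(2)[of "I y"] I Ic in auto)
  define l where "l = S 1"
  have l: "l > 0" using Sexp[of 0 1] ab(1) S(2) by (simp add: l_def)
  have Sper: "S (t + 1) = S t + l" for t
  proof -
    have "S (t + 1) - S t = S (0 + 1) - S 0"
      using indef_integral_shift[OF S(1), of 1] S(1) ltan_periodic[OF i]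
      by (intro indef_integral_unique) (auto simp: n_def[abs_def])
    then show ?thesis using S(2) by (simp add: l_def)
  qed
  have Iper: "I (y + l) = I y + 1" for y
    using Sper[of "I y"] I by metis
  define G where "G y = g i (I y)" for y
  define T where "T y = sgn (ltan g i (I y))" for y
  show ?thesis
  proof
    show "l > 0" "S 0 = 0" by fact+
    show "(S has_real_derivative norm (ltan g i t)) (at t)" for t using S' by (simp add: n_def)
    show "S (t + 1) = S t + l" for t by (rule Sper)
    show "strict_mono S" by fact
    show "surj S" using I(1) by (metis surjI)
    show "g i t = G (S t)" "T (S t) = sgn (ltan g i t)" for t by (simp_all add: G_def T_def I)
    show "(G has_vector_derivative T y) (at y)" for y
    proof -
      have "(g i \<circ> I has_vector_derivative inverse (n (I y)) *\<^sub>R ltan g i (I y)) (at y)"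
        using I'[of y] link_deriv[OF i] by (intro vector_diff_chain_at) (auto simp: has_real_derivative_iff_has_vector_derivative)
      then show ?thesis by (simp add: G_def[abs_def] T_def n_def sgn_div_norm o_def)
    qed
    show "norm (T y) = 1" for y using ltan_nonzero[OF i] by (simp add: T_def norm_sgn)
    show "continuous_on UNIV T" unfolding T_def
      using Ic ltan_nonzero[OF i]
      by (intro continuous_intros continuous_on_compose2[OF ltan_cont[OF i]]) (auto simp: continuous_on_eq_continuous_at)
    show "G (y + l) = G y" "T (y + l) = T y" for y
      by (simp_all add: G_def T_def Iper link_periodic[OF i] ltan_periodic[OF i])
    show "s \<le> t \<Longrightarrow> integral {s..t} (\<lambda>r. norm (ltan g i r)) = S t - S s" for s t
      using Sint by (simp add: n_def[abs_def])
  qed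
qed

end

section \<open>Critical pairs, tangent balls and curvature\<close>

definition crit_pair :: "(nat \<Rightarrow> real \<Rightarrow> 'a::euclidean_space) \<Rightarrow> nat \<Rightarrow> real \<Rightarrow> nat \<Rightarrow> real \<Rightarrow> bool" where
  "crit_pair g i s j t \<longleftrightarrow> g i s \<noteq> g j t \<and> (g j t - g i s) \<bullet> ltan g i s = 0 \<and> (g j t - g i s) \<bullet> ltan g j t = 0"

text \<open>An integrated form of "curvature at most \<open>k\<close>" that needs neither second
  derivatives nor a particular parametrization.\<close>

definition curv_le :: "real \<Rightarrow> nat \<Rightarrow> (nat \<Rightarrow> real \<Rightarrow> 'a::euclidean_space) \<Rightarrow> bool" where
  "curv_le k m g \<longleftrightarrow> (\<forall>i<m. \<forall>s t. s \<le> t \<longrightarrow>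
     norm (sgn (ltan g i t) - sgn (ltan g i s)) \<le> k * integral {s..t} (\<lambda>r. norm (ltan g i r)))"

text \<open>The inequality says that \<open>g j t\<close> is not in the open ball of radius \<open>r\<close> around \<open>g i s + r v\<close>.\<close>

definition avoids_tangent_balls :: "real \<Rightarrow> nat \<Rightarrow> (nat \<Rightarrow> real \<Rightarrow> 'a::euclidean_space) \<Rightarrow> bool" where
  "avoids_tangent_balls r m g \<longleftrightarrow> (\<forall>i<m. \<forall>j<m. \<forall>s t v. norm v = 1 \<and> v \<bullet> ltan g i s = 0 \<longrightarrow>
     2 * r * (v \<bullet> (g j t - g i s)) \<le> (norm (g j t - g i s))\<^sup>2)"

lemma C11_link_iff_curv_le: "C11_link m g \<longleftrightarrow> (\<exists>C. curv_le C m g)"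
  unfolding C11_link_def curv_le_def by (simp add: sgn_div_norm inverse_eq_divide)

text \<open>If \<open>p + v = q + w\<close> with the longer vector at \<open>p\<close>, then
  \<open>q\<close> lies in the closed ball around \<open>p + v\<close> whose boundary contains
  \<open>p\<close>. Apart from \<open>p\<close> this ball lies inside the open tangent ball of the
  larger radius \<open>r\<close>.\<close>

lemma avoids_tangent_balls_imp_inj:
  assumes tb: "avoids_tangent_balls r m g"
  shows "inj_on (\<lambda>(p, v). p + v) (normal_bundle m g r)"
proof -
  have *: "p = q" if p: "(p, v) \<in> normal_bundle m g r" and q: "(q, w) \<in> normal_bundle m g r"
    and eq: "p + v = q + w" and le: "norm w \<le> norm v" for p q v w
  proof (rule ccontr)
    assume "p \<noteq> q"
    obtain i s where i: "i < m" "p = g i s" "v \<bullet> ltan g i s = 0" "norm v < r" using p unfolding normal_bundle_def by auto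
    obtain j t where j: "j < m" "q = g j t" using q unfolding normal_bundle_def by auto
    define a where "a = q - p"
    have a0: "a \<noteq> 0" using \<open>p \<noteq> q\<close> by (simp add: a_def)
    have w: "w = v - a" using eq by (simp add: a_def algebra_simps)
    have "(norm w)\<^sup>2 \<le> (norm v)\<^sup>2" using le by simp
    then have av: "(norm a)\<^sup>2 \<le> 2 * (v \<bullet> a)" unfolding w
      by (simp add: power2_norm_eq_inner inner_diff_left inner_diff_right inner_commute)
    then have va: "v \<bullet> a > 0" using a0 by (metis (full_types) zero_less_norm_iff zero_less_power less_le_trans zero_less_mult_pos zero_less_numeral)
    then have v0: "norm v > 0" by auto
    have "2 * r * (sgn v \<bullet> a) \<le> (norm a)\<^sup>2"
      using tb[unfolded avoids_tangent_balls_def, rule_format, OF i(1) j(1), of "sgn v" s t] i j v0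
      by (simp add: a_def norm_sgn) (simp add: sgn_div_norm)
    also have "\<dots> \<le> 2 * norm v * (sgn v \<bullet> a)"
    proof -
      have "norm v * (sgn v \<bullet> a) = v \<bullet> a" using v0 by (simp add: sgn_div_norm)
      then show ?thesis using av by simp
    qed
    finally have "(r - norm v) * (sgn v \<bullet> a) \<le> 0" by (simp add: algebra_simps)
    moreover have "sgn v \<bullet> a > 0" using va v0 by (simp add: sgn_div_norm)
    ultimately show False using i(4) by (simp add: mult_le_0_iff)
  qed
  show ?thesis
  proof (rule inj_onI, clarsimp)
    fix p v q w assume 1: "(p, v) \<in> normal_bundle m g r" "(q, w) \<in> normal_bundle m g r" "p + v = q + w"
    have "p = q" using *[OF 1] *[OF 1(2,1) 1(3)[symmetric]] by fastforce
    then show "p = q \<and> v = w" using 1(3) by simp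
  qed
qed

text \<open>The midpoint of a critical pair is reached along normals from both of its
  points.\<close>

lemma inj_imp_le_half_crit:
  assumes inj: "inj_on (\<lambda>(p, v). p + v) (normal_bundle m g r)" and ij: "i < m" "j < m" and c: "crit_pair g i s j t"
  shows "r \<le> norm (g j t - g i s) / 2"
proof (rule ccontr)
  assume r: "\<not> r \<le> norm (g j t - g i s) / 2"
  define a where "a = g j t - g i s"
  have "(g i s, (1/2) *\<^sub>R a) \<in> normal_bundle m g r" "(g j t, (-1/2) *\<^sub>R a) \<in> normal_bundle m g r"
    using r c ij unfolding normal_bundle_def crit_pair_def a_def by auto
  moreover have "g i s + (1/2) *\<^sub>R a = g j t + (-1/2) *\<^sub>R a"
  proof -
    have "g i s + a = g j t" by (simp add: a_def)
    moreover have "(1/2) *\<^sub>R a = a - (1/2) *\<^sub>R a" using scaleR_left_diff_distrib[of 1 "1/2" a] by simp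
    ultimately show ?thesis by (metis add_diff_eq scaleR_minus_left minus_divide_left uminus_add_conv_diff add.commute)
  qed
  ultimately have "g i s = g j t" using inj_onD[OF inj, of "(g i s, (1/2) *\<^sub>R a)" "(g j t, (-1/2) *\<^sub>R a)"] by auto
  then show False using c by (simp add: crit_pair_def)
qed

lemma dist_extremal_orthogonal:
  fixes c :: "real \<Rightarrow> 'a::real_inner"
  assumes c: "(c has_vector_derivative d) (at t)"
    and ext: "(\<forall>y. norm (c t - x) \<le> norm (c y - x)) \<or> (\<forall>y. norm (c y - x) \<le> norm (c t - x))"
  shows "(c t - x) \<bullet> d = 0"
proof -
  note c' = c[unfolded has_vector_derivative_def]
  have "((\<lambda>y. (c y - x) \<bullet> (c y - x)) has_derivative (\<lambda>h. h * (2 * ((c t - x) \<bullet> d)))) (at t)"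
    by (rule derivative_eq_intros c' refl)+ (simp add: fun_eq_iff inner_commute algebra_simps)
  then have D: "((\<lambda>y. (c y - x) \<bullet> (c y - x)) has_real_derivative (2 * ((c t - x) \<bullet> d))) (at t)"
    by (rule has_real_derivativeI)
  have "2 * ((c t - x) \<bullet> d) = 0"
    using ext
  proof
    assume "\<forall>y. norm (c t - x) \<le> norm (c y - x)"
    then show ?thesis by (intro DERIV_local_min[OF D, of 1]) (simp_all add: norm_le)
  next
    assume "\<forall>y. norm (c y - x) \<le> norm (c t - x)"
    then show ?thesis by (intro DERIV_local_max[OF D, of 1]) (simp_all add: norm_le)
  qed
  then show ?thesis by simp
qed

text \<open>Two points of one component at maximal distance. Their existence makes the infimum in
  \<open>DCSD\<close> one over a nonempty set and bounds the set whose supremum is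
  \<open>NIR\<close>.\<close>

lemma crit_pair_exists:
  assumes lk: "is_link m g"
  shows "\<exists>s t. crit_pair g 0 s 0 t"
proof -
  have m: "0 < m" using lk by (simp add: is_link_def)
  define A where "A = {0..1::real} \<times> {0..1::real}"
  have "compact A" "A \<noteq> {}" unfolding A_def by (auto intro: compact_Times)
  moreover have "continuous_on A (\<lambda>p. norm (g 0 (fst p) - g 0 (snd p)))"
    by (intro continuous_intros continuous_on_compose2[OF link_cont[OF lk m]]) auto
  ultimately obtain p where p: "p \<in> A" "\<And>q. q \<in> A \<Longrightarrow> norm (g 0 (fst q) - g 0 (snd q)) \<le> norm (g 0 (fst p) - g 0 (snd p))"
    using continuous_attains_sup[of A "\<lambda>p. norm (g 0 (fst p) - g 0 (snd p))"] by blast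
  define s t where "s = fst p" and "t = snd p"
  have max: "norm (g 0 x - g 0 y) \<le> norm (g 0 s - g 0 t)" for x y
  proof -
    obtain k where k: "x + of_int k \<in> {0..<1::real}" by (rule unit_interval_reduce[OF lk])
    obtain n where n: "y + of_int n \<in> {0..<1::real}" by (rule unit_interval_reduce[OF lk])
    have "norm (g 0 (x + of_int k) - g 0 (y + of_int n)) \<le> norm (g 0 s - g 0 t)"
      using p(2)[of "(x + of_int k, y + of_int n)"] k n by (simp add: A_def s_def t_def)
    then show ?thesis by (simp only: link_periodic_int[OF lk m])
  qed
  have "g 0 0 \<noteq> g 0 (1/2)"
  proof
    assume "g 0 0 = g 0 (1/2)"
    then obtain k :: int where "1/2 = 0 + real_of_int k" using link_inj[OF lk m m] by blast
    then have "real_of_int (2 * k) = real_of_int 1" by simp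
    then have "2 * k = 1" by (simp only: of_int_eq_iff)
    then show False by presburger
  qed
  then have ne: "g 0 s \<noteq> g 0 t" using max[of 0 "1/2"] by auto
  have "(g 0 s - g 0 t) \<bullet> ltan g 0 s = 0"
    by (rule dist_extremal_orthogonal[OF link_deriv[OF lk m]]) (use max in blast)
  moreover have "(g 0 t - g 0 s) \<bullet> ltan g 0 t = 0"
    by (rule dist_extremal_orthogonal[OF link_deriv[OF lk m]]) (use max norm_minus_commute in metis)
  ultimately have "crit_pair g 0 s 0 t" using ne unfolding crit_pair_def by (simp add: inner_diff_left)
  then show ?thesis by blast
qed

lemma NIR_set_bdd:
  assumes "is_link m g"
  shows "bdd_above ({0} \<union> {r. r > 0 \<and> inj_on (\<lambda>(p, v). p + v) (normal_bundle m g r)})"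
proof -
  have m: "0 < m" using assms by (simp add: is_link_def)
  obtain s t where "crit_pair g 0 s 0 t" using crit_pair_exists[OF assms] by blast
  then show ?thesis using inj_imp_le_half_crit[OF _ m m] by (intro bdd_aboveI[of _ "norm (g 0 t - g 0 s) / 2"]) auto
qed

lemma NIR_ge:
  assumes "is_link m g" "r > 0" "avoids_tangent_balls r m g"
  shows "r \<le> NIR m g"
  unfolding NIR_def
  by (rule cSup_upper[OF _ NIR_set_bdd[OF assms(1)]]) (use assms avoids_tangent_balls_imp_inj in auto)

lemma NIR_le_half_crit:
  assumes "is_link m g" "i < m" "j < m" "crit_pair g i s j t"
  shows "NIR m g \<le> norm (g j t - g i s) / 2"
  unfolding NIR_def by (rule cSup_least) (use inj_imp_le_half_crit assms(2-4) in auto)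

lemma DCSD_crit:
  "DCSD m g = Inf {norm (g j t - g i s) | i j s t. i < m \<and> j < m \<and> crit_pair g i s j t}"
  unfolding DCSD_def crit_pair_def dist_norm
  by (rule arg_cong[where f = Inf]) (auto, metis norm_minus_commute, metis norm_minus_commute)

lemma DCSD_le_crit:
  assumes "i < m" "j < m" "crit_pair g i s j t"
  shows "DCSD m g \<le> norm (g j t - g i s)"
  unfolding DCSD_crit by (rule cInf_lower) (use assms in \<open>auto intro!: bdd_belowI[of _ 0]\<close>)

lemma NIR_le_half_DCSD:
  assumes "is_link m g"
  shows "NIR m g \<le> DCSD m g / 2"
proof -
  have m: "0 < m" using assms by (simp add: is_link_def)
  have "2 * NIR m g \<le> DCSD m g"
    unfolding DCSD_crit
  proof (rule cInf_greatest)
    show "{norm (g j t - g i s) | i j s t. i < m \<and> j < m \<and> crit_pair g i s j t} \<noteq> {}"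
      using crit_pair_exists[OF assms] m by blast
  qed (use NIR_le_half_crit[OF assms] in force)
  then show ?thesis by simp
qed

text \<open>For \<open>r\<close> below the thickness let \<open>q\<close> be a point of the link
  nearest to the centre \<open>x\<close>. Then \<open>x - q\<close> is normal at \<open>q\<close>
  and not longer than \<open>r\<close>, so injectivity forces \<open>q\<close> to be the point of
  tangency, and no point of the link is closer to \<open>x\<close> than \<open>r\<close>. The
  thickness itself is reached as a limit of such radii.\<close>

lemma NIR_avoids_tangent_balls:
  assumes lk: "is_link m g" and R: "NIR m g > 0"
  shows "avoids_tangent_balls (NIR m g) m g"
  unfolding avoids_tangent_balls_def
proof (intro allI impI)
  fix i j s t v assume ij: "i < m" "j < m" and v: "norm v = 1 \<and> v \<bullet> ltan g i s = 0"
  define a where "a = g j t - g i s"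
  have *: "2 * r * (v \<bullet> a) \<le> (norm a)\<^sup>2" if r: "0 < r" "r < NIR m g" for r
  proof -
    obtain r' where r': "r < r'" "inj_on (\<lambda>(p, v). p + v) (normal_bundle m g r')"
      using less_cSupD[of "{0} \<union> {r. r > 0 \<and> inj_on (\<lambda>(p, v). p + v) (normal_bundle m g r)}" r] r
      unfolding NIR_def by auto
    define x where "x = g i s + r *\<^sub>R v"
    have "continuous_on (link_image m g) (\<lambda>z. norm (z - x))" by (intro continuous_intros)
    then obtain q where q: "q \<in> link_image m g" "\<And>z. z \<in> link_image m g \<Longrightarrow> norm (q - x) \<le> norm (z - x)"
      using continuous_attains_inf[OF compact_link_image[OF lk]] link_in_image[OF lk ij(1)] by (metis empty_iff)
    obtain k y where k: "k < m" "q = g k y" using q(1) unfolding link_image_def by auto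
    have "(g k y - x) \<bullet> ltan g k y = 0"
      by (rule dist_extremal_orthogonal[OF link_deriv[OF lk k(1)]])
        (use q(2) link_in_image[OF lk k(1)] k in auto)
    then have "(x - q) \<bullet> ltan g k y = 0" by (simp add: k inner_diff_left)
    moreover have "norm (x - q) \<le> r"
      using q(2)[OF link_in_image[OF lk ij(1), of s]] v r by (simp add: x_def norm_minus_commute)
    ultimately have 1: "(q, x - q) \<in> normal_bundle m g r'" unfolding normal_bundle_def using k r' by auto
    have 2: "(g i s, r *\<^sub>R v) \<in> normal_bundle m g r'" unfolding normal_bundle_def using ij v r r' by auto
    have "(q, x - q) = (g i s, r *\<^sub>R v)" by (rule inj_onD[OF r'(2) _ 1 2]) (simp add: x_def)
    then have "q = g i s" by simp
    then have "norm (r *\<^sub>R v) \<le> norm (a - r *\<^sub>R v)"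
      using q(2)[OF link_in_image[OF lk ij(2), of t]] by (simp add: x_def a_def algebra_simps)
    then have "(norm (r *\<^sub>R v))\<^sup>2 \<le> (norm (a - r *\<^sub>R v))\<^sup>2" by simp
    moreover have "(norm (a - r *\<^sub>R v))\<^sup>2 = (norm a)\<^sup>2 + 2 * (- r * (a \<bullet> v)) + (norm (r *\<^sub>R v))\<^sup>2"
      using norm_add_scaleR_square[of a "- r" v] by (simp add: power_mult_distrib)
    ultimately show ?thesis by (simp add: inner_commute)
  qed
  show "2 * NIR m g * (v \<bullet> (g j t - g i s)) \<le> (norm (g j t - g i s))\<^sup>2"
  proof (rule ccontr)
    assume "\<not> ?thesis"
    then have gt: "(norm a)\<^sup>2 < 2 * NIR m g * (v \<bullet> a)" by (simp add: a_def)
    then have pos: "v \<bullet> a > 0" using R by (smt (verit) zero_le_power2 mult_nonneg_nonpos)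
    \<comment> \<open>The radius of the ball with inner normal \<open>v\<close> at
      \<open>g i s\<close> whose boundary contains \<open>g j t\<close>. Any radius strictly between
      \<open>b\<close> and the thickness contradicts the estimate above.\<close>
    define b where "b = (norm a)\<^sup>2 / (2 * (v \<bullet> a))"
    have b: "0 \<le> b" "b < NIR m g" using gt pos by (auto simp: b_def field_simps)
    have "2 * ((b + NIR m g) / 2) * (v \<bullet> a) \<le> (norm a)\<^sup>2" using b R by (intro *) auto
    moreover have "(norm a)\<^sup>2 = 2 * b * (v \<bullet> a)" using pos by (simp add: b_def)
    ultimately show False using b pos by simp
  qed
qed

text \<open>Compares the chord between two unit vectors with the sine of their angle. With
  \<open>x = b \<bullet> t\<close> the squared chord \<open>2 * (1 - x)\<close> is at most
  \<open>2 * y\<^sup>2 / (1 + x)\<close>, and for small angles \<open>1 + x\<close> is close to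
  2.\<close>

lemma unit_close_of_small_normal:
  fixes b t :: "'a::real_inner"
  assumes b: "norm b = 1" "norm t = 1" and c: "b \<bullet> t > 0" "1 - (b \<bullet> t)\<^sup>2 \<le> y\<^sup>2" and y: "0 \<le> y" "y\<^sup>2 \<le> e" "e \<le> 1"
  shows "norm (b - t) \<le> (1 + e) * y"
proof -
  define x where "x = b \<bullet> t"
  have e0: "0 \<le> e" using y(2) zero_le_power2[of y] by linarith
  have x: "0 < x" "x \<le> 1" using c norm_cauchy_schwarz[of b t] b by (auto simp: x_def)
  have "(norm (b - t))\<^sup>2 = 2 * (1 - x)"
    using b norm_add_scaleR_square[of b "-1" t] by (simp add: x_def)
  moreover have "2 * (1 - x) \<le> ((1 + e) * y)\<^sup>2"
  proof -
    have "x\<^sup>2 \<le> x" using x by (simp add: power2_eq_square mult_left_le)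
    then have "2 - e \<le> 1 + x" using c y unfolding x_def by linarith
    moreover have "(1 + e)\<^sup>2 * (2 - e) \<ge> 2"
    proof -
      have "(1 + e)\<^sup>2 * (2 - e) - 2 = e * (3 - e\<^sup>2)" by (simp add: power2_eq_square algebra_simps)
      moreover have "e\<^sup>2 \<le> 1" using e0 y by (simp add: power_le_one)
      then have "e * (3 - e\<^sup>2) \<ge> 0" using e0 by simp
      ultimately show ?thesis by linarith
    qed
    moreover have "(1 + e)\<^sup>2 * (2 - e) \<le> (1 + e)\<^sup>2 * (1 + x)" using calculation(1) by (intro mult_left_mono) auto
    ultimately have "2 \<le> (1 + e)\<^sup>2 * (1 + x)" by linarith
    then have "2 * (1 - x) \<le> (1 + e)\<^sup>2 * (1 + x) * (1 - x)" using x by (intro mult_right_mono) auto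
    also have "\<dots> = (1 + e)\<^sup>2 * (1 - x\<^sup>2)" by (simp add: power2_eq_square algebra_simps)
    also have "\<dots> \<le> (1 + e)\<^sup>2 * y\<^sup>2" using c by (intro mult_left_mono) (auto simp: x_def)
    finally show ?thesis by (simp add: power_mult_distrib)
  qed
  ultimately have "(norm (b - t))\<^sup>2 \<le> ((1 + e) * y)\<^sup>2" by simp
  then show ?thesis by (rule power2_le_imp_le) (use y e0 in simp)
qed

lemma normal_part:
  fixes a t :: "'a::real_inner"
  assumes t: "norm t = 1"
  defines "n \<equiv> a - (a \<bullet> t) *\<^sub>R t"
  shows "n \<bullet> t = 0" "(norm n)\<^sup>2 = (norm a)\<^sup>2 - (a \<bullet> t)\<^sup>2" "n \<bullet> a = (norm n)\<^sup>2"
    "v \<bullet> t = 0 \<Longrightarrow> norm v = 1 \<Longrightarrow> v \<bullet> a \<le> norm n"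
proof -
  have tt: "t \<bullet> t = 1" using t by (simp add: dot_square_norm)
  show nt: "n \<bullet> t = 0" by (simp add: n_def inner_diff_left tt)
  show "(norm n)\<^sup>2 = (norm a)\<^sup>2 - (a \<bullet> t)\<^sup>2"
    unfolding power2_norm_eq_inner n_def
    by (simp add: inner_diff_left inner_diff_right tt inner_commute[of t a] power2_eq_square)
  have a: "a = n + (a \<bullet> t) *\<^sub>R t" by (simp add: n_def)
  show "n \<bullet> a = (norm n)\<^sup>2" by (subst a) (simp add: inner_add_right nt power2_norm_eq_inner)
  show "v \<bullet> a \<le> norm n" if v: "v \<bullet> t = 0" "norm v = 1"
  proof -
    have "v \<bullet> a = v \<bullet> n" by (subst a) (simp add: inner_add_right v)
    then show ?thesis using norm_cauchy_schwarz[of v n] v by simp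
  qed
qed

lemma has_vector_derivative_inner_right:
  assumes "(c has_vector_derivative d) (at t)"
  shows "((\<lambda>y. v \<bullet> (c y - x)) has_real_derivative (v \<bullet> d)) (at t)"
proof -
  note c' = assms[unfolded has_vector_derivative_def]
  have "((\<lambda>y. v \<bullet> (c y - x)) has_derivative (\<lambda>h. h * (v \<bullet> d))) (at t)"
    by (rule derivative_eq_intros c' refl)+ (simp add: fun_eq_iff)
  then show ?thesis by (rule has_real_derivativeI)
qed

lemma deriv_ge_imp_diff_ge:
  fixes f :: "real \<Rightarrow> real"
  assumes "a \<le> b" "\<And>x. (f has_real_derivative f' x) (at x)" "\<And>x. a \<le> x \<Longrightarrow> x \<le> b \<Longrightarrow> k \<le> f' x"
  shows "k * (b - a) \<le> f b - f a"
proof -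
  have "(\<lambda>x. f x - k * x) a \<le> (\<lambda>x. f x - k * x) b"
  proof (rule DERIV_nonneg_imp_nondecreasing[OF assms(1)])
    fix x assume "a \<le> x" "x \<le> b"
    then show "\<exists>y. ((\<lambda>x. f x - k * x) has_real_derivative y) (at x) \<and> 0 \<le> y"
      using assms(3)[of x] by (intro exI[of _ "f' x - k"]) (auto intro!: derivative_eq_intros assms(2))
  qed
  then show ?thesis by (simp add: algebra_simps)
qed

text \<open>The ball condition bounds the sine of the angle between the chord \<open>a\<close> and
  the tangent at either end by \<open>norm a / (2 * R)\<close>. Two such angles add up to a turning
  of about \<open>norm a / R\<close> along the arc; the error factor disappears by
  subdivision.\<close>

lemma avoids_tangent_balls_imp_curv_le:
  assumes lk: "is_link m g" and R: "R > 0" and tb: "avoids_tangent_balls R m g"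
  shows "curv_le (1 / R) m g"
  unfolding curv_le_def
proof (intro allI impI)
  fix i s0 t0 assume i: "i < m" and st0: "(s0::real) \<le> t0"
  obtain S G T and l :: real where A: "l > 0" "\<And>t. (S has_real_derivative norm (ltan g i t)) (at t)"
    "strict_mono S" "surj S"
    "\<And>t. g i t = G (S t)" "\<And>t. T (S t) = sgn (ltan g i t)"
    "\<And>s. (G has_vector_derivative T s) (at s)" "\<And>s. norm (T s) = 1" "continuous_on UNIV T"
    "\<And>s t. s \<le> t \<Longrightarrow> integral {s..t} (\<lambda>r. norm (ltan g i r)) = S t - S s"
    by (rule arclength[OF lk i], rule that; assumption)
  have tbG: "2 * R * (v \<bullet> (G y - G x)) \<le> (norm (G y - G x))\<^sup>2" if "norm v = 1" "v \<bullet> T x = 0" for x y v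
  proof -
    obtain s t where st: "x = S s" "y = S t" using A(4) by (meson surjD)
    have "v \<bullet> ltan g i s = 0" using that(2) ltan_nonzero[OF lk i, of s] by (simp add: st A(6) sgn_div_norm)
    then show ?thesis using tb i that(1) unfolding avoids_tangent_balls_def by (simp add: st A(5)[symmetric])
  qed
  have nor: "2 * R * norm (a - (a \<bullet> T x) *\<^sub>R T x) \<le> (norm a)\<^sup>2" if a: "a = G y - G x" for a x y
  proof (cases "a - (a \<bullet> T x) *\<^sub>R T x = 0")
    case False
    define n where "n = a - (a \<bullet> T x) *\<^sub>R T x"
    note np = normal_part[OF A(8), of a x, folded n_def]
    have n0: "norm n > 0" using False by (simp add: n_def)
    have "2 * R * (sgn n \<bullet> a) \<le> (norm a)\<^sup>2"
      unfolding a by (rule tbG) (use n0 np(1) in \<open>auto simp: norm_sgn\<close>, simp add: sgn_div_norm)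
    moreover have "sgn n \<bullet> a = norm n" using np(3) n0 by (simp add: sgn_div_norm power2_eq_square)
    ultimately show ?thesis by (simp add: n_def)
  qed auto
  have Glip: "norm (G y - G x) \<le> y - x" if "x \<le> y" for x y
  proof -
    have "norm (G y - G x) \<le> 1 * norm (y - x)"
    proof (rule differentiable_bound[of UNIV])
      show "(G has_derivative (\<lambda>h. h *\<^sub>R T z)) (at z within UNIV)" for z
        using A(7)[of z] by (simp add: has_vector_derivative_def)
      show "onorm (\<lambda>h. h *\<^sub>R T z) \<le> 1" for z by (rule onorm_le) (simp add: A(8))
    qed auto
    then show ?thesis using that by simp
  qed
  have "norm (T (S t0) - T (S s0)) \<le> S t0 / R - S s0 / R"
  proof (rule norm_diff_le_of_local[where S = "\<lambda>x. x / R"])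
    show "S s0 \<le> S t0" using A(3) st0 by (simp add: strict_mono_less_eq)
    fix e0 :: real assume e0: "e0 > 0"
    define e where "e = min e0 1"
    have e: "0 < e" "e \<le> 1" "e \<le> e0" using e0 by (auto simp: e_def)
    have "uniformly_continuous_on {S s0..S t0} T"
      by (intro compact_uniformly_continuous continuous_on_subset[OF A(9)]) auto
    then obtain d where d: "d > 0" "\<And>x y. x \<in> {S s0..S t0} \<Longrightarrow> y \<in> {S s0..S t0} \<Longrightarrow> \<bar>y - x\<bar> < d \<Longrightarrow> norm (T y - T x) < 1 / 2"
      unfolding uniformly_continuous_on_def by (metis dist_norm half_gt_zero real_norm_def zero_less_one)
    show "\<exists>d>0. \<forall>x y. S s0 \<le> x \<and> x \<le> y \<and> y \<le> S t0 \<and> y - x < d \<longrightarrow> norm (T y - T x) \<le> (1 + e0) * (y / R - x / R)"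
    proof (intro exI conjI allI impI)
      show "min d (2 * R * e) > 0" using d R e by simp
      fix x y assume xy: "S s0 \<le> x \<and> x \<le> y \<and> y \<le> S t0 \<and> y - x < min d (2 * R * e)"
      show "norm (T y - T x) \<le> (1 + e0) * (y / R - x / R)"
      proof (cases "x = y")
        case False
        then have xy': "x < y" using xy by simp
        define a where "a = G y - G x"
        have TT: "1 / 2 \<le> T z \<bullet> T w" if "z \<in> {x..y}" "w \<in> {x..y}" for z w
        proof -
          have "norm (T z - T w) < 1 / 2" using that xy by (intro d(2)) auto
          then have "(T w - T z) \<bullet> T w \<le> 1 / 2"
            using norm_cauchy_schwarz[of "T w - T z" "T w"] A(8)[of w] by (simp add: norm_minus_commute)
          then show ?thesis using A(8)[of w] by (simp add: inner_diff_left dot_square_norm)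
        qed
        have aT: "a \<bullet> T w > 0" if w: "w \<in> {x..y}" for w
        proof -
          have "1 / 2 * (y - x) \<le> T w \<bullet> (G y - G x) - T w \<bullet> (G x - G x)"
            by (rule deriv_ge_imp_diff_ge[where f' = "\<lambda>z. T w \<bullet> T z"])
              (use xy TT w in \<open>auto intro!: has_vector_derivative_inner_right A(7)\<close>)
          then show ?thesis using xy' by (simp add: a_def inner_commute)
        qed
        have a0: "norm a > 0" using aT[of x] xy by auto
        have ay: "norm a \<le> y - x" using Glip xy by (simp add: a_def)
        \<comment> \<open>The bound on the sine of the angle between chord and tangent.\<close>
        define q where "q = norm a / (2 * R)"
        have q: "0 \<le> q" "q\<^sup>2 \<le> e"
        proof -
          show q0: "0 \<le> q" using R by (simp add: q_def)
          have "q \<le> e" using ay xy R by (simp add: q_def field_simps)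
          then have "q\<^sup>2 \<le> e * 1" using q0 e unfolding power2_eq_square by (intro mult_mono) auto
          then show "q\<^sup>2 \<le> e" by simp
        qed
        have *: "norm (sgn a - T w) \<le> (1 + e) * q" if w: "w \<in> {x, y}" for w
        proof (rule unit_close_of_small_normal[OF _ A(8) _ _ q e(2)])
          show "norm (sgn a) = 1" using a0 by (simp add: norm_sgn)
          show "0 < sgn a \<bullet> T w" using aT[of w] w xy a0 by (auto simp: sgn_div_norm)
          have "2 * R * norm (a - (a \<bullet> T w) *\<^sub>R T w) \<le> (norm a)\<^sup>2"
          proof (cases "w = x")
            case True then show ?thesis using nor[of a y x] by (simp add: a_def)
          next
            case False
            then have "w = y" using w by simp
            have "2 * R * norm (- a - (- a \<bullet> T y) *\<^sub>R T y) \<le> (norm (- a))\<^sup>2"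
              by (rule nor[where x = y and y = x]) (simp add: a_def)
            moreover have "- a - (- a \<bullet> T y) *\<^sub>R T y = - (a - (a \<bullet> T y) *\<^sub>R T y)" by simp
            ultimately show ?thesis unfolding \<open>w = y\<close> by (simp only: norm_minus_cancel)
          qed
          then have "norm (a - (a \<bullet> T w) *\<^sub>R T w) \<le> q * norm a"
            using R by (simp add: q_def field_simps power2_eq_square)
          then have "(norm (a - (a \<bullet> T w) *\<^sub>R T w))\<^sup>2 \<le> (q * norm a)\<^sup>2" by (intro power_mono) auto
          then have "(norm a)\<^sup>2 - (a \<bullet> T w)\<^sup>2 \<le> q\<^sup>2 * (norm a)\<^sup>2"
            using normal_part(2)[OF A(8), of a w] by (simp add: power_mult_distrib)
          then have "((norm a)\<^sup>2 - (a \<bullet> T w)\<^sup>2) / (norm a)\<^sup>2 \<le> q\<^sup>2" using a0 by (simp add: pos_divide_le_eq)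
          then show "1 - (sgn a \<bullet> T w)\<^sup>2 \<le> q\<^sup>2"
          proof -
            have "(sgn a \<bullet> T w)\<^sup>2 = (a \<bullet> T w)\<^sup>2 / (norm a)\<^sup>2"
              by (simp add: sgn_div_norm power_mult_distrib divide_inverse power_inverse)
            then have "1 - (sgn a \<bullet> T w)\<^sup>2 = ((norm a)\<^sup>2 - (a \<bullet> T w)\<^sup>2) / (norm a)\<^sup>2"
              using a0 by (simp add: diff_divide_distrib)
            then show ?thesis using \<open>((norm a)\<^sup>2 - (a \<bullet> T w)\<^sup>2) / (norm a)\<^sup>2 \<le> q\<^sup>2\<close> by simp
          qed
        qed
        have "norm (T y - T x) \<le> norm (sgn a - T x) + norm (sgn a - T y)"
          using norm_triangle_ineq4[of "sgn a - T x" "sgn a - T y"] by simp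
        also have "\<dots> \<le> 2 * ((1 + e) * q)" using *[of x] *[of y] by simp
        also have "\<dots> = (1 + e) * (norm a / R)" by (simp add: q_def)
        also have "\<dots> \<le> (1 + e0) * ((y - x) / R)"
          using ay R e e0 a0 by (intro mult_mono divide_right_mono) auto
        finally show ?thesis by (simp add: diff_divide_distrib)
      qed (use e0 R xy in auto)
    qed
  qed
  then show "norm (sgn (ltan g i t0) - sgn (ltan g i s0)) \<le> 1 / R * integral {s0..t0} (\<lambda>r. norm (ltan g i r))"
    using A(10)[OF st0] by (simp add: A(6) diff_divide_distrib)
qed

text \<open>Along an arc of length \<open>h\<close> the curve advances by at least
  \<open>(1 - h / rho) * h\<close> in the direction of its initial tangent and deviates by at most
  \<open>h\<^sup>2 / (2 * rho)\<close> in any normal direction. The gap between \<open>r\<close> and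
  \<open>rho\<close> makes the first effect win.\<close>

lemma short_arc_avoids_ball:
  fixes H V :: "real \<Rightarrow> 'a::real_inner"
  assumes H: "\<And>y. (H has_vector_derivative V y) (at y)" and V0: "norm (V 0) = 1"
    and lip: "\<And>y. 0 \<le> y \<Longrightarrow> norm (V y - V 0) \<le> y / rho"
    and r: "0 < r" "r < rho" and h: "0 \<le> h" "h \<le> (rho - r) / 2" and v: "norm v = 1" "v \<bullet> V 0 = 0"
  shows "2 * r * (v \<bullet> (H h - H 0)) \<le> (norm (H h - H 0))\<^sup>2"
proof -
  define a where "a = H h - H 0"
  have rho: "rho > 0" using r by simp
  have hr: "h / rho \<le> 1" "1 - 2 * (h / rho) \<ge> r / rho" using h r by (auto simp: field_simps)
  have "(1 - h / rho) * (h - 0) \<le> V 0 \<bullet> (H h - H 0) - V 0 \<bullet> (H 0 - H 0)"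
  proof (rule deriv_ge_imp_diff_ge[where f' = "\<lambda>z. V 0 \<bullet> V z"])
    fix x assume x: "0 \<le> x" "x \<le> h"
    have "V 0 \<bullet> (V 0 - V x) \<le> h / rho"
      using norm_cauchy_schwarz[of "V 0" "V 0 - V x"] lip[of x] V0 x rho
      by (simp add: norm_minus_commute) (meson divide_right_mono less_imp_le order_trans)
    then show "1 - h / rho \<le> V 0 \<bullet> V x" using V0 by (simp add: inner_diff_right dot_square_norm)
  qed (use h in \<open>auto intro!: has_vector_derivative_inner_right H\<close>)
  then have 1: "(1 - h / rho) * h \<le> V 0 \<bullet> a" by (simp add: a_def)
  also have "V 0 \<bullet> a \<le> norm a" using norm_cauchy_schwarz[of "V 0" a] V0 by simp
  finally have "((1 - h / rho) * h)\<^sup>2 \<le> (norm a)\<^sup>2" using h hr by (intro power_mono) auto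
  moreover have "2 * r * (v \<bullet> a) \<le> (r / rho) * h\<^sup>2"
  proof -
    have "0 * (h - 0) \<le> (h\<^sup>2 / (2 * rho) - v \<bullet> (H h - H 0)) - (0\<^sup>2 / (2 * rho) - v \<bullet> (H 0 - H 0))"
    proof (rule deriv_ge_imp_diff_ge[where f = "\<lambda>y. y\<^sup>2 / (2 * rho) - v \<bullet> (H y - H 0)" and f' = "\<lambda>z. z / rho - v \<bullet> V z"])
      show "((\<lambda>y. y\<^sup>2 / (2 * rho) - v \<bullet> (H y - H 0)) has_real_derivative (x / rho - v \<bullet> V x)) (at x)" for x
      proof -
        have "((\<lambda>y. y\<^sup>2 / (2 * rho)) has_real_derivative x / rho) (at x)"
          using rho by (auto intro!: derivative_eq_intros)
        then show ?thesis by (intro DERIV_diff has_vector_derivative_inner_right H)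
      qed
      fix x assume x: "0 \<le> x" "x \<le> h"
      have "v \<bullet> V x = v \<bullet> (V x - V 0)" using v by (simp add: inner_diff_right)
      also have "\<dots> \<le> x / rho" using norm_cauchy_schwarz[of v "V x - V 0"] lip[of x] v x by simp
      finally show "0 \<le> x / rho - v \<bullet> V x" by simp
    qed (use h in auto)
    then have "v \<bullet> a \<le> h\<^sup>2 / (2 * rho)" by (simp add: a_def)
    then have "2 * r * (v \<bullet> a) \<le> 2 * r * (h\<^sup>2 / (2 * rho))" using r by (intro mult_left_mono) auto
    then show ?thesis by simp
  qed
  moreover have "(r / rho) * h\<^sup>2 \<le> ((1 - h / rho) * h)\<^sup>2"
  proof -
    have "(1 - h / rho)\<^sup>2 = 1 - 2 * (h / rho) + (h / rho)\<^sup>2" by (simp add: power2_diff)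
    then have "r / rho \<le> (1 - h / rho)\<^sup>2" using hr(2) zero_le_power2[of "h / rho"] by linarith
    then show ?thesis unfolding power_mult_distrib by (rule mult_right_mono) simp
  qed
  ultimately show ?thesis unfolding a_def by linarith
qed

lemma curv_le_imp_lipschitz:
  assumes cv: "curv_le k m g" and i: "i < m" and S: "strict_mono S" "surj S"
    and T: "\<And>t. T (S t) = sgn (ltan g i t)"
    and int: "\<And>s t. s \<le> t \<Longrightarrow> integral {s..t} (\<lambda>r. norm (ltan g i r)) = S t - S s"
  shows "norm (T y - T x) \<le> k * \<bar>y - x\<bar>"
proof -
  have *: "norm (T y - T x) \<le> k * (y - x)" if "x \<le> y" for x y
  proof -
    obtain s t where st: "x = S s" "y = S t" using S(2) by (meson surjD)
    then have "s \<le> t" using that S(1) by (simp add: strict_mono_less_eq)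
    then show ?thesis using cv i int[of s t] unfolding curv_le_def st T by metis
  qed
  show ?thesis using *[of x y] *[of y x] by (cases "x \<le> y") (auto simp: norm_minus_commute)
qed

text \<open>If a tangent ball of radius \<open>r < 1 / curvature\<close> touches the link a second time and no tangent ball of
  radius \<open>r\<close> is entered, then moving the point of tangency towards the other point shows that the
  two points are antipodal on the ball.\<close>

lemma touching_ball_crit_pair:
  assumes lk: "is_link m g" and r: "0 < r" "r < rho" and cv: "curv_le (1 / rho) m g"
    and tb: "avoids_tangent_balls r m g" and ij: "i < m" "j < m"
    and a: "a = g j t - g i s" "a \<noteq> 0" and n: "n = a - (a \<bullet> sgn (ltan g i s)) *\<^sub>R sgn (ltan g i s)"
    and eq: "(norm a)\<^sup>2 = 2 * r * norm n"
  shows "crit_pair g i s j t \<and> norm a = 2 * r"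
proof -
  obtain S G T and l :: real where A: "l > 0" "strict_mono S" "surj S"
    "\<And>t. g i t = G (S t)" "\<And>t. T (S t) = sgn (ltan g i t)"
    "\<And>s. (G has_vector_derivative T s) (at s)" "\<And>s. norm (T s) = 1" "continuous_on UNIV T"
    "\<And>s t. s \<le> t \<Longrightarrow> integral {s..t} (\<lambda>r. norm (ltan g i r)) = S t - S s"
    by (rule arclength[OF lk ij(1)], rule that; assumption)
  have Tlip: "norm (T y - T x) \<le> \<bar>y - x\<bar> / rho" for x y
    using curv_le_imp_lipschitz[OF cv ij(1) A(2,3,5,9), of y x] by simp
  define s0 where "s0 = S s"
  have n': "n = a - (a \<bullet> T s0) *\<^sub>R T s0" by (simp add: n s0_def A(5))
  have aG: "a = g j t - G s0" by (simp add: a s0_def A(4))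
  note np = normal_part[OF A(7), of a s0, folded n']
  have n0: "norm n > 0" using eq a(2) r by (auto intro: ccontr)
  define v where "v = sgn n"
  have v: "norm v = 1" "v \<bullet> T s0 = 0" "v \<bullet> a = norm n"
    using n0 np(1,3) by (auto simp: v_def norm_sgn) (auto simp: sgn_div_norm power2_eq_square)
  have tbG: "2 * r * (w \<bullet> (g k y - G x)) \<le> (norm (g k y - G x))\<^sup>2" if "norm w = 1" "w \<bullet> T x = 0" "k < m" for x y w k
  proof -
    obtain s where st: "x = S s" using A(3) by (meson surjD)
    have "w \<bullet> ltan g i s = 0" using that(2) ltan_nonzero[OF lk ij(1), of s] by (simp add: st A(5) sgn_div_norm)
    then show ?thesis using tb ij(1) that(1,3) unfolding avoids_tangent_balls_def by (simp add: st A(4)[symmetric])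
  qed
  \<comment> \<open>The centre of the touching ball. As the ball is not entered,
    \<open>g j t\<close> is a nearest point of its component to \<open>x\<close>, so the radius
    there is perpendicular to the link.\<close>
  define x where "x = G s0 + r *\<^sub>R v"
  have xq: "norm (g j t - x) \<le> norm (g j y - x)" for y
  proof -
    have e: "(norm (g j y - x))\<^sup>2 = (norm (g j y - G s0))\<^sup>2 - 2 * r * (v \<bullet> (g j y - G s0)) + r\<^sup>2" for y
    proof -
      have "g j y - x = (g j y - G s0) + (- r) *\<^sub>R v" by (simp add: x_def)
      then show ?thesis using v(1) by (simp only: norm_add_scaleR_square) (simp add: inner_commute)
    qed
    have "(norm (g j t - x))\<^sup>2 = r\<^sup>2" unfolding e using eq v(3) by (simp add: aG)
    also have "\<dots> \<le> (norm (g j y - x))\<^sup>2" unfolding e using tbG[OF v(1,2) ij(2), of y] by simp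
    finally show ?thesis by (rule power2_le_imp_le) simp
  qed
  have perp_t: "(g j t - x) \<bullet> ltan g j t = 0"
    by (rule dist_extremal_orthogonal[OF link_deriv[OF lk ij(2)]]) (use xq in blast)
  \<comment> \<open>\<open>f1\<close> measures the position of \<open>g j t\<close> relative to the
    ball with fixed normal \<open>v\<close> whose point of tangency is moved in the direction
    \<open>sg\<close>. It starts at 0, and the ball condition keeps it from decreasing faster than
    the turning of the tangent allows. With the sign of \<open>a \<bullet> T s0\<close> for
    \<open>sg\<close>, this says that \<open>\<bar>a \<bullet> T s0\<bar>\<close> is at most
    \<open>r / rho\<close> times itself.\<close>
  have side: "0 \<le> - 2 * (sg * (a \<bullet> T s0)) + (2 * r / rho) * \<bar>T s0 \<bullet> a\<bar>" if sg: "sg = 1 \<or> sg = -1" for sg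
  proof -
    define p where "p y = G (s0 + sg * y)" for y
    define W where "W y = T (s0 + sg * y)" for y
    have p': "(p has_vector_derivative sg *\<^sub>R W y) (at y)" for y
    proof -
      have "((\<lambda>y. s0 + sg * y) has_real_derivative sg) (at y)" by (auto intro!: derivative_eq_intros)
      then have "(G \<circ> (\<lambda>y. s0 + sg * y) has_vector_derivative sg *\<^sub>R T (s0 + sg * y)) (at y)"
        by (intro vector_diff_chain_at A(6)) (simp add: has_real_derivative_iff_has_vector_derivative)
      then show ?thesis by (simp add: p_def[abs_def] W_def o_def)
    qed
    define b where "b y = g j t - p y" for y
    define f1 where "f1 y = (norm (b y))\<^sup>2 - 2 * r * (v \<bullet> b y)" for y
    have b0: "b 0 = a" by (simp add: b_def p_def aG)
    have f10: "f1 0 = 0" unfolding f1_def b0 using eq v(3) by simp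
    have f1': "(f1 has_real_derivative (- 2 * (sg * (a \<bullet> T s0)))) (at 0)"
    proof -
      note pd = p'[of 0, unfolded has_vector_derivative_def]
      have "(f1 has_derivative (\<lambda>h. h * (- 2 * (sg * (a \<bullet> T s0))))) (at 0)"
        unfolding f1_def b_def power2_norm_eq_inner
        by (rule derivative_eq_intros pd refl)+
          (simp add: fun_eq_iff W_def b0[unfolded b_def] v inner_commute)
      then show ?thesis by (rule has_real_derivativeI)
    qed
    \<comment> \<open>At the moved point \<open>v\<close> need not be normal. Its normal part
      \<open>z\<close> is, and since \<open>norm z \<le> 1\<close> the ball condition for
      \<open>sgn z\<close> passes to \<open>z\<close>.\<close>
    have ge: "0 \<le> f1 y + 2 * r * ((v \<bullet> W y) * (W y \<bullet> b y))" for y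
    proof -
      define z where "z = v - (v \<bullet> W y) *\<^sub>R W y"
      have Wn: "norm (W y) = 1" by (simp add: W_def A(7))
      note zp = normal_part[OF Wn, of v, folded z_def]
      have "norm z \<le> 1"
      proof -
        have "(norm z)\<^sup>2 \<le> 1\<^sup>2" unfolding zp(2) using v(1) by simp
        then show ?thesis by (rule power2_le_imp_le) simp
      qed
      have "2 * r * (z \<bullet> b y) \<le> (norm (b y))\<^sup>2"
      proof (cases "z = 0")
        case False
        have "2 * r * (sgn z \<bullet> b y) \<le> (norm (b y))\<^sup>2"
          unfolding b_def p_def
          by (rule tbG) (use False zp(1) ij in \<open>auto simp: norm_sgn W_def\<close>, simp add: sgn_div_norm)
        then have "norm z * (2 * r * (sgn z \<bullet> b y)) \<le> norm z * (norm (b y))\<^sup>2" by (rule mult_left_mono) simp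
        moreover have "norm z * (2 * r * (sgn z \<bullet> b y)) = 2 * r * (z \<bullet> b y)" using False by (simp add: sgn_div_norm)
        ultimately have "2 * r * (z \<bullet> b y) \<le> norm z * (norm (b y))\<^sup>2" by simp
        also have "\<dots> \<le> (norm (b y))\<^sup>2" using \<open>norm z \<le> 1\<close> by (simp add: mult_left_le_one_le)
        finally show ?thesis .
      qed simp
      then show ?thesis by (simp add: f1_def z_def inner_diff_left algebra_simps)
    qed
    have "((\<lambda>y. f1 y / y) \<longlongrightarrow> - 2 * (sg * (a \<bullet> T s0))) (at_right 0)"
    proof -
      have "((\<lambda>y. (f1 y - f1 0) / (y - 0)) \<longlongrightarrow> - 2 * (sg * (a \<bullet> T s0))) (at 0)"
        using f1' unfolding has_field_derivative_iff by simp
      then show ?thesis unfolding f10 by (simp add: filterlim_at_split)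
    qed
    moreover have "((\<lambda>y. (2 * r / rho) * \<bar>W y \<bullet> b y\<bar>) \<longlongrightarrow> (2 * r / rho) * \<bar>W 0 \<bullet> b 0\<bar>) (at_right 0)"
    proof -
      have "isCont p 0" using p'[of 0] has_vector_derivative_continuous by blast
      then have "isCont b 0" unfolding b_def by (intro continuous_diff continuous_const)
      moreover have "isCont T (s0 + sg * 0)" using A(8) by (simp add: continuous_on_eq_continuous_at)
      then have "isCont W 0" unfolding W_def by (rule isCont_o2[rotated]) simp
      ultimately have "isCont (\<lambda>y. (2 * r / rho) * \<bar>W y \<bullet> b y\<bar>) 0"
        by (intro continuous_mult continuous_const continuous_rabs continuous_inner)
      then show ?thesis by (simp only: isCont_def filterlim_at_split)
    qed
    ultimately have lim: "((\<lambda>y. f1 y / y + (2 * r / rho) * \<bar>W y \<bullet> b y\<bar>) \<longlongrightarrow>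
        - 2 * (sg * (a \<bullet> T s0)) + (2 * r / rho) * \<bar>W 0 \<bullet> b 0\<bar>) (at_right 0)" by (rule tendsto_add)
    have "\<forall>\<^sub>F y in at_right 0. 0 \<le> f1 y / y + (2 * r / rho) * \<bar>W y \<bullet> b y\<bar>"
    proof (rule eventually_at_right_less[THEN eventually_mono])
      fix y :: real assume y: "0 < y"
      have "v \<bullet> W y = v \<bullet> (W y - T s0)" by (simp add: inner_diff_right v)
      moreover have "norm (W y - T s0) \<le> y / rho" using Tlip[of "s0 + sg * y" s0] sg y by (auto simp: W_def)
      ultimately have "\<bar>v \<bullet> W y\<bar> \<le> y / rho" using Cauchy_Schwarz_ineq2[of v "W y - T s0"] v(1) by simp
      then have "\<bar>(v \<bullet> W y) * (W y \<bullet> b y)\<bar> \<le> (y / rho) * \<bar>W y \<bullet> b y\<bar>"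
        unfolding abs_mult by (rule mult_right_mono) simp
      then have "(v \<bullet> W y) * (W y \<bullet> b y) \<le> (y / rho) * \<bar>W y \<bullet> b y\<bar>" by simp
      then have "2 * r * ((v \<bullet> W y) * (W y \<bullet> b y)) \<le> 2 * r * ((y / rho) * \<bar>W y \<bullet> b y\<bar>)"
        using r by (intro mult_left_mono) auto
      then have "0 \<le> f1 y + 2 * r * ((y / rho) * \<bar>W y \<bullet> b y\<bar>)" using ge[of y] by linarith
      then have "0 \<le> (f1 y + 2 * r * ((y / rho) * \<bar>W y \<bullet> b y\<bar>)) / y" using y by simp
      then show "0 \<le> f1 y / y + (2 * r / rho) * \<bar>W y \<bullet> b y\<bar>" using y by (simp add: add_divide_distrib)
    qed
    from tendsto_lowerbound[OF lim this] show ?thesis by (simp add: W_def b0)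
  qed
  have aT: "a \<bullet> T s0 = 0"
  proof (rule ccontr)
    assume "a \<bullet> T s0 \<noteq> 0"
    then have p: "\<bar>a \<bullet> T s0\<bar> > 0" by simp
    have "2 * \<bar>a \<bullet> T s0\<bar> \<le> (2 * r / rho) * \<bar>a \<bullet> T s0\<bar>"
      using side[of 1] side[of "-1"] by (cases "a \<bullet> T s0 \<ge> 0") (auto simp: inner_commute)
    then have "2 \<le> 2 * r / rho" using p by (rule mult_right_le_imp_le)
    then show False using r by (simp add: pos_le_divide_eq)
  qed
  then have na: "n = a" by (simp add: n')
  have na2: "norm a = 2 * r" using eq a(2) unfolding na by (simp add: power2_eq_square)
  have "r *\<^sub>R v = (1/2) *\<^sub>R a" using na2 r by (simp add: v_def na sgn_div_norm)
  then have "g j t - x = (1/2) *\<^sub>R a"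
    using scaleR_left_diff_distrib[of 1 "1/2" a] by (simp add: x_def aG[symmetric] diff_diff_eq[symmetric])
  then have "a \<bullet> ltan g j t = 0" using perp_t by simp
  moreover have "a \<bullet> ltan g i s = 0"
    using aT ltan_nonzero[OF lk ij(1), of s] by (simp add: s0_def A(5) sgn_div_norm)
  ultimately show ?thesis using a na2 by (auto simp: crit_pair_def)
qed

text \<open>Points of the link that are close in space are close in arclength, up to a period, so
  the estimate for short arcs applies, forwards or backwards along the curve.\<close>

lemma curv_le_locally_avoids_tangent_balls:
  assumes lk: "is_link m g" and r: "0 < r" "r < rho" and cv: "curv_le (1 / rho) m g"
  shows "\<exists>d>0. \<forall>i<m. \<forall>j<m. \<forall>s t v. norm (g j t - g i s) < d \<and> norm v = 1 \<and> v \<bullet> ltan g i s = 0 \<longrightarrow>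
     2 * r * (v \<bullet> (g j t - g i s)) \<le> (norm (g j t - g i s))\<^sup>2"
proof -
  obtain a b where ab: "0 < a" "a \<le> b" "\<And>i t. i < m \<Longrightarrow> norm (ltan g i t) \<le> b"
    using speed_bounds[OF lk] by metis
  define h where "h = (rho - r) / 2 / b"
  have h: "h > 0" "b * h = (rho - r) / 2" using r ab by (auto simp: h_def)
  obtain d where d: "d > 0" "\<And>i j s t. i < m \<Longrightarrow> j < m \<Longrightarrow> norm (g i s - g j t) < d \<Longrightarrow> i = j \<and> (\<exists>k::int. \<bar>s - (t + of_int k)\<bar> < h)"
    using link_close_params[OF lk h(1)] by metis
  have "2 * r * (v \<bullet> (g j t - g i s)) \<le> (norm (g j t - g i s))\<^sup>2"
    if ij: "i < m" "j < m" and close: "norm (g j t - g i s) < d" and v: "norm v = 1" "v \<bullet> ltan g i s = 0" for i j s t v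
  proof -
    have "norm (g i s - g j t) < d" using close by (simp add: norm_minus_commute)
    from d(2)[OF ij this] obtain k :: int where eq: "i = j" and k: "\<bar>s - (t + of_int k)\<bar> < h" by blast
    define t' where "t' = t + of_int k"
    have gt: "g j t = g i t'" using eq ij by (simp add: t'_def link_periodic_int[OF lk])
    obtain S G T and l :: real where A: "l > 0" "strict_mono S" "surj S" "\<And>t. (S has_real_derivative norm (ltan g i t)) (at t)"
      "\<And>t. g i t = G (S t)" "\<And>t. T (S t) = sgn (ltan g i t)"
      "\<And>s. (G has_vector_derivative T s) (at s)" "\<And>s. norm (T s) = 1"
      "\<And>s t. s \<le> t \<Longrightarrow> integral {s..t} (\<lambda>r. norm (ltan g i r)) = S t - S s"
      by (rule arclength[OF lk ij(1)], rule that; assumption)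
    note Tlip = curv_le_imp_lipschitz[OF cv ij(1) A(2,3,6,9)]
    have "\<bar>S t' - S s\<bar> \<le> b * \<bar>t' - s\<bar>"
    proof -
      have "norm (S t' - S s) \<le> b * norm (t' - s)"
      proof (rule differentiable_bound[of UNIV])
        show "(S has_derivative (\<lambda>h. h * norm (ltan g i x))) (at x within UNIV)" for x
          using A(4)[of x] by (simp add: has_field_derivative_def mult.commute[of _ "norm (ltan g i x)"])
        show "onorm (\<lambda>h. h * norm (ltan g i x)) \<le> b" for x
        proof (rule onorm_le)
          fix z :: real
          show "norm (z * norm (ltan g i x)) \<le> b * norm z"
            using mult_right_mono[OF ab(3)[OF ij(1), of x], of "\<bar>z\<bar>"] by (simp add: abs_mult mult.commute)
        qed
      qed auto
      then show ?thesis by simp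
    qed
    also have "\<dots> \<le> b * h" using k ab by (intro mult_left_mono) (auto simp: t'_def)
    finally have near: "\<bar>S t' - S s\<bar> \<le> (rho - r) / 2" using h by simp
    have v0: "v \<bullet> T (S s) = 0" using v(2) by (simp add: A(6) sgn_div_norm)
    have main: "2 * r * (v \<bullet> (G (S s + sg * y) - G (S s))) \<le> (norm (G (S s + sg * y) - G (S s)))\<^sup>2"
      if sg: "sg = 1 \<or> sg = -1" and y: "0 \<le> y" "y \<le> (rho - r) / 2" for sg y
    proof -
      define H where "H z = G (S s + sg * z)" for z
      define V where "V z = sg *\<^sub>R T (S s + sg * z)" for z
      have "2 * r * (v \<bullet> (H y - H 0)) \<le> (norm (H y - H 0))\<^sup>2"
      proof (rule short_arc_avoids_ball[where V = V and rho = rho])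
        show "(H has_vector_derivative V z) (at z)" for z
        proof -
          have "((\<lambda>y. S s + sg * y) has_real_derivative sg) (at z)" by (auto intro!: derivative_eq_intros)
          then have "(G \<circ> (\<lambda>y. S s + sg * y) has_vector_derivative sg *\<^sub>R T (S s + sg * z)) (at z)"
            by (intro vector_diff_chain_at A(7)) (simp add: has_real_derivative_iff_has_vector_derivative)
          then show ?thesis by (simp add: H_def[abs_def] V_def o_def)
        qed
        show "norm (V 0) = 1" using sg A(8) by (auto simp: V_def)
        show "norm (V z - V 0) \<le> z / rho" if "0 \<le> z" for z
        proof -
          have "norm (V z - V 0) = \<bar>sg\<bar> * norm (T (S s + sg * z) - T (S s))"
            by (simp add: V_def scaleR_diff_right[symmetric])
          also have "\<dots> \<le> 1 / rho * \<bar>sg * z\<bar>" using Tlip[of "S s + sg * z" "S s"] sg by auto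
          finally show ?thesis using sg that by auto
        qed
        show "v \<bullet> V 0 = 0" by (simp add: V_def v0)
      qed (use r y v in auto)
      then show ?thesis by (simp add: H_def)
    qed
    define sg :: real where "sg = (if S s \<le> S t' then 1 else -1)"
    have "S s + sg * \<bar>S t' - S s\<bar> = S t'" by (auto simp: sg_def)
    then show ?thesis using main[of sg "\<bar>S t' - S s\<bar>"] near by (simp add: gt A(5)) (simp add: sg_def split: if_splits)
  qed
  then show ?thesis using d(1) by blast
qed

text \<open>If a tangent ball of radius below \<open>rho\<close> were entered, shrink the balls
  until none is entered any more. The last one touches the link a second time, away from the point
  of tangency because of the local estimate, and yields a critical pair closer than
  \<open>2 * rho\<close>. The radius \<open>rho\<close> itself is a limit case.\<close>

lemma curv_le_imp_avoids_tangent_balls: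
  assumes lk: "is_link m g" and rho: "0 < rho" and cv: "curv_le (1 / rho) m g"
    and crit: "\<And>i j s t. i < m \<Longrightarrow> j < m \<Longrightarrow> crit_pair g i s j t \<Longrightarrow> 2 * rho \<le> norm (g j t - g i s)"
  shows "avoids_tangent_balls rho m g"
proof -
  have main: "avoids_tangent_balls r1 m g" if r1: "0 < r1" "r1 < rho" for r1
  proof (rule ccontr)
    assume "\<not> avoids_tangent_balls r1 m g"
    then obtain i j s t v where ij: "i < m" "j < m" and v: "norm v = 1" "v \<bullet> ltan g i s = 0"
      and viol: "(norm (g j t - g i s))\<^sup>2 < 2 * r1 * (v \<bullet> (g j t - g i s))"
      unfolding avoids_tangent_balls_def not_all not_imp not_le by blast
    obtain d where d: "d > 0" "\<And>i j s t v. i < m \<Longrightarrow> j < m \<Longrightarrow> norm (g j t - g i s) < d \<Longrightarrow> norm v = 1 \<Longrightarrow> v \<bullet> ltan g i s = 0 \<Longrightarrow>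
       2 * r1 * (v \<bullet> (g j t - g i s)) \<le> (norm (g j t - g i s))\<^sup>2"
      using curv_le_locally_avoids_tangent_balls[OF lk r1 cv] by metis
    define D where "D = {..<m} \<times> {0..1::real}"
    define c where "c x = g (fst x) (snd x)" for x :: "nat \<times> real"
    define \<tau> where "\<tau> x = sgn (ltan g (fst x) (snd x))" for x :: "nat \<times> real"
    define A where "A = (D \<times> D) \<inter> (\<lambda>z. norm (c (snd z) - c (fst z))) -` {d..}"
    define n where "n z = (c (snd z) - c (fst z)) - ((c (snd z) - c (fst z)) \<bullet> \<tau> (fst z)) *\<^sub>R \<tau> (fst z)" for z
    \<comment> \<open>The reciprocal of the diameter of the smallest ball tangent at the first point
      whose boundary contains the second. The optimal normal direction is that of
      \<open>n z\<close>.\<close>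
    define f where "f z = norm (n z) / (norm (c (snd z) - c (fst z)))\<^sup>2" for z
    have cc: "continuous_on D c" unfolding D_def c_def by (rule link_cont_domain[OF lk])
    have ct: "continuous_on D \<tau>" unfolding D_def \<tau>_def
      by (rule continuous_on_sgn[OF ltan_cont_domain[OF lk]]) (use ltan_nonzero[OF lk] in auto)
    have cD: "compact D" unfolding D_def by (rule compact_link_domain[OF lk])
    have c1: "continuous_on (D \<times> D) (\<lambda>z. c (fst z))" "continuous_on (D \<times> D) (\<lambda>z. c (snd z))"
       "continuous_on (D \<times> D) (\<lambda>z. \<tau> (fst z))"
      by (rule continuous_on_compose2[OF cc] continuous_on_compose2[OF ct]; auto intro: continuous_on_fst continuous_on_snd)+
    have "closed A" unfolding A_def
      by (rule continuous_closed_preimage) (auto intro!: continuous_intros c1 compact_imp_closed compact_Times cD)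
    then have cA: "compact A"
      using compact_Int_closed[OF compact_Times[OF cD cD], of A] by (simp add: A_def Int_absorb1 Int_assoc[symmetric])
    have AD: "A \<subseteq> D \<times> D" by (auto simp: A_def)
    have pos: "norm (c (snd z) - c (fst z)) > 0" if "z \<in> A" for z using that d(1) by (auto simp: A_def)
    have fc: "continuous_on A f" unfolding f_def n_def
      by (intro continuous_intros continuous_on_subset[OF c1(1) AD] continuous_on_subset[OF c1(2) AD] continuous_on_subset[OF c1(3) AD])
        (use pos in fastforce)
    have red: "\<exists>z\<in>D \<times> D. c (fst z) = g i s \<and> c (snd z) = g j t \<and> \<tau> (fst z) = sgn (ltan g i s) \<and>
        fst (fst z) = i \<and> fst (snd z) = j" if "i < m" "j < m" for i j s t
    proof -
      obtain k where k: "s + of_int k \<in> {0..<1::real}" by (rule unit_interval_reduce[OF lk])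
      obtain l where l: "t + of_int l \<in> {0..<1::real}" by (rule unit_interval_reduce[OF lk])
      show ?thesis
        by (rule bexI[of _ "((i, s + of_int k), (j, t + of_int l))"])
          (use that k l link_periodic_int[OF lk] ltan_periodic_int[OF lk] in \<open>auto simp: c_def \<tau>_def D_def\<close>)
    qed
    have vn: "v \<bullet> a \<le> norm (a - (a \<bullet> sgn (ltan g i s)) *\<^sub>R sgn (ltan g i s))"
      if "i < m" "norm v = 1" "v \<bullet> ltan g i s = 0" for i s v a
      by (rule normal_part(4)) (use that ltan_nonzero[OF lk that(1)] in \<open>auto simp: norm_sgn\<close>, simp add: sgn_div_norm)
    obtain z0 where z0: "z0 \<in> D \<times> D" "c (fst z0) = g i s" "c (snd z0) = g j t" "\<tau> (fst z0) = sgn (ltan g i s)"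
      using red[OF ij] by blast
    have "\<not> norm (g j t - g i s) < d" using d(2)[OF ij _ v, of t] viol by force
    then have z0A: "z0 \<in> A" using z0 by (auto simp: A_def)
    have f0: "f z0 > 1 / (2 * r1)"
    proof -
      have "(norm (g j t - g i s))\<^sup>2 < 2 * r1 * norm (n z0)"
      proof -
        have "v \<bullet> (g j t - g i s) \<le> norm (n z0)" using vn[OF ij(1) v] by (simp add: n_def z0)
        then have "2 * r1 * (v \<bullet> (g j t - g i s)) \<le> 2 * r1 * norm (n z0)" using r1 by (intro mult_left_mono) auto
        then show ?thesis using viol by linarith
      qed
      then show ?thesis using pos[OF z0A] r1 by (simp add: f_def z0 field_simps)
    qed
    obtain z where z: "z \<in> A" "\<And>y. y \<in> A \<Longrightarrow> f y \<le> f z"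
      using continuous_attains_sup[OF cA _ fc] z0A by blast
    have fz: "f z > 1 / (2 * r1)" using z(2)[OF z0A] f0 by linarith
    then have fz0: "f z > 0" using r1 by (smt (verit) divide_pos_pos)
    \<comment> \<open>The smallest radius at which a tangent ball touches a point at distance at
      least \<open>d\<close>. No ball of this radius is entered: at smaller distances the local
      estimate for \<open>r1 > r\<close> applies.\<close>
    define r where "r = 1 / (2 * f z)"
    have r: "0 < r" "r < r1" using fz fz0 r1 by (auto simp: r_def field_simps)
    have tb: "avoids_tangent_balls r m g"
      unfolding avoids_tangent_balls_def
    proof (intro allI impI)
      fix i j s t v assume ij: "i < m" "j < m" and v: "norm v = 1 \<and> v \<bullet> ltan g i s = 0"
      define a where "a = g j t - g i s"
      have "2 * r * (v \<bullet> a) \<le> (norm a)\<^sup>2"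
      proof (cases "norm a < d")
        case True
        then have 1: "2 * r1 * (v \<bullet> a) \<le> (norm a)\<^sup>2" using d(2)[OF ij] v by (simp add: a_def)
        show ?thesis
        proof (cases "v \<bullet> a \<ge> 0")
          case True
          then have "2 * r * (v \<bullet> a) \<le> 2 * r1 * (v \<bullet> a)" using r by (intro mult_right_mono) auto
          then show ?thesis using 1 by linarith
        next
          case False
          then have "2 * r * (v \<bullet> a) \<le> 0" using r by (simp add: mult_nonneg_nonpos)
          then show ?thesis by (smt (verit) zero_le_power2)
        qed
      next
        case False
        obtain y where y: "y \<in> D \<times> D" "c (fst y) = g i s" "c (snd y) = g j t" "\<tau> (fst y) = sgn (ltan g i s)"
          using red[OF ij] by blast
        have yA: "y \<in> A" using y False by (auto simp: A_def a_def)
        have "v \<bullet> a \<le> norm (n y)" using vn[OF ij(1)] v by (simp add: n_def y a_def)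
        also have "norm (n y) \<le> f z * (norm a)\<^sup>2"
          using z(2)[OF yA] pos[OF yA] by (simp add: f_def[of y] y a_def pos_divide_le_eq)
        finally have "2 * r * (v \<bullet> a) \<le> 2 * r * (f z * (norm a)\<^sup>2)" using r by (intro mult_left_mono) auto
        also have "\<dots> = (norm a)\<^sup>2" using fz0 by (simp add: r_def)
        finally show ?thesis .
      qed
      then show "2 * r * (v \<bullet> (g j t - g i s)) \<le> (norm (g j t - g i s))\<^sup>2" by (simp add: a_def)
    qed
    obtain i' s' j' t' where zz: "z = ((i', s'), (j', t'))" by (metis surj_pair)
    have ij': "i' < m" "j' < m" using z(1) by (auto simp: A_def D_def zz)
    define a where "a = g j' t' - g i' s'"
    have a0: "norm a > 0" using pos[OF z(1)] by (simp add: zz c_def a_def)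
    have eq: "(norm a)\<^sup>2 = 2 * r * norm (a - (a \<bullet> sgn (ltan g i' s')) *\<^sub>R sgn (ltan g i' s'))"
    proof -
      have "f z = norm (a - (a \<bullet> sgn (ltan g i' s')) *\<^sub>R sgn (ltan g i' s')) / (norm a)\<^sup>2"
        by (simp add: f_def n_def zz c_def \<tau>_def a_def)
      then have "norm (a - (a \<bullet> sgn (ltan g i' s')) *\<^sub>R sgn (ltan g i' s')) = f z * (norm a)\<^sup>2"
        using a0 by (simp add: field_simps)
      then show ?thesis using fz0 by (simp add: r_def)
    qed
    have "crit_pair g i' s' j' t' \<and> norm a = 2 * r"
      by (rule touching_ball_crit_pair[OF lk r(1) _ cv tb ij' a_def _ refl eq]) (use r r1 a0 in auto)
    then show False using crit[OF ij', of s' t'] r r1 by (simp add: a_def)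
  qed
  show ?thesis
    unfolding avoids_tangent_balls_def
  proof (intro allI impI)
    fix i j s t v assume ij: "i < m" "j < m" and v: "norm v = 1 \<and> v \<bullet> ltan g i s = 0"
    define x where "x = v \<bullet> (g j t - g i s)"
    define y where "y = (norm (g j t - g i s))\<^sup>2"
    have *: "2 * r * x \<le> y" if "0 < r" "r < rho" for r
      using main[OF that] ij v unfolding avoids_tangent_balls_def x_def y_def by blast
    have "((\<lambda>r. 2 * r * x) \<longlongrightarrow> 2 * rho * x) (at_left rho)" by (intro tendsto_intros)
    moreover have "\<forall>\<^sub>F r in at_left rho. 2 * r * x \<le> y"
      using eventually_at_left_real[OF rho] by eventually_elim (use * in auto)
    ultimately have "2 * rho * x \<le> y" by (intro tendsto_upperbound[where F = "at_left rho"]) auto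
    then show "2 * rho * (v \<bullet> (g j t - g i s)) \<le> (norm (g j t - g i s))\<^sup>2" by (simp add: x_def y_def)
  qed
qed

section \<open>Critical pairs of C^1-close links\<close>

definition C1_close :: "real \<Rightarrow> nat \<Rightarrow> (nat \<Rightarrow> real \<Rightarrow> 'a::euclidean_space) \<Rightarrow> (nat \<Rightarrow> real \<Rightarrow> 'a) \<Rightarrow> bool" where
  "C1_close e m g h \<longleftrightarrow> (\<forall>i<m. \<forall>t. norm (h i t - g i t) < e \<and> norm (ltan h i t - ltan g i t) < e)"

text \<open>Points that are close on \<open>g\<close> are joined by a short arc. Along such an arc
  the tangent of every C^1-close \<open>h\<close> keeps a positive component in its initial
  direction, so the chord cannot be orthogonal to the tangent. The size of the neighbourhood depends
  on \<open>g\<close> only.\<close>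

lemma near_not_crit_pair:
  assumes lk: "is_link m g"
  shows "\<exists>d>0. \<forall>h i j s t. is_link m h \<and> C1_close d m g h \<and> i < m \<and> j < m \<and>
     norm (g i s - g j t) < d \<longrightarrow> \<not> crit_pair h i s j t"
proof -
  obtain a b where ab: "0 < a" "\<And>i t. i < m \<Longrightarrow> a \<le> norm (ltan g i t)"
    using speed_bounds[OF lk] by metis
  have "\<exists>d>0. \<forall>s t. \<bar>s - t\<bar> < d \<longrightarrow> norm (ltan g i s - ltan g i t) < a / 4" if i: "i < m" for i
  proof -
    have "uniformly_continuous_on {-1..2} (ltan g i)"
      by (intro compact_uniformly_continuous continuous_on_subset[OF ltan_cont[OF lk i]]) auto
    then obtain d where d: "d > 0" "\<And>x y. x \<in> {-1..2} \<Longrightarrow> y \<in> {-1..2} \<Longrightarrow> \<bar>y - x\<bar> < d \<Longrightarrow> norm (ltan g i y - ltan g i x) < a / 4"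
      unfolding uniformly_continuous_on_def using ab(1)
      by (metis dist_norm real_norm_def zero_less_divide_iff zero_less_numeral)
    have "norm (ltan g i s - ltan g i t) < a / 4" if "\<bar>s - t\<bar> < min d 1" for s t
    proof -
      obtain k where k: "t + of_int k \<in> {0..<1::real}" by (rule unit_interval_reduce[OF lk])
      have "norm (ltan g i (s + of_int k) - ltan g i (t + of_int k)) < a / 4"
        using that k by (intro d(2)) auto
      then show ?thesis by (simp only: ltan_periodic_int[OF lk i])
    qed
    then show ?thesis using d(1) by (intro exI[of _ "min d 1"]) auto
  qed
  then have "\<exists>d>0. \<forall>i<m. \<forall>s t. \<bar>s - t\<bar> < d \<longrightarrow> norm (ltan g i s - ltan g i t) < a / 4"
    by (rule finite_min_pos) auto
  then obtain d1 where d1: "d1 > 0" "\<And>i s t. i < m \<Longrightarrow> \<bar>s - t\<bar> < d1 \<Longrightarrow> norm (ltan g i s - ltan g i t) < a / 4" by blast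
  obtain d2 where d2: "d2 > 0" "\<And>i j s t. i < m \<Longrightarrow> j < m \<Longrightarrow> norm (g i s - g j t) < d2 \<Longrightarrow> i = j \<and> (\<exists>k::int. \<bar>s - (t + of_int k)\<bar> < d1)"
    using link_close_params[OF lk d1(1)] by metis
  define d where "d = min d2 (a / 8)"
  have "\<not> crit_pair h i s j t" if lh: "is_link m h" and cl: "C1_close d m g h" and ij: "i < m" "j < m" and near: "norm (g i s - g j t) < d" for h i j s t
  proof
    assume crit: "crit_pair h i s j t"
    obtain k :: int where eq: "i = j" and k: "\<bar>s - (t + of_int k)\<bar> < d1"
      using d2(2)[OF ij] near by (auto simp: d_def)
    define t' where "t' = t + of_int k"
    have ht: "h j t = h i t'" using eq ij by (simp add: t'_def link_periodic_int[OF lh])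
    have "s \<noteq> t'" using crit by (auto simp: crit_pair_def ht)
    \<comment> \<open>Two deviations below \<open>a / 8\<close> between \<open>h\<close> and
      \<open>g\<close> and one below \<open>a / 4\<close> along \<open>g\<close> add up to less than
      \<open>a / 2\<close>, whereas the speed of \<open>h\<close> exceeds
      \<open>a / 2\<close>.\<close>
    have ip: "ltan h i s \<bullet> ltan h i y > 0" if y: "\<bar>y - s\<bar> < d1" for y
    proof -
      have "norm (ltan h i y - ltan h i s) \<le> norm (ltan h i y - ltan g i y) + norm (ltan g i y - ltan g i s) + norm (ltan h i s - ltan g i s)"
        using norm_triangle_ineq[of "ltan h i y - ltan g i y" "ltan g i y - ltan h i s"]
          norm_triangle_ineq[of "ltan g i y - ltan g i s" "ltan g i s - ltan h i s"] by (simp add: norm_minus_commute)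
      also have "\<dots> < a / 8 + a / 4 + a / 8"
        using cl ij(1) d1(2)[OF ij(1) y] unfolding C1_close_def d_def by (smt (verit) min.strict_boundedE)
      finally have 1: "norm (ltan h i y - ltan h i s) < a / 2" by simp
      have "norm (ltan h i s - ltan g i s) < a / 8" using cl ij(1) unfolding C1_close_def d_def by simp
      then have 2: "norm (ltan h i s) > a / 2"
        using ab(2)[OF ij(1), of s] norm_triangle_ineq2[of "ltan g i s" "ltan h i s"] ab(1) by (simp add: norm_minus_commute)
      have "\<bar>ltan h i s \<bullet> (ltan h i y - ltan h i s)\<bar> \<le> norm (ltan h i s) * norm (ltan h i y - ltan h i s)"
        by (rule Cauchy_Schwarz_ineq2)
      also have "\<dots> < norm (ltan h i s) * norm (ltan h i s)"
        using 1 2 ab(1) by (intro mult_strict_left_mono) auto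
      also have "\<dots> = ltan h i s \<bullet> ltan h i s" by (simp add: dot_square_norm power2_eq_square)
      finally show ?thesis by (simp add: inner_diff_right)
    qed
    define f where "f y = ltan h i s \<bullet> (h i y - h i s)" for y
    have f': "(f has_real_derivative (ltan h i s \<bullet> ltan h i y)) (at y)" for y
      unfolding f_def by (rule has_vector_derivative_inner_right[OF link_deriv[OF lh ij(1)]])
    have "f t' \<noteq> f s"
    proof (cases "s < t'")
      case True
      then have "f s < f t'"
        by (rule DERIV_pos_imp_increasing) (use f' ip k in \<open>force simp: t'_def\<close>)
      then show ?thesis by simp
    next
      case False
      then have "t' < s" using \<open>s \<noteq> t'\<close> by simp
      then have "f t' < f s"
        by (rule DERIV_pos_imp_increasing) (use f' ip k in \<open>force simp: t'_def\<close>)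
      then show ?thesis by simp
    qed
    moreover have "f t' = 0" using crit by (simp add: f_def crit_pair_def ht inner_commute)
    ultimately show False by (simp add: f_def)
  qed
  moreover have "d > 0" using d2 ab by (simp add: d_def)
  ultimately show ?thesis by blast
qed

lemma crit_pair_dist_pos:
  assumes lk: "is_link m g"
  shows "\<exists>d>0. \<forall>i<m. \<forall>j<m. \<forall>s t. crit_pair g i s j t \<longrightarrow> d \<le> norm (g j t - g i s)"
proof -
  obtain d where d: "d > 0" "\<And>h i j s t. is_link m h \<Longrightarrow> C1_close d m g h \<Longrightarrow> i < m \<Longrightarrow> j < m \<Longrightarrow>
     norm (g i s - g j t) < d \<Longrightarrow> \<not> crit_pair h i s j t" using near_not_crit_pair[OF lk] by metis
  have "C1_close d m g g" using d(1) by (simp add: C1_close_def)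
  then show ?thesis using d lk by (intro exI[of _ d]) (metis not_le_imp_less norm_minus_commute)
qed

text \<open>Curvature and the lengths of critical segments bound the thickness from below, and both
  are controlled for a C^{1,1} link. Hence the ropelength of the given link is finite and its
  thickness can be used as a scale.\<close>

lemma C11_NIR_pos:
  assumes lk: "is_link m g" and C11: "C11_link m g"
  shows "NIR m g > 0"
proof -
  obtain C where C: "curv_le C m g" using C11 by (auto simp: C11_link_iff_curv_le)
  obtain d where d: "d > 0" "\<And>i j s t. i < m \<Longrightarrow> j < m \<Longrightarrow> crit_pair g i s j t \<Longrightarrow> d \<le> norm (g j t - g i s)"
    using crit_pair_dist_pos[OF lk] by blast
  define rho where "rho = min (d / 2) (1 / (\<bar>C\<bar> + 1))"
  have rho: "rho > 0" using d(1) by (simp add: rho_def)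
  have "C \<le> 1 / rho"
  proof -
    have "rho \<le> 1 / (\<bar>C\<bar> + 1)" by (simp add: rho_def)
    then have "rho * (\<bar>C\<bar> + 1) \<le> 1" by (simp add: field_simps)
    then have "\<bar>C\<bar> + 1 \<le> 1 / rho" using rho by (simp add: field_simps)
    then show ?thesis by simp
  qed
  then have cv: "curv_le (1 / rho) m g"
    unfolding curv_le_def
  proof (intro allI impI)
    fix i s t assume i: "i < m" and st: "(s::real) \<le> t"
    have "0 \<le> integral {s..t} (\<lambda>r. norm (ltan g i r))"
      by (intro integral_nonneg integrable_continuous_real continuous_on_norm continuous_on_subset[OF ltan_cont[OF lk i]]) auto
    then have "C * integral {s..t} (\<lambda>r. norm (ltan g i r)) \<le> 1 / rho * integral {s..t} (\<lambda>r. norm (ltan g i r))"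
      by (rule mult_right_mono[OF \<open>C \<le> 1 / rho\<close>])
    moreover have "norm (sgn (ltan g i t) - sgn (ltan g i s)) \<le> C * integral {s..t} (\<lambda>r. norm (ltan g i r))"
      using C i st unfolding curv_le_def by blast
    ultimately show "norm (sgn (ltan g i t) - sgn (ltan g i s)) \<le> 1 / rho * integral {s..t} (\<lambda>r. norm (ltan g i r))"
      by (rule order_trans[rotated])
  qed
  have "avoids_tangent_balls rho m g"
  proof (rule curv_le_imp_avoids_tangent_balls[OF lk rho cv])
    fix i j s t assume "i < m" "j < m" "crit_pair g i s j t"
    then have "d \<le> norm (g j t - g i s)" by (rule d(2))
    then show "2 * rho \<le> norm (g j t - g i s)" by (simp add: rho_def min_def)
  qed
  then show ?thesis using NIR_ge[OF lk rho] rho by simp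
qed

text \<open>The pairs of points of \<open>g\<close> with distance between \<open>d\<close> and
  \<open>R1 < DCSD m g\<close> form a compact set without critical pairs, so the defect
  \<open>F\<close> from orthogonality is at least some \<open>k > 0\<close> there. A critical pair
  of a nearby \<open>h\<close> shorter than \<open>2 * R\<close> would give a pair in this set with
  a smaller defect.\<close>

lemma DCSD_lower_semicont:
  assumes lk: "is_link m g" and R: "0 < R" "2 * R < DCSD m g"
  shows "\<exists>e>0. \<forall>h i j s t. is_link m h \<and> C1_close e m g h \<and> i < m \<and> j < m \<and> crit_pair h i s j t
     \<longrightarrow> 2 * R \<le> norm (h j t - h i s)"
proof -
  obtain d where d: "d > 0" "\<And>h i j s t. is_link m h \<Longrightarrow> C1_close d m g h \<Longrightarrow> i < m \<Longrightarrow> j < m \<Longrightarrow>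
     norm (g i s - g j t) < d \<Longrightarrow> \<not> crit_pair h i s j t" using near_not_crit_pair[OF lk] by metis
  obtain b where b: "0 < b" "\<And>i t. i < m \<Longrightarrow> norm (ltan g i t) \<le> b"
    using speed_bounds[OF lk] by (meson less_le_trans)
  define R1 where "R1 = (2 * R + DCSD m g) / 2"
  have R1: "2 * R < R1" "R1 < DCSD m g" using R by (auto simp: R1_def)
  define D where "D = {..<m} \<times> {0..1::real}"
  define c where "c x = g (fst x) (snd x)" for x :: "nat \<times> real"
  define \<tau> where "\<tau> x = ltan g (fst x) (snd x)" for x :: "nat \<times> real"
  define A where "A = (D \<times> D) \<inter> (\<lambda>z. norm (c (snd z) - c (fst z))) -` {d..R1}"
  define F where "F z = \<bar>(c (snd z) - c (fst z)) \<bullet> \<tau> (fst z)\<bar> + \<bar>(c (snd z) - c (fst z)) \<bullet> \<tau> (snd z)\<bar>" for z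
  have cc: "continuous_on D c" unfolding D_def c_def by (rule link_cont_domain[OF lk])
  have ct: "continuous_on D \<tau>" unfolding D_def \<tau>_def by (rule ltan_cont_domain[OF lk])
  have cD: "compact D" unfolding D_def by (rule compact_link_domain[OF lk])
  have c1: "continuous_on (D \<times> D) (\<lambda>z. c (fst z))" "continuous_on (D \<times> D) (\<lambda>z. c (snd z))"
     "continuous_on (D \<times> D) (\<lambda>z. \<tau> (fst z))" "continuous_on (D \<times> D) (\<lambda>z. \<tau> (snd z))"
    by (rule continuous_on_compose2[OF cc] continuous_on_compose2[OF ct]; auto intro: continuous_on_fst continuous_on_snd)+
  have "closed A" unfolding A_def
    by (rule continuous_closed_preimage) (auto intro!: continuous_intros c1 compact_imp_closed compact_Times cD)
  then have cA: "compact A"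
    using compact_Int_closed[OF compact_Times[OF cD cD], of A] by (simp add: A_def Int_absorb1 Int_assoc[symmetric])
  have AD: "A \<subseteq> D \<times> D" by (auto simp: A_def)
  have "continuous_on A F" unfolding F_def
    by (intro continuous_intros continuous_on_subset[OF c1(1) AD] continuous_on_subset[OF c1(2) AD]
      continuous_on_subset[OF c1(3) AD] continuous_on_subset[OF c1(4) AD])
  moreover have "F z > 0" if z: "z \<in> A" for z
  proof (rule ccontr)
    assume n: "\<not> F z > 0"
    obtain i s j t where zz: "z = ((i, s), (j, t))" by (metis surj_pair)
    have ij: "i < m" "j < m" and r: "d \<le> norm (g j t - g i s)" "norm (g j t - g i s) \<le> R1"
      using z by (auto simp: A_def D_def zz c_def)
    have "crit_pair g i s j t"
      using n r d(1) by (auto simp: F_def zz c_def \<tau>_def crit_pair_def)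
    from DCSD_le_crit[OF ij this] r R1 show False by simp
  qed
  ultimately obtain k where k: "k > 0" "\<And>z. z \<in> A \<Longrightarrow> k \<le> F z"
    using continuous_attains_pos_inf[OF cA] by metis
  \<comment> \<open>The three bounds exclude critical pairs of \<open>h\<close> over points of
    \<open>g\<close> closer than \<open>d\<close>, keep the corresponding distance on
    \<open>g\<close> below \<open>R1\<close>, and keep the defect below \<open>k\<close>.\<close>
  define e where "e = min d (min ((R1 - 2 * R) / 2) (k / (4 * b + 4 * R)))"
  have bR: "4 * b + 4 * R > 0" using b R by simp
  have e: "e > 0" "e \<le> d" "2 * e \<le> R1 - 2 * R" "e * (4 * b + 4 * R) \<le> k"
  proof -
    show "e > 0" using d k R1 bR by (simp add: e_def)
    show "e \<le> d" by (simp add: e_def)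
    have "e \<le> (R1 - 2 * R) / 2" unfolding e_def min_le_iff_disj by (intro disjI2 disjI1 order_refl)
    then show "2 * e \<le> R1 - 2 * R" by simp
    have "e \<le> k / (4 * b + 4 * R)" unfolding e_def min_le_iff_disj by (intro disjI2 order_refl)
    then show "e * (4 * b + 4 * R) \<le> k" using bR by (simp add: pos_le_divide_eq)
  qed
  have "2 * R \<le> norm (h j t - h i s)" if lh: "is_link m h" and cl: "C1_close e m g h" and ij: "i < m" "j < m" and crit: "crit_pair h i s j t" for h i j s t
  proof (rule ccontr)
    assume short: "\<not> 2 * R \<le> norm (h j t - h i s)"
    have cl': "C1_close d m g h" using cl e unfolding C1_close_def by (meson less_le_trans)
    have far: "d \<le> norm (g j t - g i s)" using d(2)[OF lh cl' ij, of s t] crit by (force simp: norm_minus_commute)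
    define x where "x = g j t - g i s"
    define y where "y = h j t - h i s"
    have xy: "norm (x - y) < 2 * e"
    proof -
      have "x - y = (g j t - h j t) + (h i s - g i s)" by (simp add: x_def y_def)
      then have "norm (x - y) \<le> norm (h j t - g j t) + norm (h i s - g i s)"
        using norm_triangle_ineq[of "g j t - h j t" "h i s - g i s"] by (simp add: norm_minus_commute)
      then show ?thesis using cl ij unfolding C1_close_def by (smt (verit))
    qed
    have "norm x \<le> R1" using norm_triangle_ineq2[of x y] xy short e(3) by (simp add: y_def)
    then have xr: "norm x \<in> {d..R1}" using far by (simp add: x_def)
    have tb: "\<bar>x \<bullet> ltan g i' s'\<bar> < e * (2 * b + 2 * R)" if i': "i' < m" and p: "y \<bullet> ltan h i' s' = 0" for i' s'
    proof -
      have "x \<bullet> ltan g i' s' = (x - y) \<bullet> ltan g i' s' + y \<bullet> (ltan g i' s' - ltan h i' s')"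
        by (simp add: inner_diff_left inner_diff_right p)
      moreover have "\<bar>(x - y) \<bullet> ltan g i' s'\<bar> \<le> (2 * e) * b"
        using xy b(2)[OF i', of s'] b e by (intro order_trans[OF Cauchy_Schwarz_ineq2] mult_mono) auto
      moreover have "\<bar>y \<bullet> (ltan g i' s' - ltan h i' s')\<bar> < (2 * R) * e"
      proof -
        have "\<bar>y \<bullet> (ltan g i' s' - ltan h i' s')\<bar> \<le> norm y * norm (ltan g i' s' - ltan h i' s')" by (rule Cauchy_Schwarz_ineq2)
        also have "\<dots> < (2 * R) * e"
          using short cl i' R unfolding C1_close_def y_def[symmetric]
          by (intro mult_strict_mono) (auto simp: norm_minus_commute)
        finally show ?thesis .
      qed
      ultimately show ?thesis by (simp add: algebra_simps abs_less_iff abs_le_iff)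
    qed
    obtain p where p: "s + of_int p \<in> {0..<1::real}" by (rule unit_interval_reduce[OF lk])
    obtain q where q: "t + of_int q \<in> {0..<1::real}" by (rule unit_interval_reduce[OF lk])
    define z where "z = ((i, s + of_int p), (j, t + of_int q))"
    have cz: "c (fst z) = g i s" "c (snd z) = g j t" "\<tau> (fst z) = ltan g i s" "\<tau> (snd z) = ltan g j t"
      by (simp_all add: z_def c_def \<tau>_def link_periodic_int[OF lk] ltan_periodic_int[OF lk] ij)
    have "z \<in> A" using xr p q ij by (auto simp: A_def cz x_def) (auto simp: D_def z_def)
    then have "k \<le> \<bar>x \<bullet> ltan g i s\<bar> + \<bar>x \<bullet> ltan g j t\<bar>" using k(2)[of z] by (simp add: F_def cz x_def)
    also have "\<dots> < e * (2 * b + 2 * R) + e * (2 * b + 2 * R)"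
      using crit by (intro add_strict_mono tb ij) (auto simp: crit_pair_def y_def)
    also have "\<dots> = e * (4 * b + 4 * R)" by (simp add: algebra_simps)
    finally show False using e(4) by simp
  qed
  then show ?thesis using e(1) by blast
qed

section \<open>Ambient isotopy of nearby links\<close>

text \<open>The bound is an explicit parameter because the isotopy needs a field with bound 1/2, so
  constants must be followed through the whole extension.\<close>

definition C1_bounded :: "real \<Rightarrow> ('a::euclidean_space \<Rightarrow> 'b::real_normed_vector) \<Rightarrow> ('a \<Rightarrow> 'a \<Rightarrow>\<^sub>L 'b) \<Rightarrow> bool" where
  "C1_bounded B f f' \<longleftrightarrow> (\<forall>x. (f has_derivative blinfun_apply (f' x)) (at x)) \<and> continuous_on UNIV f' \<and>
     (\<forall>x. norm (f x) \<le> B \<and> norm (f' x) \<le> B)"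

lemma C1_bounded_cont: "C1_bounded B f f' \<Longrightarrow> continuous_on UNIV f"
  unfolding C1_bounded_def by (meson continuous_at_imp_continuous_on has_derivative_continuous)

lemma C1_bounded_add:
  assumes "C1_bounded A f f'" "C1_bounded B g g'"
  shows "C1_bounded (A + B) (\<lambda>x. f x + g x) (\<lambda>x. f' x + g' x)"
  unfolding C1_bounded_def
proof (intro conjI allI)
  fix x
  show "((\<lambda>x. f x + g x) has_derivative blinfun_apply (f' x + g' x)) (at x)"
    using has_derivative_add[of f "blinfun_apply (f' x)" "at x" g "blinfun_apply (g' x)"] assms
    by (simp add: C1_bounded_def blinfun.add_left[abs_def] plus_blinfun.rep_eq)
  show "norm (f x + g x) \<le> A + B" "norm (f' x + g' x) \<le> A + B"
    using assms by (auto simp: C1_bounded_def intro: norm_triangle_mono)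
qed (use assms in \<open>auto simp: C1_bounded_def intro!: continuous_intros\<close>)

lemma C1_bounded_diff:
  assumes "C1_bounded A f f'" "C1_bounded B g g'"
  shows "C1_bounded (A + B) (\<lambda>x. f x - g x) (\<lambda>x. f' x - g' x)"
  unfolding C1_bounded_def
proof (intro conjI allI)
  fix x
  show "((\<lambda>x. f x - g x) has_derivative blinfun_apply (f' x - g' x)) (at x)"
    using has_derivative_diff[of f "blinfun_apply (f' x)" "at x" g "blinfun_apply (g' x)"] assms
    by (simp add: C1_bounded_def minus_blinfun.rep_eq)
  show "norm (f x - g x) \<le> A + B" "norm (f' x - g' x) \<le> A + B"
    using assms norm_triangle_ineq4[of "f x" "g x"] norm_triangle_ineq4[of "f' x" "g' x"]
    unfolding C1_bounded_def by (meson add_mono order_trans)+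
qed (use assms in \<open>auto simp: C1_bounded_def intro!: continuous_intros\<close>)

lemma C1_bounded_scaleR:
  assumes "C1_bounded A c c'" "C1_bounded B f f'"
  shows "C1_bounded (2 * A * B) (\<lambda>x. c x *\<^sub>R f x) (\<lambda>x. c x *\<^sub>R f' x + (blinfun_scaleR_left (f x) o\<^sub>L c' x))"
proof -
  have A: "A \<ge> 0" and B: "B \<ge> 0" using assms unfolding C1_bounded_def by (meson norm_ge_zero order_trans)+
  show ?thesis
    unfolding C1_bounded_def
  proof (intro conjI allI)
    fix x
    have 1: "(c has_derivative blinfun_apply (c' x)) (at x)" "(f has_derivative blinfun_apply (f' x)) (at x)"
      using assms by (auto simp: C1_bounded_def)
    show "((\<lambda>x. c x *\<^sub>R f x) has_derivative blinfun_apply (c x *\<^sub>R f' x + (blinfun_scaleR_left (f x) o\<^sub>L c' x))) (at x)"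
      by (rule has_derivative_eq_rhs[OF has_derivative_scaleR[OF 1]])
        (simp add: fun_eq_iff blinfun.add_left blinfun.scaleR_left)
    have b: "norm (c x) \<le> A" "norm (c' x) \<le> A" "norm (f x) \<le> B" "norm (f' x) \<le> B"
      using assms by (auto simp: C1_bounded_def)
    have AB: "norm (c x) * norm (f x) \<le> A * B" "norm (c x) * norm (f' x) \<le> A * B" "norm (f x) * norm (c' x) \<le> B * A"
      using b A B by (auto intro!: mult_mono)
    then show "norm (c x *\<^sub>R f x) \<le> 2 * A * B"
      using mult_nonneg_nonneg[OF A B] unfolding norm_scaleR mult.assoc real_norm_def[symmetric] by linarith
    have "norm (blinfun_scaleR_left (f x)) \<le> norm (f x)"
      by (rule norm_blinfun_bound) (auto simp: mult.commute)
    then have "norm (blinfun_scaleR_left (f x) o\<^sub>L c' x) \<le> norm (f x) * norm (c' x)"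
      by (meson norm_blinfun_compose mult_right_mono norm_ge_zero order_trans)
    then have "norm (c x *\<^sub>R f' x + (blinfun_scaleR_left (f x) o\<^sub>L c' x)) \<le> A * B + B * A"
      using AB(2,3) by (intro norm_triangle_mono) (simp, linarith)
    then show "norm (c x *\<^sub>R f' x + (blinfun_scaleR_left (f x) o\<^sub>L c' x)) \<le> 2 * A * B" by (simp add: mult.commute[of B A] mult.assoc)
  next
    have "continuous_on UNIV c" "continuous_on UNIV f" using assms by (auto intro: C1_bounded_cont)
    then show "continuous_on UNIV (\<lambda>x. c x *\<^sub>R f' x + (blinfun_scaleR_left (f x) o\<^sub>L c' x))"
      using assms unfolding C1_bounded_def
      by (intro continuous_on_add continuous_on_scaleR bounded_bilinear.continuous_on[OF bounded_bilinear_blinfun_compose]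
          bounded_linear.continuous_on[OF bounded_linear_blinfun_scaleR_left]) auto
  qed
qed

lemma C1_bounded_mono: "C1_bounded A f f' \<Longrightarrow> A \<le> B \<Longrightarrow> C1_bounded B f f'"
  unfolding C1_bounded_def by (meson order_trans)

text \<open>The squared positive part is an elementary C^1 building block for a cutoff
  function.\<close>

lemma pos_part_square_deriv: "((\<lambda>z::real. (max 0 z)\<^sup>2) has_real_derivative 2 * max 0 z) (at z)"
  unfolding has_field_derivative_def has_derivative_at_alt
proof (intro conjI allI impI)
  fix e :: real assume e: "e > 0"
  have *: "\<bar>(max 0 y)\<^sup>2 - (max 0 z)\<^sup>2 - 2 * max 0 z * (y - z)\<bar> \<le> \<bar>y - z\<bar> * \<bar>y - z\<bar>" for y
  proof -
    have sq: "\<bar>y - z\<bar> * \<bar>y - z\<bar> = (y - z)\<^sup>2" by (simp add: power2_eq_square abs_mult[symmetric])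
    consider "0 \<le> y" "0 \<le> z" | "0 \<le> y" "z < 0" | "y < 0" "0 \<le> z" | "y < 0" "z < 0" by linarith
    then show ?thesis
    proof cases
      case 1
      then have "(max 0 y)\<^sup>2 - (max 0 z)\<^sup>2 - 2 * max 0 z * (y - z) = (y - z)\<^sup>2"
        by (simp add: max_def power2_eq_square algebra_simps)
      then show ?thesis unfolding sq by simp
    next
      case 2
      then have "y\<^sup>2 \<le> (y - z)\<^sup>2" by (intro power_mono) auto
      then show ?thesis unfolding sq using 2 by simp
    next
      case 3
      have "(max 0 y)\<^sup>2 - (max 0 z)\<^sup>2 - 2 * max 0 z * (y - z) = (y - z)\<^sup>2 - y\<^sup>2"
        using 3 by (simp add: max_def power2_eq_square algebra_simps)
      moreover have "y\<^sup>2 \<le> (y - z)\<^sup>2"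
        using 3 power_mono[of "- y" "z - y" 2] by (simp add: power2_commute)
      ultimately show ?thesis unfolding sq using zero_le_power2[of y] by linarith
    next
      case 4 then show ?thesis by simp
    qed
  qed
  show "\<exists>d>0. \<forall>y. norm (y - z) < d \<longrightarrow> norm ((max 0 y)\<^sup>2 - (max 0 z)\<^sup>2 - 2 * max 0 z * (y - z)) \<le> e * norm (y - z)"
  proof (intro exI[of _ e] conjI allI impI e)
    fix y assume "norm (y - z) < e"
    then have "\<bar>y - z\<bar> * \<bar>y - z\<bar> \<le> e * \<bar>y - z\<bar>" by (intro mult_right_mono) auto
    then show "norm ((max 0 y)\<^sup>2 - (max 0 z)\<^sup>2 - 2 * max 0 z * (y - z)) \<le> e * norm (y - z)"
      using *[of y] by simp
  qed
qed (rule bounded_linear_mult_right)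

lemma bump_function:
  fixes x0 :: "'a::euclidean_space"
  assumes r: "r > 0"
  shows "\<exists>B c c'. C1_bounded B c c' \<and> (\<forall>x. norm (x - x0) \<le> r / 2 \<longrightarrow> c x = (1::real)) \<and> (\<forall>x. r \<le> norm (x - x0) \<longrightarrow> c x = 0)"
proof -
  \<comment> \<open>Scales \<open>s\<close> so that it is 0 at distance \<open>r / 2\<close> and 1
    at distance \<open>r\<close>.\<close>
  define k where "k = 4 / (3 * r\<^sup>2)"
  have k: "k > 0" using r by (simp add: k_def)
  define s where "s x = k * ((x - x0) \<bullet> (x - x0) - r\<^sup>2 / 4)" for x
  \<comment> \<open>Clipping with squared positive parts twice gives a C^1 function \<open>q\<close>
    with value 1 for \<open>y \<le> 0\<close> and value 0 for \<open>y \<ge> 1\<close>.\<close>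
  define w where "w y = 1 - (max 0 (1 - y))\<^sup>2" for y :: real
  define q where "q y = 1 - (max 0 (w y))\<^sup>2" for y
  define q' where "q' y = - (2 * max 0 (w y) * (2 * max 0 (1 - y)))" for y
  define c where "c x = q (s x)" for x
  define c' where "c' x = (q' (s x) * (2 * k)) *\<^sub>R blinfun_inner_left (x - x0)" for x
  have s_eq: "s x = k * ((norm (x - x0))\<^sup>2 - r\<^sup>2 / 4)" for x by (simp add: s_def power2_norm_eq_inner)
  have s0: "s x \<le> 0" if "norm (x - x0) \<le> r / 2" for x
  proof -
    have "(norm (x - x0))\<^sup>2 \<le> (r / 2)\<^sup>2" using that by (intro power_mono) auto
    then show ?thesis unfolding s_eq using k by (simp add: power_divide mult_nonneg_nonpos)
  qed
  have s1: "s x \<ge> 1" if "r \<le> norm (x - x0)" for x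
  proof -
    have "r\<^sup>2 \<le> (norm (x - x0))\<^sup>2" using that r by (intro power_mono) auto
    then have "k * (3 * r\<^sup>2 / 4) \<le> s x" unfolding s_eq using k by (intro mult_left_mono) auto
    then show ?thesis using r by (simp add: k_def)
  qed
  have s2: "s x \<ge> - 1" for x
  proof -
    have "k * (- (r\<^sup>2 / 4)) \<le> s x" unfolding s_eq using k by (intro mult_left_mono) auto
    then show ?thesis using r by (simp add: k_def)
  qed
  have w1: "w y \<le> 1" for y by (simp add: w_def)
  have q01: "0 \<le> q y" "q y \<le> 1" for y
  proof -
    have "(max 0 (w y))\<^sup>2 \<le> 1" using w1[of y] by (simp add: power_le_one)
    then show "0 \<le> q y" by (simp add: q_def)
  qed (simp add: q_def)
  have q_deriv: "(q has_real_derivative q' y) (at y)" for y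
  proof -
    have a: "((\<lambda>y. (max 0 (1 - y))\<^sup>2) has_real_derivative - (2 * max 0 (1 - y))) (at y)"
    proof -
      have "((\<lambda>y. 1 - y) has_real_derivative -1) (at y)" by (auto intro!: derivative_eq_intros)
      from DERIV_chain2[where f = "\<lambda>z. (max 0 z)\<^sup>2", OF pos_part_square_deriv this] show ?thesis by simp
    qed
    then have "(w has_real_derivative 2 * max 0 (1 - y)) (at y)"
      unfolding w_def using DERIV_diff[OF DERIV_const a, of 1] by simp
    from DERIV_chain2[where f = "\<lambda>z. (max 0 z)\<^sup>2", OF pos_part_square_deriv this]
    have "((\<lambda>y. (max 0 (w y))\<^sup>2) has_real_derivative 2 * max 0 (w y) * (2 * max 0 (1 - y))) (at y)" .
    from DERIV_diff[OF DERIV_const this, of 1] show ?thesis by (simp add: q_def[abs_def] q'_def)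
  qed
  have s_deriv: "(s has_derivative (\<lambda>v. 2 * k * (v \<bullet> (x - x0)))) (at x)" for x
    unfolding s_def
    by (rule derivative_eq_intros refl)+ (simp add: fun_eq_iff inner_commute algebra_simps)
  have c_deriv: "(c has_derivative blinfun_apply (c' x)) (at x)" for x
  proof -
    have "(q has_derivative (\<lambda>h. q' (s x) * h)) (at (s x))" using q_deriv[of "s x"] by (simp add: has_field_derivative_def)
    from has_derivative_compose[OF s_deriv this] show ?thesis
      unfolding c_def[abs_def] by (rule has_derivative_eq_rhs) (simp add: c'_def fun_eq_iff blinfun.scaleR_left)
  qed
  define B where "B = 1 + 16 * k * r"
  have "C1_bounded B c c'"
    unfolding C1_bounded_def
  proof (intro conjI allI c_deriv)
    have "continuous_on UNIV (\<lambda>x. q' (s x))" unfolding q'_def w_def s_def by (intro continuous_intros)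
    then show "continuous_on UNIV c'" unfolding c'_def
      by (intro continuous_intros bounded_linear.continuous_on[OF bounded_linear_blinfun_inner_left])
    fix x
    have kr: "16 * k * r \<ge> 0" using k r by simp
    show "norm (c x) \<le> B" using q01[of "s x"] kr by (simp add: c_def B_def)
    show "norm (c' x) \<le> B"
    proof (cases "r \<le> norm (x - x0)")
      case True
      then show ?thesis using s1[OF True] kr by (simp add: c'_def q'_def B_def)
    next
      case False
      have n: "norm (blinfun_inner_left (x - x0)) \<le> r"
      proof (rule norm_blinfun_bound)
        fix v
        have "\<bar>v \<bullet> (x - x0)\<bar> \<le> norm v * norm (x - x0)" by (rule Cauchy_Schwarz_ineq2)
        also have "\<dots> \<le> norm v * r" using False by (intro mult_left_mono) auto
        finally show "norm (blinfun_apply (blinfun_inner_left (x - x0)) v) \<le> r * norm v" by (simp add: mult.commute)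
      qed (use r in simp)
      have "\<bar>q' (s x)\<bar> \<le> 2 * 1 * (2 * 2)"
        unfolding q'_def abs_minus abs_mult using w1[of "s x"] s2[of x] by (intro mult_mono) auto
      then have "\<bar>q' (s x)\<bar> * (2 * k) \<le> 8 * (2 * k)" using k by (intro mult_right_mono) auto
      then have "\<bar>q' (s x) * (2 * k)\<bar> \<le> 16 * k" using k by (simp add: abs_mult)
      then have "\<bar>q' (s x) * (2 * k)\<bar> * norm (blinfun_inner_left (x - x0)) \<le> (16 * k) * r"
        using n k by (intro mult_mono) auto
      then show ?thesis by (simp add: c'_def B_def)
    qed
  qed
  moreover have "c x = 1" if "norm (x - x0) \<le> r / 2" for x
  proof -
    have "(1 - s x)\<^sup>2 \<ge> 1\<^sup>2" using s0[OF that] by (intro power_mono) auto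
    then have "w (s x) \<le> 0" using s0[OF that] by (simp add: w_def max_absorb2)
    then show ?thesis by (simp add: c_def q_def max_absorb1)
  qed
  moreover have "c x = 0" if "r \<le> norm (x - x0)" for x
    using s1[OF that] by (simp add: c_def q_def w_def)
  ultimately show ?thesis by blast
qed

section \<open>Extension of vector fields from the link to the whole space\<close>

definition link_field :: "nat \<Rightarrow> real \<Rightarrow> (nat \<Rightarrow> real \<Rightarrow> 'a::euclidean_space) \<Rightarrow> (nat \<Rightarrow> real \<Rightarrow> 'a) \<Rightarrow> bool" where
  "link_field m e D D' \<longleftrightarrow> (\<forall>i<m. continuous_on UNIV (D' i) \<and> (\<forall>t. D i (t + 1) = D i t \<and>
     (D i has_vector_derivative D' i t) (at t) \<and> norm (D i t) \<le> e \<and> norm (D' i t) \<le> e))"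

text \<open>The constant \<open>A\<close> is chosen before the field, so that small fields along the
  link have small extensions.\<close>

definition extension_set :: "nat \<Rightarrow> (nat \<Rightarrow> real \<Rightarrow> 'a::euclidean_space) \<Rightarrow> 'a set \<Rightarrow> bool" where
  "extension_set m g U \<longleftrightarrow> (\<exists>A\<ge>0. \<forall>e (D :: nat \<Rightarrow> real \<Rightarrow> 'a) D'. e \<ge> 0 \<longrightarrow> link_field m e D D' \<longrightarrow>
     (\<exists>f f'. C1_bounded (A * e) f f' \<and> (\<forall>i<m. \<forall>t. g i t \<in> U \<longrightarrow> f (g i t) = D i t)))"

lemma extension_setE:
  fixes g :: "nat \<Rightarrow> real \<Rightarrow> 'a::euclidean_space"
  assumes "extension_set m g U"
  obtains A where "A \<ge> 0" "\<And>e (D :: nat \<Rightarrow> real \<Rightarrow> 'a) D'. e \<ge> 0 \<Longrightarrow> link_field m e D D' \<Longrightarrow>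
     (\<exists>f f'. C1_bounded (A * e) f f' \<and> (\<forall>i<m. \<forall>t. g i t \<in> U \<longrightarrow> f (g i t) = D i t))"
proof -
  from assms[unfolded extension_set_def]
  obtain A where A: "A \<ge> 0" "\<forall>e (D :: nat \<Rightarrow> real \<Rightarrow> 'a) D'. e \<ge> 0 \<longrightarrow> link_field m e D D' \<longrightarrow>
     (\<exists>f f'. C1_bounded (A * e) f f' \<and> (\<forall>i<m. \<forall>t. g i t \<in> U \<longrightarrow> f (g i t) = D i t))"
    by (elim exE conjE)
  show ?thesis by (rule that[OF A(1)]) (use A(2) in blast)
qed

text \<open>Near \<open>g j t0\<close> the coordinate of a point along the tangent \<open>T0\<close>
  determines the parameter on the curve, and the field is extended constantly in the directions
  orthogonal to \<open>T0\<close>. The ball is so small that only the strand with parameters near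
  \<open>t0\<close> meets it.\<close>

lemma chart_extension:
  fixes g :: "nat \<Rightarrow> real \<Rightarrow> 'a::euclidean_space"
  assumes lk: "is_link m g" and j: "j < m"
  shows "\<exists>r>0. extension_set m g (ball (g j t0) r)"
proof -
  define T0 where "T0 = ltan g j t0"
  define x0 where "x0 = g j t0"
  define c where "c = (norm T0)\<^sup>2 / 2"
  have T0: "T0 \<noteq> 0" using ltan_nonzero[OF lk j] by (simp add: T0_def)
  have c: "c > 0" using T0 by (simp add: c_def)
  have lc: "continuous_on UNIV (\<lambda>t. ltan g j t \<bullet> T0)" by (intro continuous_intros ltan_cont[OF lk j])
  have "open {t. c < ltan g j t \<bullet> T0}" by (rule open_Collect_less) (use lc in auto)
  moreover have "t0 \<in> {t. c < ltan g j t \<bullet> T0}" using T0 by (simp add: c_def T0_def[symmetric] dot_square_norm)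
  ultimately obtain d where d0: "d > 0" "cball t0 d \<subseteq> {t. c < ltan g j t \<bullet> T0}"
    using open_contains_cball by blast
  have d: "d > 0" "\<And>t. \<bar>t - t0\<bar> \<le> d \<Longrightarrow> c < ltan g j t \<bullet> T0"
    using d0 by (auto simp: dist_real_def abs_minus_commute subset_iff)
  define p where "p t = ltan g j (max (t0 - d) (min t (t0 + d))) \<bullet> T0" for t
  have pc: "continuous_on UNIV p"
    unfolding p_def by (rule continuous_on_compose2[OF lc]) (auto intro!: continuous_intros)
  have p_ge: "c \<le> p t" for t
    unfolding p_def by (rule less_imp_le[OF d(2)]) (use d(1) in \<open>auto simp: max_def min_def\<close>)
  have p_eq: "p t = ltan g j t \<bullet> T0" if "\<bar>t - t0\<bar> \<le> d" for t
    using that by (simp add: p_def max_def min_def abs_le_iff)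
  have "p integrable_on {a..b}" for a b
    by (rule integrable_continuous_real[OF continuous_on_subset[OF pc]]) auto
  then obtain F0 where F0: "indef_integral F0 p" using indef_integral_exists[of p] by metis
  define F where "F t = F0 t - F0 t0" for t
  have F': "(F has_real_derivative p t) (at t)" for t
  proof -
    have "isCont p t" using pc by (simp add: continuous_on_eq_continuous_at)
    from indef_integral_deriv[OF F0 this] have "(F0 has_real_derivative p t) (at t)"
      by (simp add: has_real_derivative_iff_has_vector_derivative)
    from DERIV_diff[OF this DERIV_const] show ?thesis by (simp add: F_def[abs_def])
  qed
  have Fexp: "c * (t - s) \<le> F t - F s" if "s \<le> t" for s t
    by (rule deriv_ge_imp_diff_ge[OF that F']) (rule p_ge)
  have Fc: "continuous_on UNIV F" using F' by (meson DERIV_isCont continuous_at_imp_continuous_on)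
  obtain I where I: "\<And>y. F (I y) = y" "\<And>x. I (F x) = x" "\<And>x y. \<bar>I y - I x\<bar> \<le> \<bar>y - x\<bar> / c" "strict_mono F"
    using expanding_inverse[OF c Fexp Fc] by metis
  have Ic: "continuous_on UNIV I"
  proof -
    have "(1/c)-lipschitz_on UNIV I" using I(3) c by (auto intro!: lipschitz_onI simp: dist_real_def abs_minus_commute)
    then show ?thesis by (rule lipschitz_on_continuous_on)
  qed
  have I': "(I has_real_derivative inverse (p (I y))) (at y)" for y
  proof (rule DERIV_inverse_function[where f = F and a = "y - 1" and b = "y + 1"])
    show "p (I y) \<noteq> 0" using p_ge[of "I y"] c by simp
    show "isCont I y" using Ic by (simp add: continuous_on_eq_continuous_at)
  qed (use F' I in auto)
  have F_eq: "F t = (g j t - x0) \<bullet> T0" if t: "\<bar>t - t0\<bar> \<le> d" for t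
  proof -
    have gd: "((\<lambda>y. T0 \<bullet> (g j y - x0)) has_real_derivative (T0 \<bullet> ltan g j y)) (at y)" for y
      by (rule has_vector_derivative_inner_right[OF link_deriv[OF lk j]])
    have "((\<lambda>y. F y - T0 \<bullet> (g j y - x0)) has_derivative (\<lambda>h. 0)) (at y within {t0 - d..t0 + d})"
      if "y \<in> {t0 - d..t0 + d}" for y
    proof -
      have "p y = T0 \<bullet> ltan g j y" using that by (subst p_eq) (auto simp: inner_commute)
      then have "((\<lambda>y. F y - T0 \<bullet> (g j y - x0)) has_real_derivative 0) (at y)"
        using DERIV_diff[OF F' gd, of y] by simp
      then show ?thesis by (auto simp: has_field_derivative_def lambda_zero intro: has_derivative_at_withinI)
    qed
    from has_derivative_zero_constant[OF convex_real_interval(5) this] t d(1)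
    have "F t0 - T0 \<bullet> (g j t0 - x0) = F t - T0 \<bullet> (g j t - x0)" by (force simp: abs_le_iff)
    then show ?thesis by (simp add: F_def x0_def inner_commute)
  qed
  obtain r where r: "r > 0" "\<And>i i' s t. i < m \<Longrightarrow> i' < m \<Longrightarrow> norm (g i s - g i' t) < r \<Longrightarrow> i = i' \<and> (\<exists>k::int. \<bar>s - (t + of_int k)\<bar> < d)"
    using link_close_params[OF lk d(1)] by metis
  define A where "A = 1 + norm T0 / c"
  have A: "A \<ge> 0" using c by (simp add: A_def add_nonneg_nonneg)
  have "\<exists>f f'. C1_bounded (A * e) f f' \<and> (\<forall>i<m. \<forall>t. g i t \<in> ball x0 r \<longrightarrow> f (g i t) = D i t)"
    if e: "e \<ge> 0" and D: "link_field m e D D'" for e and D :: "nat \<Rightarrow> real \<Rightarrow> 'a" and D'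
  proof -
    have Dj: "continuous_on UNIV (D' j)" "\<And>t. D j (t + 1) = D j t" "\<And>t. (D j has_vector_derivative D' j t) (at t)"
      "\<And>t. norm (D j t) \<le> e" "\<And>t. norm (D' j t) \<le> e"
      using D j unfolding link_field_def by auto
    define y where "y x = (x - x0) \<bullet> T0" for x
    define f where "f x = D j (I (y x))" for x
    define f' where "f' x = blinfun_scaleR_left (inverse (p (I (y x))) *\<^sub>R D' j (I (y x))) o\<^sub>L blinfun_inner_left T0" for x
    have "C1_bounded (A * e) f f'"
      unfolding C1_bounded_def
    proof (intro conjI allI)
      fix x
      have "(D j \<circ> I has_vector_derivative inverse (p (I (y x))) *\<^sub>R D' j (I (y x))) (at (y x))"
        using I'[of "y x"] by (intro vector_diff_chain_at Dj) (simp add: has_real_derivative_iff_has_vector_derivative)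
      then have 1: "((\<lambda>z. D j (I z)) has_derivative (\<lambda>h. h *\<^sub>R (inverse (p (I (y x))) *\<^sub>R D' j (I (y x))))) (at (y x))"
        by (simp add: has_vector_derivative_def o_def)
      have "(y has_derivative (\<lambda>v. v \<bullet> T0)) (at x)"
        unfolding y_def by (auto intro!: derivative_eq_intros)
      from has_derivative_compose[OF this 1]
      show "(f has_derivative blinfun_apply (f' x)) (at x)"
        unfolding f_def[abs_def] by (rule has_derivative_eq_rhs) (simp add: f'_def fun_eq_iff)
      have "0 \<le> (norm T0 / c) * e" using c e by simp
      then show "norm (f x) \<le> A * e" using Dj(4)[of "I (y x)"] by (simp add: f_def A_def algebra_simps)
      show "norm (f' x) \<le> A * e"
      proof (rule norm_blinfun_bound)
        show "0 \<le> A * e" using A e by simp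
        fix v
        have "norm (blinfun_apply (f' x) v) = \<bar>v \<bullet> T0\<bar> * (inverse (p (I (y x))) * norm (D' j (I (y x))))"
          using p_ge[of "I (y x)"] c by (simp add: f'_def abs_mult)
        also have "\<dots> \<le> (norm v * norm T0) * (inverse c * e)"
          using p_ge[of "I (y x)"] c e Dj(5)
          by (intro mult_mono Cauchy_Schwarz_ineq2 le_imp_inverse_le) auto
        also have "\<dots> = (norm T0 / c * e) * norm v" by (simp add: divide_inverse mult_ac)
        also have "\<dots> \<le> (A * e) * norm v" using e by (intro mult_right_mono) (auto simp: A_def)
        finally show "norm (blinfun_apply (f' x) v) \<le> A * e * norm v" .
      qed
    next
      have yc: "continuous_on UNIV y" unfolding y_def by (intro continuous_intros)
      have Iy: "continuous_on UNIV (\<lambda>x. I (y x))" by (rule continuous_on_compose2[OF Ic yc]) simp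
      have "continuous_on UNIV (\<lambda>x. D' j (I (y x)))" "continuous_on UNIV (\<lambda>x. p (I (y x)))"
        by (rule continuous_on_compose2[OF Dj(1) Iy], simp, rule continuous_on_compose2[OF pc Iy], simp)
      moreover have "p (I (y x)) \<noteq> 0" for x using p_ge[of "I (y x)"] c by simp
      ultimately show "continuous_on UNIV f'"
        unfolding f'_def
        by (intro bounded_bilinear.continuous_on[OF bounded_bilinear_blinfun_compose]
          bounded_linear.continuous_on[OF bounded_linear_blinfun_scaleR_left] continuous_intros) auto
    qed
    moreover have "f (g i t) = D i t" if i: "i < m" and b: "g i t \<in> ball x0 r" for i t
    proof -
      have "norm (g i t - g j t0) < r" using b by (simp add: x0_def dist_norm norm_minus_commute)
      from r(2)[OF i j this] obtain k :: int where ij: "i = j" and k: "\<bar>t - (t0 + of_int k)\<bar> < d" by blast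
      define t' where "t' = t + of_int (- k)"
      have t': "\<bar>t' - t0\<bar> \<le> d" using k by (simp add: t'_def)
      have "f (g i t) = D j (I ((g j t' - x0) \<bullet> T0))"
        unfolding f_def y_def t'_def ij link_periodic_int[OF lk j] ..
      also have "\<dots> = D j t'" using F_eq[OF t'] I(2) by metis
      also have "\<dots> = D i t" using periodic_of_int[of "D j" 1 t "- k"] Dj(2) by (simp add: t'_def ij)
      finally show ?thesis .
    qed
    ultimately show ?thesis by blast
  qed
  then have "extension_set m g (ball x0 r)" unfolding extension_set_def using A by blast
  then show ?thesis using r(1) by (auto simp: x0_def)
qed

text \<open>With a bump function \<open>c\<close> the field \<open>f + c (h - f)\<close> switches from \<open>f\<close> to \<open>h\<close>. Along the link
  nothing is lost in the transition region, since there both agree with the given field.\<close>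

lemma extension_set_Un:
  fixes g :: "nat \<Rightarrow> real \<Rightarrow> 'a::euclidean_space"
  assumes U: "extension_set m g U" and V: "extension_set m g (ball x0 r)" and r: "r > 0"
  shows "extension_set m g (U \<union> ball x0 (r / 2))"
proof -
  obtain A where A: "A \<ge> 0" "\<And>e (D :: nat \<Rightarrow> real \<Rightarrow> 'a) D'. e \<ge> 0 \<Longrightarrow> link_field m e D D' \<Longrightarrow>
     (\<exists>f f'. C1_bounded (A * e) f f' \<and> (\<forall>i<m. \<forall>t. g i t \<in> U \<longrightarrow> f (g i t) = D i t))"
    by (rule extension_setE[OF U], rule that; assumption)
  obtain B where B: "B \<ge> 0" "\<And>e (D :: nat \<Rightarrow> real \<Rightarrow> 'a) D'. e \<ge> 0 \<Longrightarrow> link_field m e D D' \<Longrightarrow>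
     (\<exists>f f'. C1_bounded (B * e) f f' \<and> (\<forall>i<m. \<forall>t. g i t \<in> ball x0 r \<longrightarrow> f (g i t) = D i t))"
    by (rule extension_setE[OF V], rule that; assumption)
  obtain K c c' where c: "C1_bounded K c c'" "\<And>x. norm (x - x0) \<le> r / 2 \<Longrightarrow> c x = (1::real)" "\<And>x. r \<le> norm (x - x0) \<Longrightarrow> c x = 0"
    using bump_function[OF r, of x0] by blast
  have K: "K \<ge> 0" using c(1) unfolding C1_bounded_def by (meson norm_ge_zero order_trans)
  have "\<exists>f f'. C1_bounded ((A + 2 * K * (B + A)) * e) f f' \<and> (\<forall>i<m. \<forall>t. g i t \<in> U \<union> ball x0 (r / 2) \<longrightarrow> f (g i t) = D i t)"
    if e: "e \<ge> 0" and D: "link_field m e D D'" for e and D :: "nat \<Rightarrow> real \<Rightarrow> 'a" and D'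
  proof -
    obtain f f' where f: "C1_bounded (A * e) f f'" "\<And>i t. i < m \<Longrightarrow> g i t \<in> U \<Longrightarrow> f (g i t) = D i t"
      using A(2)[OF e D] by blast
    obtain h h' where h: "C1_bounded (B * e) h h'" "\<And>i t. i < m \<Longrightarrow> g i t \<in> ball x0 r \<Longrightarrow> h (g i t) = D i t"
      using B(2)[OF e D] by blast
    define F where "F x = f x + c x *\<^sub>R (h x - f x)" for x
    obtain F' where "C1_bounded (A * e + 2 * K * (B * e + A * e)) F F'"
      using C1_bounded_add[OF f(1) C1_bounded_scaleR[OF c(1) C1_bounded_diff[OF h(1) f(1)]]] unfolding F_def by blast
    then have "C1_bounded ((A + 2 * K * (B + A)) * e) F F'" by (simp add: algebra_simps)
    moreover have "F (g i t) = D i t" if i: "i < m" and t: "g i t \<in> U \<union> ball x0 (r / 2)" for i t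
    proof (cases "norm (g i t - x0) < r")
      case True
      then have hD: "h (g i t) = D i t" using h(2)[OF i] by (simp add: dist_norm norm_minus_commute)
      show ?thesis
      proof (cases "g i t \<in> U")
        case True then show ?thesis using hD f(2)[OF i] by (simp add: F_def)
      next
        case False
        then have "c (g i t) = 1" using t by (intro c(2)) (simp add: dist_norm norm_minus_commute)
        then show ?thesis using hD by (simp add: F_def)
      qed
    next
      case False
      then have "g i t \<in> U" using t r by (auto simp: dist_norm norm_minus_commute)
      then show ?thesis using c(3)[of "g i t"] False f(2)[OF i] by (simp add: F_def)
    qed
    ultimately show ?thesis by blast
  qed
  moreover have "A + 2 * K * (B + A) \<ge> 0" using A(1) B(1) K by simp
  ultimately show ?thesis unfolding extension_set_def by blast
qed

lemma link_extension_set: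
  assumes lk: "is_link m g"
  shows "extension_set m g (link_image m g)"
proof -
  have "\<exists>r>0. extension_set m g (ball x r)" if "x \<in> link_image m g" for x
    using chart_extension[OF lk] that unfolding link_image_def by auto
  then obtain r where r: "\<And>x. x \<in> link_image m g \<Longrightarrow> r x > 0" "\<And>x. x \<in> link_image m g \<Longrightarrow> extension_set m g (ball x (r x))" by metis
  obtain C where C: "C \<subseteq> link_image m g" "finite C" "link_image m g \<subseteq> (\<Union>x\<in>C. ball x (r x / 2))"
    by (rule compactE_image[OF compact_link_image[OF lk], of "link_image m g" "\<lambda>x. ball x (r x / 2)"]) (use r(1) in auto)
  have "extension_set m g (\<Union>x\<in>C. ball x (r x / 2))"
    using C(2,1)
  proof (induction C rule: finite_induct)
    case empty
    have "C1_bounded (0 * e) (\<lambda>x. 0) (\<lambda>x. 0)" for e by (simp add: C1_bounded_def zero_blinfun.rep_eq)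
    then show ?case unfolding extension_set_def by (intro exI[of _ 0]) auto
  next
    case (insert x C)
    then have "extension_set m g ((\<Union>x\<in>C. ball x (r x / 2)) \<union> ball x (r x / 2))"
      by (intro extension_set_Un r) auto
    then show ?case by (simp add: Un_commute)
  qed
  then show ?thesis using C(3) unfolding extension_set_def by (meson subsetD)
qed

text \<open>\<open>f\<close> is Lipschitz with constant 1/2, so every
  \<open>x + t *\<^sub>R f x\<close> is a perturbation of the identity by a contraction: injective,
  surjective by Banach's fixed point theorem, and with injective derivative.\<close>

lemma small_field_ambient_isotopy:
  fixes f :: "'a::euclidean_space \<Rightarrow> 'a"
  assumes f: "C1_bounded (1/2) f f'"
  shows "C1_ambient_isotopy (\<lambda>t x. x + t *\<^sub>R f x)" "bij (\<lambda>x. x + f x)"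
proof -
  have f'b: "norm (f' x) \<le> 1 / 2" and fd: "(f has_derivative blinfun_apply (f' x)) (at x)" for x
    using f by (auto simp: C1_bounded_def)
  have lip: "norm (f x - f y) \<le> 1 / 2 * norm (x - y)" for x y
  proof (rule differentiable_bound[of UNIV])
    show "(f has_derivative blinfun_apply (f' x)) (at x within UNIV)" for x using fd by simp
    show "onorm (blinfun_apply (f' x)) \<le> 1 / 2" for x using f'b[of x] by (simp add: norm_blinfun.rep_eq)
  qed auto
  have tl: "norm (t *\<^sub>R f x - t *\<^sub>R f y) \<le> 1 / 2 * norm (x - y)" if "t \<in> {0..1}" for t x y
  proof -
    have "norm (t *\<^sub>R f x - t *\<^sub>R f y) = t * norm (f x - f y)" using that by (simp add: scaleR_diff_right[symmetric])
    also have "\<dots> \<le> 1 * norm (f x - f y)" using that by (intro mult_right_mono) auto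
    finally show ?thesis using lip[of x y] by simp
  qed
  have bij: "bij (\<lambda>x. x + t *\<^sub>R f x)" if t: "t \<in> {0..1}" for t
  proof (rule bijI)
    show "inj (\<lambda>x. x + t *\<^sub>R f x)"
    proof (rule injI)
      fix x y assume "x + t *\<^sub>R f x = y + t *\<^sub>R f y"
      then have "x - y = - (t *\<^sub>R f x - t *\<^sub>R f y)" by (simp add: algebra_simps)
      then have "norm (x - y) \<le> 1 / 2 * norm (x - y)" using tl[OF t, of x y] by (metis norm_minus_cancel)
      then show "x = y" by simp
    qed
    show "surj (\<lambda>x. x + t *\<^sub>R f x)"
      unfolding surj_def
    proof
      fix y
      have "\<forall>x z. dist (y - t *\<^sub>R f x) (y - t *\<^sub>R f z) \<le> 1 / 2 * dist x z"
        using tl[OF t] by (simp add: dist_norm norm_minus_commute)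
      then have "\<exists>!x. y - t *\<^sub>R f x = x" by (intro banach_fix_type[where c = "1/2"]) auto
      then obtain x where "y - t *\<^sub>R f x = x" by blast
      then have "y = x + t *\<^sub>R f x" by (simp add: algebra_simps)
      then show "\<exists>x. y = x + t *\<^sub>R f x" by blast
    qed
  qed
  from bij[of 1] show "bij (\<lambda>x. x + f x)" by simp
  define DH where "DH t x = id_blinfun + t *\<^sub>R f' x" for t :: real and x
  show "C1_ambient_isotopy (\<lambda>t x. x + t *\<^sub>R f x)"
    unfolding C1_ambient_isotopy_def
  proof (intro conjI exI[of _ DH] ballI allI)
    have fc: "continuous_on UNIV f" by (rule C1_bounded_cont[OF f])
    have f'c: "continuous_on UNIV f'" using f by (simp add: C1_bounded_def)
    have "continuous_on ({0..1} \<times> UNIV) (\<lambda>z. f (snd z))" for S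
      by (rule continuous_on_compose2[OF fc]) (auto intro: continuous_on_snd)
    then show "continuous_on ({0..1} \<times> UNIV) (\<lambda>(t, x). x + t *\<^sub>R f x)"
      unfolding case_prod_beta by (intro continuous_intros)
    have "continuous_on ({0..1} \<times> UNIV) (\<lambda>z. f' (snd z))" for S
      by (rule continuous_on_compose2[OF f'c]) (auto intro: continuous_on_snd)
    then show "continuous_on ({0..1} \<times> UNIV) (\<lambda>(t, x). DH t x)"
      unfolding case_prod_beta DH_def by (intro continuous_intros)
    fix t :: real and x assume t: "t \<in> {0..1}"
    show "bij (\<lambda>x. x + t *\<^sub>R f x)" by (rule bij[OF t])
    show "((\<lambda>x. x + t *\<^sub>R f x) has_derivative blinfun_apply (DH t x)) (at x)"
      unfolding DH_def
      by (rule has_derivative_eq_rhs, rule derivative_intros fd)+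
        (auto intro!: derivative_eq_intros fd simp: blinfun.add_left blinfun.scaleR_left)
    show "inj (blinfun_apply (DH t x))"
      unfolding linear_injective_0[OF bounded_linear.linear[OF blinfun.bounded_linear_right]]
    proof (intro allI impI)
      fix v assume "blinfun_apply (DH t x) v = 0"
      then have "v = - (t *\<^sub>R blinfun_apply (f' x) v)"
        by (simp add: DH_def blinfun.add_left blinfun.scaleR_left eq_neg_iff_add_eq_0)
      then have "norm v = t * norm (blinfun_apply (f' x) v)" using t by (metis norm_minus_cancel norm_scaleR abs_of_nonneg atLeastAtMost_iff)
      also have "\<dots> \<le> 1 * (norm (f' x) * norm v)" using t norm_blinfun[of "f' x" v] by (intro mult_mono) auto
      also have "\<dots> \<le> 1 / 2 * norm v" using mult_right_mono[OF f'b[of x], of "norm v"] by simp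
      finally show "v = 0" by simp
    qed
  qed simp
qed

text \<open>The displacement from \<open>g\<close> to \<open>h\<close> is a small field along
  \<open>g\<close>. Its extension \<open>f\<close> gives a bijection \<open>x + f x\<close> of space
  that carries \<open>g\<close> to \<open>h\<close> pointwise; thus \<open>h\<close> inherits
  injectivity and is isotopic to \<open>g\<close>. The bound \<open>e \<le> a\<close> keeps the
  velocity of \<open>h\<close> away from 0.\<close>

lemma C1_close_same_link_class:
  fixes g :: "nat \<Rightarrow> real \<Rightarrow> 'a::euclidean_space"
  assumes lk: "is_link m g"
  shows "\<exists>e>0. \<forall>h h'. (\<forall>i<m. continuous_on UNIV (h' i) \<and> (\<forall>t. h i (t + 1) = h i t \<and> (h i has_vector_derivative h' i t) (at t)
      \<and> norm (h i t - g i t) < e \<and> norm (h' i t - ltan g i t) < e)) \<longrightarrow> is_link m h \<and> same_link_class m g h"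
proof -
  obtain A where A: "A \<ge> 0" "\<And>e (D :: nat \<Rightarrow> real \<Rightarrow> 'a) D'. e \<ge> 0 \<Longrightarrow> link_field m e D D' \<Longrightarrow>
     (\<exists>f f'. C1_bounded (A * e) f f' \<and> (\<forall>i<m. \<forall>t. g i t \<in> link_image m g \<longrightarrow> f (g i t) = D i t))"
    by (rule extension_setE[OF link_extension_set[OF lk]], rule that; assumption)
  obtain a b where ab: "0 < a" "\<And>i t. i < m \<Longrightarrow> a \<le> norm (ltan g i t)"
    using speed_bounds[OF lk] by metis
  define e where "e = min a (1 / (2 * (A + 1)))"
  have e: "e > 0" "A * e \<le> 1 / 2"
  proof -
    show "e > 0" using ab A by (simp add: e_def)
    have "e \<le> 1 / (2 * (A + 1))" by (simp add: e_def)
    then have "A * e \<le> A * (1 / (2 * (A + 1)))" using A by (intro mult_left_mono) auto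
    also have "\<dots> \<le> 1 / 2" using A by (simp add: field_simps)
    finally show "A * e \<le> 1 / 2" .
  qed
  have main: "is_link m h \<and> same_link_class m g h"
    if h: "\<And>i. i < m \<Longrightarrow> continuous_on UNIV (h' i)" "\<And>i t. i < m \<Longrightarrow> h i (t + 1) = h i t"
      "\<And>i t. i < m \<Longrightarrow> (h i has_vector_derivative h' i t) (at t)"
      "\<And>i t. i < m \<Longrightarrow> norm (h i t - g i t) < e" "\<And>i t. i < m \<Longrightarrow> norm (h' i t - ltan g i t) < e" for h h'
  proof -
    have "link_field m e (\<lambda>i t. h i t - g i t) (\<lambda>i t. h' i t - ltan g i t)"
      unfolding link_field_def
      using h link_periodic[OF lk]
      by (auto intro!: continuous_intros ltan_cont[OF lk] has_vector_derivative_diff link_deriv[OF lk] less_imp_le)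
    from A(2)[OF less_imp_le[OF e(1)] this]
    obtain f f' where f: "C1_bounded (A * e) f f'" "\<And>i t. i < m \<Longrightarrow> f (g i t) = h i t - g i t"
      using link_in_image[OF lk] by blast
    have f2: "C1_bounded (1/2) f f'" by (rule C1_bounded_mono[OF f(1) e(2)])
    note iso = small_field_ambient_isotopy[OF f2]
    have hg: "h i t = g i t + f (g i t)" if "i < m" for i t using f(2)[OF that] by simp
    have ltan_h: "ltan h i t = h' i t" if "i < m" for i t
      unfolding ltan_def by (rule vector_derivative_at[OF h(3)[OF that]])
    have lh: "is_link m h"
      unfolding is_link_def
    proof (intro conjI allI impI)
      show "m \<ge> 1" using lk by (simp add: is_link_def)
      fix i assume i: "i < m"
      show "h i (t + 1) = h i t" for t by (rule h(2)[OF i])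
      show "h i differentiable (at t)" for t using h(3)[OF i] by (rule differentiableI_vector)
      have "ltan h i = h' i" using ltan_h[OF i] by auto
      then show "continuous_on UNIV (ltan h i)" using h(1)[OF i] by simp
      show "ltan h i t \<noteq> 0" for t
        using h(5)[OF i, of t] ab(2)[OF i, of t] by (auto simp: ltan_h[OF i] e_def)
    next
      show "inj_on (\<lambda>(i, t). h i t) ({..<m} \<times> {0..<1})"
      proof (rule inj_onI, clarsimp)
        fix i s j t assume 1: "i < m" "0 \<le> s" "s < 1" "j < m" "0 \<le> t" "t < 1" "h i s = h j (t::real)"
        then have "g i s = g j t" using injD[OF bij_is_inj[OF iso(2)], of "g i s" "g j t"] by (simp add: hg)
        moreover have "inj_on (\<lambda>(i, t). g i t) ({..<m} \<times> {0..<1})" using lk by (simp add: is_link_def)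
        ultimately show "i = j \<and> s = t" using 1 inj_onD[of "\<lambda>(i, t). g i t" "{..<m} \<times> {0..<1}" "(i, s)" "(j, t)"] by simp
      qed
    qed
    have img: "(\<lambda>x. x + 1 *\<^sub>R f x) ` link_image m g = link_image m h"
    proof -
      have "(\<lambda>x. x + 1 *\<^sub>R f x) ` link_image m g = (\<lambda>z. g (fst z) (snd z) + f (g (fst z) (snd z))) ` ({..<m} \<times> {0..<1})"
        unfolding link_image_def image_image by (simp add: case_prod_beta)
      also have "\<dots> = (\<lambda>z. h (fst z) (snd z)) ` ({..<m} \<times> {0..<1})"
        by (rule image_cong) (auto simp: hg)
      finally show ?thesis by (simp add: link_image_def case_prod_beta)
    qed
    have "same_link_class m g h" unfolding same_link_class_def
      by (intro conjI exI[of _ "\<lambda>t x. x + t *\<^sub>R f x"] lk lh iso(1) img)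
    then show ?thesis using lh by blast
  qed
  show ?thesis
  proof (rule exI[of _ e], rule conjI[OF e(1)], intro allI impI)
    fix h h' assume "\<forall>i<m. continuous_on UNIV (h' i) \<and> (\<forall>t. h i (t + 1) = h i t \<and> (h i has_vector_derivative h' i t) (at t)
      \<and> norm (h i t - g i t) < e \<and> norm (h' i t - ltan g i t) < e)"
    then show "is_link m h \<and> same_link_class m g h" by (intro main[of h' h]) auto
  qed
qed

theorem theorem1:
  fixes m :: nat and \<gamma> :: "nat \<Rightarrow> real \<Rightarrow> 'a::euclidean_space"
  assumes dim: "DIM('a) \<ge> 2"
    and hyp_i: "\<forall>(p::'a) q v w \<beta> L. md_minimizer p q v w \<beta> L \<longrightarrow>
                  smooth_curv1_pos_torsion \<beta> L \<or> arcs_and_segment \<beta> L"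
    and hyp_ii: "\<forall>(\<beta>::real \<Rightarrow> 'a) L a b. CCC_curve \<beta> L a b \<and> b - a < pi \<longrightarrow>
                  \<not> md_minimizer (\<beta> 0) (\<beta> L) (tangent \<beta> L 0) (tangent \<beta> L L) \<beta> L"
    and link: "is_link m \<gamma>"
    and C11: "C11_link m \<gamma>"
    and relmin: "ropelength_rel_min m \<gamma>"
  shows "NIR m \<gamma> = DCSD m \<gamma> / 2"
proof (rule ccontr)
  assume ne: "NIR m \<gamma> \<noteq> DCSD m \<gamma> / 2"
  define R where "R = NIR m \<gamma>"
  have R: "R > 0" using C11_NIR_pos[OF link C11] by (simp add: R_def)
  have RD: "2 * R < DCSD m \<gamma>" using NIR_le_half_DCSD[OF link] ne by (simp add: R_def)
  have cv: "curv_le (1 / R) m \<gamma>"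
    using avoids_tangent_balls_imp_curv_le[OF link R] NIR_avoids_tangent_balls[OF link] R by (simp add: R_def)
  have m: "0 < m" using link by (simp add: is_link_def)
  obtain S G T and l :: real where A: "l > 0" "S 0 = 0" "\<And>s. G (s + l) = G s" "\<And>s. T (s + l) = T s"
    "\<And>s. norm (T s) = 1" "\<And>t. \<gamma> 0 t = G (S t)" "\<And>t. T (S t) = sgn (ltan \<gamma> 0 t)"
    "\<And>t. S (t + 1) = S t + l" "strict_mono S" "surj S"
    "\<And>s. (G has_vector_derivative T s) (at s)" "\<And>t. (S has_real_derivative norm (ltan \<gamma> 0 t)) (at t)"
    "\<And>s t. s \<le> t \<Longrightarrow> integral {s..t} (\<lambda>r. norm (ltan \<gamma> 0 r)) = S t - S s"
    by (rule arclength[OF link m], rule that; assumption)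
  note Tlip = curv_le_imp_lipschitz[OF cv m A(9,10,7,13)]
  \<comment> \<open>Only component 0 is varied. Scaling by \<open>1 / R\<close> turns its curvature
    bound \<open>1 / R\<close> into 1.\<close>
  define G1 where "G1 s = (1 / R) *\<^sub>R G (R * s)" for s
  define T1 where "T1 s = T (R * s)" for s
  define l1 where "l1 = l / R"
  have Rl1: "R * (s + l1) = R * s + l" for s using R by (simp add: l1_def field_simps)
  have G1': "(G1 has_vector_derivative T1 s) (at s)" for s
  proof -
    have "((\<lambda>s. R * s) has_real_derivative R) (at s)" by (auto intro!: derivative_eq_intros)
    then have "(G \<circ> (\<lambda>s. R * s) has_vector_derivative R *\<^sub>R T (R * s)) (at s)"
      by (intro vector_diff_chain_at A(11)) (simp add: has_real_derivative_iff_has_vector_derivative)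
    then have "((\<lambda>s. (1 / R) *\<^sub>R (G \<circ> (\<lambda>s. R * s)) s) has_vector_derivative (1 / R) *\<^sub>R R *\<^sub>R T (R * s)) (at s)"
      by (rule bounded_linear.has_vector_derivative[OF bounded_linear_scaleR_right])
    then show ?thesis using R by (simp add: G1_def[abs_def] T1_def o_def)
  qed
  have T1lip: "norm (T1 t - T1 s) \<le> 1 * \<bar>t - s\<bar>" for s t
  proof -
    have "norm (T1 t - T1 s) \<le> 1 / R * \<bar>R * t - R * s\<bar>" unfolding T1_def by (rule Tlip)
    also have "\<bar>R * t - R * s\<bar> = R * \<bar>t - s\<bar>" using R by (simp add: abs_mult flip: right_diff_distrib)
    finally show ?thesis using R by simp
  qed
  have per: "T1 (s + l1) = T1 s" "G1 (s + l1) = G1 s" for s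
    unfolding T1_def G1_def Rl1 by (simp_all add: A)
  obtain u where u: "u \<in> borel_measurable borel" "\<And>t. norm (u t) \<le> 1" "\<And>t. u (t + l1) = u t" "indef_integral T1 u"
    by (rule lipschitz_density[of T1 1 l1, OF T1lip per(1)], rule that; assumption)
  interpret closed_curve G1 T1 u l1
    by unfold_locales (use A R G1' per u in \<open>auto simp: l1_def T1_def\<close>)
  obtain e1 where e1: "e1 > 0" "\<And>h h'. (\<forall>i<m. continuous_on UNIV (h' i) \<and> (\<forall>t. h i (t + 1) = h i t \<and> (h i has_vector_derivative h' i t) (at t)
      \<and> norm (h i t - \<gamma> i t) < e1 \<and> norm (h' i t - ltan \<gamma> i t) < e1)) \<Longrightarrow> is_link m h \<and> same_link_class m \<gamma> h"
    using C1_close_same_link_class[OF link] by blast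
  obtain e2 where e2: "e2 > 0" "\<And>h i j s t. is_link m h \<Longrightarrow> C1_close e2 m \<gamma> h \<Longrightarrow> i < m \<Longrightarrow> j < m \<Longrightarrow>
     crit_pair h i s j t \<Longrightarrow> 2 * R \<le> norm (h j t - h i s)"
    using DCSD_lower_semicont[OF link R RD] by blast
  obtain e3 where e3: "e3 > 0" "\<And>h. same_link_class m \<gamma> h \<Longrightarrow> C1_close e3 m \<gamma> h \<Longrightarrow> ropelength m \<gamma> \<le> ropelength m h"
    using relmin unfolding ropelength_rel_min_def C1_close_def by blast
  \<comment> \<open>Within \<open>e1\<close> the link class is preserved, within \<open>e2\<close>
    no critical pair is shorter than \<open>2 * R\<close>, and within \<open>e3\<close> the
    minimality applies.\<close>
  define e where "e = min e1 (min e2 e3)"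
  have e: "e > 0" "e \<le> e1" "e \<le> e2" "e \<le> e3" using e1 e2 e3 by (auto simp: e_def)
  obtain b where b: "0 < b" "\<And>t. norm (ltan \<gamma> 0 t) \<le> b"
    using speed_bounds[OF link] m by (meson less_le_trans)
  \<comment> \<open>Undoing the scaling multiplies deviations of position by \<open>R\<close> and
    deviations of velocity by the speed, which is at most \<open>b\<close>.\<close>
  define d where "d = e / (R + b)"
  have d: "d > 0" "R * d < e" "b * d < e"
    using e(1) R b by (auto simp: d_def field_simps)
  have no_semicircle: "\<nexists>a. T1 (a + pi) = - T1 a \<and> (G1 (a + pi) - G1 a) \<bullet> T1 a = 0 \<and> norm (G1 (a + pi) - G1 a) = 2"
  proof
    assume "\<exists>a. T1 (a + pi) = - T1 a \<and> (G1 (a + pi) - G1 a) \<bullet> T1 a = 0 \<and> norm (G1 (a + pi) - G1 a) = 2"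
    then obtain a where a: "T1 (a + pi) = - T1 a" "(G1 (a + pi) - G1 a) \<bullet> T1 a = 0" "norm (G1 (a + pi) - G1 a) = 2" by blast
    obtain s t where st: "R * a = S s" "R * (a + pi) = S t" using A(10) by (meson surjD)
    have eq: "\<gamma> 0 t - \<gamma> 0 s = R *\<^sub>R (G1 (a + pi) - G1 a)"
      using R by (simp add: A(6) G1_def st scaleR_diff_right)
    have lt: "ltan \<gamma> 0 s = norm (ltan \<gamma> 0 s) *\<^sub>R T1 a" "ltan \<gamma> 0 t = norm (ltan \<gamma> 0 t) *\<^sub>R T1 (a + pi)"
      using ltan_nonzero[OF link m] by (auto simp: T1_def st A(7) sgn_div_norm)
    have n: "norm (\<gamma> 0 t - \<gamma> 0 s) = 2 * R" unfolding eq using a(3) R by simp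
    have "(\<gamma> 0 t - \<gamma> 0 s) \<bullet> ltan \<gamma> 0 s = 0" unfolding eq by (subst lt(1)) (simp add: a(2))
    moreover have "(\<gamma> 0 t - \<gamma> 0 s) \<bullet> ltan \<gamma> 0 t = 0" unfolding eq by (subst lt(2)) (simp add: a(1,2))
    ultimately have "crit_pair \<gamma> 0 s 0 t" using n R by (auto simp: crit_pair_def)
    from DCSD_le_crit[OF m m this] show False using n RD by simp
  qed
  obtain G2 Z2 L where sh: "\<And>t. (G2 has_vector_derivative Z2 t) (at t)" "continuous_on UNIV Z2"
    "\<And>t. G2 (t + l1) = G2 t" "\<And>t. norm (Z2 t - T1 t) < d" "\<And>t. norm (G2 t - G1 t) < d"
    "\<And>t. (L has_real_derivative norm (Z2 t)) (at t)"
    "\<And>s t. s \<le> t \<Longrightarrow> norm (sgn (Z2 t) - sgn (Z2 s)) \<le> L t - L s"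
    "L l1 - L 0 < l1"
    by (rule semicircle_or_shorten[OF no_semicircle d(1)], rule that; assumption)
  define sp where "sp t = norm (ltan \<gamma> 0 t)" for t
  have sp: "sp t > 0" for t using ltan_nonzero[OF link m] by (simp add: sp_def)
  \<comment> \<open>The shortened curve is run through with the arclength \<open>S\<close> of the
    original component, not with its own. The velocity is then the original speed times
    \<open>Z2\<close>, hence close to the original velocity.\<close>
  define h where "h i = (if i = 0 then (\<lambda>t. R *\<^sub>R G2 (S t / R)) else \<gamma> i)" for i :: nat
  define h' where "h' i = (if i = 0 then (\<lambda>t. sp t *\<^sub>R Z2 (S t / R)) else ltan \<gamma> i)" for i :: nat
  have S': "((\<lambda>t. S t / R) has_real_derivative sp t / R) (at t)" for t
    using DERIV_cdivide[OF A(12), of R t] by (simp add: sp_def)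
  have Sc: "continuous_on UNIV (\<lambda>t. S t / R)"
    using S' by (meson DERIV_isCont continuous_at_imp_continuous_on)
  have h'_deriv: "(h i has_vector_derivative h' i t) (at t)" if i: "i < m" for i t
  proof (cases "i = 0")
    case True
    have "(G2 \<circ> (\<lambda>t. S t / R) has_vector_derivative (sp t / R) *\<^sub>R Z2 (S t / R)) (at t)"
      using S' by (intro vector_diff_chain_at sh(1)) (simp add: has_real_derivative_iff_has_vector_derivative)
    then have "((\<lambda>t. R *\<^sub>R (G2 \<circ> (\<lambda>t. S t / R)) t) has_vector_derivative R *\<^sub>R (sp t / R) *\<^sub>R Z2 (S t / R)) (at t)"
      by (rule bounded_linear.has_vector_derivative[OF bounded_linear_scaleR_right])
    then show ?thesis using R True by (simp add: h_def h'_def o_def)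
  next
    case False
    then show ?thesis using link_deriv[OF link i] by (simp add: h_def h'_def)
  qed
  have ltan_h: "ltan h i = h' i" if "i < m" for i
    unfolding ltan_def using vector_derivative_at[OF h'_deriv[OF that]] by auto
  have close: "norm (h i t - \<gamma> i t) < e \<and> norm (h' i t - ltan \<gamma> i t) < e" for i t
  proof (cases "i = 0")
    case True
    define x where "x = S t / R"
    have Rx: "R * x = S t" using R by (simp add: x_def)
    have "h 0 t - \<gamma> 0 t = R *\<^sub>R (G2 x - G1 x)"
      using R by (simp add: h_def x_def[symmetric] G1_def Rx A(6) scaleR_diff_right)
    then have "norm (h 0 t - \<gamma> 0 t) = R * norm (G2 x - G1 x)" using R by simp
    also have "\<dots> \<le> R * d" using sh(5)[of x] R by (intro mult_left_mono) auto
    finally have 1: "norm (h 0 t - \<gamma> 0 t) < e" using d(2) by simp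
    have "ltan \<gamma> 0 t = sp t *\<^sub>R T1 x"
      using ltan_nonzero[OF link m] by (simp add: T1_def Rx A(7) sgn_div_norm sp_def)
    then have "h' 0 t - ltan \<gamma> 0 t = sp t *\<^sub>R (Z2 x - T1 x)"
      by (simp add: h'_def x_def[symmetric] scaleR_diff_right)
    then have "norm (h' 0 t - ltan \<gamma> 0 t) = sp t * norm (Z2 x - T1 x)" using sp[of t] by simp
    also have "\<dots> \<le> b * d" using sh(4)[of x] b by (intro mult_mono) (auto simp: sp_def)
    finally have "norm (h' 0 t - ltan \<gamma> 0 t) < e" using d(3) by simp
    then show ?thesis using 1 True by simp
  next
    case False
    then show ?thesis using e(1) by (simp add: h_def h'_def)
  qed
  have h_per: "h i (t + 1) = h i t" if i: "i < m" for i t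
  proof (cases "i = 0")
    case True
    have "S (t + 1) / R = S t / R + l1" by (simp add: A(8) l1_def add_divide_distrib)
    then show ?thesis using True by (simp add: h_def sh(3))
  next
    case False
    then show ?thesis using link_periodic[OF link i] by (simp add: h_def)
  qed
  have h'_cont: "continuous_on UNIV (h' i)" if i: "i < m" for i
  proof (cases "i = 0")
    case True
    have "continuous_on UNIV (\<lambda>t. sp t *\<^sub>R Z2 (S t / R))"
      unfolding sp_def
      by (intro continuous_on_scaleR continuous_on_norm ltan_cont[OF link m] continuous_on_compose2[OF sh(2) Sc]) simp
    then show ?thesis using True by (simp add: h'_def)
  next
    case False
    then show ?thesis using ltan_cont[OF link i] by (simp add: h'_def)
  qed
  have "norm (h i t - \<gamma> i t) < e1 \<and> norm (h' i t - ltan \<gamma> i t) < e1" for i t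
    using close[of i t] e(2) by linarith
  then have "is_link m h \<and> same_link_class m \<gamma> h"
    using h_per h'_cont h'_deriv by (intro e1(2)[of h' h]) blast
  then have lh: "is_link m h" and same: "same_link_class m \<gamma> h" by auto
  have C1c: "C1_close c m \<gamma> h" if "e \<le> c" for c
    unfolding C1_close_def using close ltan_h that by (metis less_le_trans)
  \<comment> \<open>Up to scale, \<open>L\<close> is the arclength of the shortened curve. This one
    formula gives both its length and its curvature bound.\<close>
  have len0: "integral {s..t} (\<lambda>r. norm (ltan h 0 r)) = R * (L (S t / R) - L (S s / R))" if st: "s \<le> t" for s t
  proof -
    have "((\<lambda>r. R * L (S r / R)) has_vector_derivative norm (ltan h 0 r)) (at r)" for r
    proof -
      have "((\<lambda>r. R * L (S r / R)) has_real_derivative R * (norm (Z2 (S r / R)) * (sp r / R))) (at r)"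
        by (rule DERIV_cmult[OF DERIV_chain2[OF sh(6) S']])
      moreover have "R * (norm (Z2 (S r / R)) * (sp r / R)) = norm (ltan h 0 r)"
        using R sp[of r] by (simp add: ltan_h[OF m] h'_def)
      ultimately show ?thesis by (simp add: has_real_derivative_iff_has_vector_derivative)
    qed
    then have "((\<lambda>r. norm (ltan h 0 r)) has_integral (R * L (S t / R) - R * L (S s / R))) {s..t}"
      by (intro fundamental_theorem_of_calculus[OF st]) (rule has_vector_derivative_at_within)
    then show ?thesis by (simp add: integral_unique right_diff_distrib)
  qed
  have ltan_other: "ltan h i = ltan \<gamma> i" if "i \<noteq> 0" for i
    using that by (simp add: ltan_def[abs_def] h_def)
  have cvh: "curv_le (1 / R) m h"
    unfolding curv_le_def
  proof (intro allI impI)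
    fix i s t assume i: "i < m" and st: "(s::real) \<le> t"
    show "norm (sgn (ltan h i t) - sgn (ltan h i s)) \<le> 1 / R * integral {s..t} (\<lambda>r. norm (ltan h i r))"
    proof (cases "i = 0")
      case True
      have "S s / R \<le> S t / R" using st A(9) R by (simp add: strict_mono_less_eq divide_right_mono)
      moreover have "sgn (ltan h 0 x) = sgn (Z2 (S x / R))" for x
        using sp[of x] by (simp add: ltan_h[OF m] h'_def sgn_scaleR)
      ultimately show ?thesis using sh(7) R unfolding True len0[OF st] by simp
    next
      case False
      then show ?thesis using cv i st unfolding curv_le_def by (simp add: ltan_other)
    qed
  qed
  have "avoids_tangent_balls R m h"
    by (rule curv_le_imp_avoids_tangent_balls[OF lh R cvh]) (rule e2(2)[OF lh C1c[OF e(3)]])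
  then have NIRh: "R \<le> NIR m h" by (rule NIR_ge[OF lh R])
  have shorter: "link_length m h < link_length m \<gamma>"
    unfolding link_length_def
  proof (rule sum_strict_mono_ex1)
    have "integral {0..1} (\<lambda>t. norm (ltan h 0 t)) = R * (L l1 - L 0)"
      using len0[of 0 1] A(2) A(8)[of 0] by (simp add: l1_def)
    also have "\<dots> < R * l1" using sh(8) R by (intro mult_strict_left_mono) auto
    also have "\<dots> = integral {0..1} (\<lambda>t. norm (ltan \<gamma> 0 t))"
      using A(13)[of 0 1] A(2) A(8)[of 0] R by (simp add: l1_def)
    finally have lt: "integral {0..1} (\<lambda>t. norm (ltan h 0 t)) < integral {0..1} (\<lambda>t. norm (ltan \<gamma> 0 t))" .
    then show "\<exists>i\<in>{..<m}. integral {0..1} (\<lambda>t. norm (ltan h i t)) < integral {0..1} (\<lambda>t. norm (ltan \<gamma> i t))"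
      using m by blast
    show "\<forall>i\<in>{..<m}. integral {0..1} (\<lambda>t. norm (ltan h i t)) \<le> integral {0..1} (\<lambda>t. norm (ltan \<gamma> i t))"
    proof
      fix i show "integral {0..1} (\<lambda>t. norm (ltan h i t)) \<le> integral {0..1} (\<lambda>t. norm (ltan \<gamma> i t))"
        using lt ltan_other[of i] by (cases "i = 0") auto
    qed
  qed simp
  have len_nonneg: "0 \<le> link_length m h"
    unfolding link_length_def
    by (intro sum_nonneg integral_nonneg integrable_continuous_real continuous_on_norm
        continuous_on_subset[OF ltan_cont[OF lh]]) auto
  have "ropelength m \<gamma> \<le> ropelength m h" by (rule e3(2)[OF same C1c[OF e(4)]])
  then have "link_length m \<gamma> / R \<le> link_length m h / NIR m h"
    using R NIRh unfolding ropelength_def by (simp add: R_def)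
  also have "\<dots> \<le> link_length m h / R" using NIRh R len_nonneg by (intro divide_left_mono) auto
  also have "\<dots> < link_length m \<gamma> / R" using shorter R by (rule divide_strict_right_mono)
  finally show False by simp
qed

end
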